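(* Let $G$ be a locally compact group, and let $\mu$ be the smallest cardinality of a neighborhood basis about $e\in G$. If $\mu=\aleph_0$, then $P_1(\widehat G)$ contains an orthogonal TI-sequence.
   Context: All groups are Hausdorff. Let $\lambda$ be the left regular representation of $G$ on $L_2(G)$, and $VN(G)=\lambda[G]''$. The Fourier algebra $A(G)$ is the predual of $VN(G)$; it consists of the functions $u_{f,g}(x)=\langle\lambda(x)f,g\rangle$ on $G$, $f,g\in L_2(G)$, with duality $\langle T,u_{f,g}\rangle=\langle Tf,g\rangle$ for $T\in VN(G)$, norm $\|u\|=\sup_{\|T\|=1}|\langle T,u\rangle|$, and pointwise multiplication. $P_1(\widehat G)=\{u\in A(G):\|u\|=u(e)=1\}$ is the set of normal states on $VN(G)$. The support $S(u)$ of a normal state $u$ is the infimum of all (orthogonal) projections $P\in VN(G)$ with $\langle P,u\rangle=1$. Normal states $u,v$ are orthogonal if $S(u)S(v)=0$; a sequence of normal states is orthogonal if its terms are pairwise orthogonal. A sequence $\{u_n\}\subset P_1(\widehat G)$ is a TI-sequence if $\lim_n\|vu_n-u_n\|=0$ for all $v\in P_1(\widehat G)$. (The symbol $\widehat G$ is only notation; $G$ need not be abelian.) *)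

theory Defs
  imports "HOL-Analysis.Analysis"
begin

unbundle cardinal_syntax

text \<open>
  The library's topological groups are the type class \<open>topological_group_add\<close>. Its group law is
  written additively but is not assumed to be commutative: \<open>x + y\<close> is the product, \<open>- x\<close> the
  inverse and \<open>0\<close> the identity \<open>e\<close> of \<open>G\<close>.
\<close>

section \<open>Local weight and Haar measure\<close>

definition nhds_basis :: "'a::topological_space \<Rightarrow> 'a set set \<Rightarrow> bool" where
  "nhds_basis x \<B> \<longleftrightarrow>
     (\<forall>V\<in>\<B>. x \<in> interior V) \<and> (\<forall>U. open U \<longrightarrow> x \<in> U \<longrightarrow> (\<exists>V\<in>\<B>. V \<subseteq> U))"

text \<open>The smallest cardinality of a neighbourhood basis at \<open>x\<close> is that of the cardinal \<open>r\<close>.\<close>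

definition local_weight_is :: "'a::topological_space \<Rightarrow> 'b rel \<Rightarrow> bool" where
  "local_weight_is x r \<longleftrightarrow>
     (\<exists>\<B>. nhds_basis x \<B> \<and> |\<B>| =o r) \<and> (\<forall>\<B>. nhds_basis x \<B> \<longrightarrow> r \<le>o |\<B>| )"

definition left_Haar_measure :: "'a::{topological_group_add, t2_space} measure \<Rightarrow> bool" where
  "left_Haar_measure m \<longleftrightarrow>
     sets m = sets borel \<and>
     emeasure m UNIV \<noteq> 0 \<and>
     (\<forall>x. \<forall>A\<in>sets borel. emeasure m ((+) x ` A) = emeasure m A) \<and>
     (\<forall>K. compact K \<longrightarrow> emeasure m K < \<infinity>) \<and>
     (\<forall>A\<in>sets borel. emeasure m A = (INF U\<in>{U. open U \<and> A \<subseteq> U}. emeasure m U)) \<and>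
     (\<forall>U. open U \<longrightarrow> emeasure m U = (SUP K\<in>{K. compact K \<and> K \<subseteq> U}. emeasure m K))"

section \<open>The Hilbert space of square-integrable functions and its operators\<close>

text \<open>
  Vectors are square-integrable functions and operators act on such functions; both are
  considered up to equality almost everywhere, so equations between vectors are \<open>L2_eq\<close>.
\<close>

definition L2 :: "'a measure \<Rightarrow> ('a \<Rightarrow> complex) set" where
  "L2 m = {f \<in> borel_measurable m. integrable m (\<lambda>x. (cmod (f x))\<^sup>2)}"

definition L2_eq :: "'a measure \<Rightarrow> ('a \<Rightarrow> complex) \<Rightarrow> ('a \<Rightarrow> complex) \<Rightarrow> bool" where
  "L2_eq m f g \<longleftrightarrow> (AE x in m. f x = g x)"

definition L2_inner :: "'a measure \<Rightarrow> ('a \<Rightarrow> complex) \<Rightarrow> ('a \<Rightarrow> complex) \<Rightarrow> complex" where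
  "L2_inner m f g = (\<integral>x. f x * cnj (g x) \<partial>m)"

definition L2_nrm :: "'a measure \<Rightarrow> ('a \<Rightarrow> complex) \<Rightarrow> real" where
  "L2_nrm m f = sqrt (\<integral>x. (cmod (f x))\<^sup>2 \<partial>m)"

type_synonym 'a operator = "('a \<Rightarrow> complex) \<Rightarrow> ('a \<Rightarrow> complex)"

definition bounded_op :: "'a measure \<Rightarrow> 'a operator \<Rightarrow> bool" where
  "bounded_op m T \<longleftrightarrow>
     (\<forall>f\<in>L2 m. T f \<in> L2 m) \<and>
     (\<forall>f\<in>L2 m. \<forall>g\<in>L2 m. L2_eq m (T (\<lambda>x. f x + g x)) (\<lambda>x. T f x + T g x)) \<and>
     (\<forall>c. \<forall>f\<in>L2 m. L2_eq m (T (\<lambda>x. c * f x)) (\<lambda>x. c * T f x)) \<and>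
     (\<exists>C. \<forall>f\<in>L2 m. L2_nrm m (T f) \<le> C * L2_nrm m f)"

definition op_nrm :: "'a measure \<Rightarrow> 'a operator \<Rightarrow> real" where
  "op_nrm m T = (SUP f\<in>{f \<in> L2 m. L2_nrm m f \<le> 1}. L2_nrm m (T f))"

definition commutant :: "'a measure \<Rightarrow> 'a operator set \<Rightarrow> 'a operator set" where
  "commutant m \<S> = {T. bounded_op m T \<and> (\<forall>A\<in>\<S>. \<forall>f\<in>L2 m. L2_eq m (T (A f)) (A (T f)))}"

definition projection_op :: "'a measure \<Rightarrow> 'a operator \<Rightarrow> bool" where
  "projection_op m P \<longleftrightarrow>
     bounded_op m P \<and>
     (\<forall>f\<in>L2 m. L2_eq m (P (P f)) (P f)) \<and>
     (\<forall>f\<in>L2 m. \<forall>g\<in>L2 m. L2_inner m (P f) g = L2_inner m f (P g))"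

text \<open>The order of projections: the range of \<open>P\<close> is contained in the range of \<open>Q\<close>.\<close>

definition proj_le :: "'a measure \<Rightarrow> 'a operator \<Rightarrow> 'a operator \<Rightarrow> bool" where
  "proj_le m P Q \<longleftrightarrow> (\<forall>f\<in>L2 m. L2_eq m (Q (P f)) (P f))"

section \<open>The group von Neumann algebra and the Fourier algebra\<close>

definition left_regular :: "'a::group_add \<Rightarrow> 'a operator" where
  "left_regular x f = (\<lambda>y. f (- x + y))"

definition VN :: "'a::group_add measure \<Rightarrow> 'a operator set" where
  "VN m = commutant m (commutant m (range left_regular))"

definition coeff_fun ::
    "'a::group_add measure \<Rightarrow> ('a \<Rightarrow> complex) \<Rightarrow> ('a \<Rightarrow> complex) \<Rightarrow> 'a \<Rightarrow> complex" where
  "coeff_fun m f g = (\<lambda>x. L2_inner m (left_regular x f) g)"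

definition Fourier_algebra :: "'a::group_add measure \<Rightarrow> ('a \<Rightarrow> complex) set" where
  "Fourier_algebra m = {coeff_fun m f g | f g. f \<in> L2 m \<and> g \<in> L2 m}"

text \<open>The predual of \<open>VN(G)\<close>: the ultraweakly continuous functionals.\<close>

definition normal_functional :: "'a::group_add measure \<Rightarrow> ('a operator \<Rightarrow> complex) \<Rightarrow> bool" where
  "normal_functional m \<phi> \<longleftrightarrow>
     (\<exists>f g. (\<forall>i::nat. f i \<in> L2 m \<and> g i \<in> L2 m) \<and>
        summable (\<lambda>i. (L2_nrm m (f i))\<^sup>2) \<and> summable (\<lambda>i. (L2_nrm m (g i))\<^sup>2) \<and>
        (\<forall>T\<in>VN m. \<phi> T = (\<Sum>i. L2_inner m (T (f i)) (g i))))"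

lemma normal_functional_vector:
  assumes "f \<in> L2 m" "g \<in> L2 m"
  shows "normal_functional m (\<lambda>T. L2_inner m (T f) g)"
proof -
  let ?z = "\<lambda>_. 0 :: complex"
  let ?f = "\<lambda>i::nat. if i = 0 then f else ?z" and ?g = "\<lambda>i::nat. if i = 0 then g else ?z"
  have z: "?z \<in> L2 m" "L2_nrm m ?z = 0"
    by (simp_all add: L2_def L2_nrm_def)
  have s: "summable (\<lambda>i. (L2_nrm m (if i = 0 then h else ?z))\<^sup>2)" for h :: "'a \<Rightarrow> complex"
    by (rule summable_finite[of "{0::nat}"]) (auto simp: z)
  have "(\<Sum>i. L2_inner m (T (?f i)) (?g i)) = (\<Sum>i\<in>{0}. L2_inner m (T (?f i)) (?g i))" for T
    by (rule suminf_finite) (auto simp: L2_inner_def)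
  then have "\<forall>T\<in>VN m. L2_inner m (T f) g = (\<Sum>i. L2_inner m (T (?f i)) (?g i))"
    by simp
  moreover have "\<forall>i. ?f i \<in> L2 m \<and> ?g i \<in> L2 m"
    using assms z by simp
  ultimately show ?thesis
    unfolding normal_functional_def using s[of f] s[of g]
    by (intro exI[of _ ?f] exI[of _ ?g] conjI)
qed

text \<open>
  The duality between \<open>VN(G)\<close> and its predual: \<open>u\<close> corresponds to the normal functional \<open>\<phi>\<close> with
  \<open>\<phi> (\<lambda>(x)) = u x\<close>, which is determined on \<open>VN(G)\<close> because the translations span an ultraweakly
  dense subspace. For \<open>u = coeff_fun m f g\<close> this functional is \<open>T \<mapsto> L2_inner m (T f) g\<close>
  (see \<open>normal_functional_vector\<close>). Allowing series of such functionals gives sums and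
  products of coefficient functions a value without presupposing Eymard's theorem that they
  are again single coefficient functions.
\<close>

definition duality :: "'a::group_add measure \<Rightarrow> 'a operator \<Rightarrow> ('a \<Rightarrow> complex) \<Rightarrow> complex" where
  "duality m T u =
     (THE c. \<exists>\<phi>. normal_functional m \<phi> \<and> (\<forall>x. \<phi> (left_regular x) = u x) \<and> c = \<phi> T)"

definition Fourier_nrm :: "'a::group_add measure \<Rightarrow> ('a \<Rightarrow> complex) \<Rightarrow> real" where
  "Fourier_nrm m u = (SUP T\<in>{T \<in> VN m. op_nrm m T = 1}. cmod (duality m T u))"

definition normal_states :: "'a::group_add measure \<Rightarrow> ('a \<Rightarrow> complex) set" where
  "normal_states m = {u \<in> Fourier_algebra m. Fourier_nrm m u = 1 \<and> u 0 = 1}"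

section \<open>Supports, orthogonality and TI-sequences\<close>

definition VN_projections :: "'a::group_add measure \<Rightarrow> 'a operator set" where
  "VN_projections m = {P \<in> VN m. projection_op m P}"

definition is_proj_Inf :: "'a::group_add measure \<Rightarrow> 'a operator set \<Rightarrow> 'a operator \<Rightarrow> bool" where
  "is_proj_Inf m \<P> S \<longleftrightarrow>
     S \<in> VN_projections m \<and> (\<forall>P\<in>\<P>. proj_le m S P) \<and>
     (\<forall>R\<in>VN_projections m. (\<forall>P\<in>\<P>. proj_le m R P) \<longrightarrow> proj_le m R S)"

text \<open>The infimum exists and is unique up to \<open>L2_eq\<close>, so \<open>SOME\<close> only picks a representative.\<close>

definition state_support :: "'a::group_add measure \<Rightarrow> ('a \<Rightarrow> complex) \<Rightarrow> 'a operator" where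
  "state_support m u = (SOME S. is_proj_Inf m {P \<in> VN_projections m. duality m P u = 1} S)"

definition orthogonal_states ::
    "'a::group_add measure \<Rightarrow> ('a \<Rightarrow> complex) \<Rightarrow> ('a \<Rightarrow> complex) \<Rightarrow> bool" where
  "orthogonal_states m u v \<longleftrightarrow>
     (\<forall>f\<in>L2 m. L2_eq m (state_support m u (state_support m v f)) (\<lambda>_. 0))"

definition orthogonal_sequence ::
    "'a::group_add measure \<Rightarrow> (nat \<Rightarrow> 'a \<Rightarrow> complex) \<Rightarrow> bool" where
  "orthogonal_sequence m u \<longleftrightarrow> (\<forall>i j. i \<noteq> j \<longrightarrow> orthogonal_states m (u i) (u j))"

definition TI_sequence :: "'a::group_add measure \<Rightarrow> (nat \<Rightarrow> 'a \<Rightarrow> complex) \<Rightarrow> bool" where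
  "TI_sequence m u \<longleftrightarrow>
     (\<forall>n. u n \<in> normal_states m) \<and>
     (\<forall>v\<in>normal_states m.
        (\<lambda>n. Fourier_nrm m (\<lambda>x. v x * u n x - u n x)) \<longlonglongrightarrow> 0)"

end

theory Submission
  imports Defs
begin

text \<open>
  A vector state \<open>u = \<langle>\<lambda>(\<cdot>) h, h\<rangle>\<close> with \<open>h\<close> concentrated near the identity is almost a
  topologically invariant mean: by Fell's absorption principle, \<open>v u - u\<close> for
  \<open>v = \<langle>\<lambda>(\<cdot>) f, g\<rangle>\<close> is small as soon as \<open>f\<close> and \<open>g\<close> are almost invariant under the
  translations by elements of the region where \<open>h\<close> lives. The support of \<open>u\<close> lies below every
  projection of \<open>VN(G)\<close> that fixes \<open>h\<close>, so it suffices to find such \<open>h\<^sub>n\<close> in the ranges of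
  pairwise orthogonal projections of \<open>VN(G)\<close>. Let \<open>A\<close> be the average of the translations over a
  neighbourhood \<open>V\<close> of the identity. It almost fixes a given function when \<open>V\<close> is small, but, \<open>G\<close>
  not being discrete, it almost annihilates all functions that are concentrated enough. Hence the
  spectral projection of \<open>A\<^sup>* A\<close> for \<open>[1/2, \<infinity>)\<close> almost fixes the given function and almost
  annihilates the concentrated ones; compressing to the complement of the projections found before
  yields the orthogonal sequence inductively.
\<close>

section \<open>Real Hilbert spaces\<close>

text \<open>The Haar measure need not be sigma-finite, so neither Fubini's theorem nor a countable
  orthonormal basis of L2 is at hand. Hence averages of translations are defined weakly, by a
  bounded form, and integrated in one variable at a time, and the absorption principle is run with
  an orthonormal sequence that is complete only for the orbit of \<open>g\<close> over a
  sigma-compact set that carries \<open>h\<close>. The product of two coefficient functions becomes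
  a normal functional given by a series; \<open>duality\<close> can be evaluated at it because a
  normal functional is determined by its values at translations, which is the bicommutant argument.
  The invariant of the induction is that the sum of the projections found so far still tends to zero
  on normalised indicators of shrinking neighbourhoods, so that its complement moves concentrated
  functions very little. Countability of the neighbourhood basis supplies the shrinking
  neighbourhoods, and minimality of the weight supplies non-discreteness. The Hilbert space
  arguments use the real inner product; complex linearity is recorded as commuting with
  \<open>cmul\<close>.\<close>

lemma subspace_closure:
  fixes S :: "'a::real_normed_vector set"
  assumes "subspace S"
  shows "subspace (closure S)"
proof (rule subspaceI)
  show "0 \<in> closure S" using assms subspace_0 closure_subset by blast
next
  fix x y assume "x \<in> closure S" "y \<in> closure S"
  then obtain a b where "\<And>n. a n \<in> S" "a \<longlonglongrightarrow> x" "\<And>n. b n \<in> S" "b \<longlonglongrightarrow> y"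
    unfolding closure_sequential by blast
  then show "x + y \<in> closure S"
    unfolding closure_sequential
    by (intro exI[of _ "\<lambda>n. a n + b n"]) (auto intro: tendsto_add subspace_add assms)
next
  fix x :: 'a and c :: real assume "x \<in> closure S"
  then obtain a where "\<And>n. a n \<in> S" "a \<longlonglongrightarrow> x"
    unfolding closure_sequential by blast
  then show "c *\<^sub>R x \<in> closure S"
    unfolding closure_sequential
    by (intro exI[of _ "\<lambda>n. c *\<^sub>R a n"]) (auto intro: tendsto_scaleR tendsto_const subspace_scale assms)
qed

text \<open>Continuity and linearity carry invariance from generators to their closed span. In this
  way the closed subspaces below are seen to be invariant under translations, complex scalars and
  lifted operators.\<close>

lemma bounded_linear_closure_span_subset:
  fixes T :: "'a::real_normed_vector \<Rightarrow> 'b::real_normed_vector"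
  assumes "bounded_linear T" "T ` A \<subseteq> closure (span B)"
  shows "T ` closure (span A) \<subseteq> closure (span B)"
proof -
  interpret bounded_linear T by fact
  have "T ` span A \<subseteq> closure (span B)"
  proof -
    have "T ` span A = span (T ` A)"
      by (simp add: linear_axioms linear_span_image)
    also have "\<dots> \<subseteq> closure (span B)"
      by (intro span_minimal assms subspace_closure subspace_span)
    finally show ?thesis .
  qed
  then show ?thesis
    by (intro image_closure_subset) (auto intro: continuous_on linear_continuous_on assms)
qed

lemma parallelogram_law:
  fixes x y :: "'a::real_inner"
  shows "(norm (x + y))\<^sup>2 + (norm (x - y))\<^sup>2 = 2 * (norm x)\<^sup>2 + 2 * (norm y)\<^sup>2"
  by (simp add: power2_norm_eq_inner inner_add inner_diff inner_commute algebra_simps)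

lemma inner_zero_of_norm_minimal:
  fixes x z :: "'a::real_inner"
  assumes "\<And>t. norm x \<le> norm (x - t *\<^sub>R z)"
  shows "inner x z = 0"
proof (cases "z = 0")
  case False
  \<comment> \<open>The minimiser of the quadratic function |x - t z|^2 of t, where its value has
    dropped by <x, z>^2 / |z|^2.\<close>
  define t where "t = inner x z / (norm z)\<^sup>2"
  have "(norm x)\<^sup>2 \<le> (norm (x - t *\<^sub>R z))\<^sup>2"
    using assms by (intro power_mono) auto
  also have "\<dots> = (norm x)\<^sup>2 - 2 * t * inner x z + t\<^sup>2 * (norm z)\<^sup>2"
    unfolding power2_norm_eq_inner
    by (simp add: inner_diff inner_commute algebra_simps power2_eq_square)
  also have "\<dots> = (norm x)\<^sup>2 - (inner x z)\<^sup>2 / (norm z)\<^sup>2"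
    using False by (simp add: t_def field_simps power2_eq_square)
  finally have "(inner x z)\<^sup>2 / (norm z)\<^sup>2 \<le> 0" by simp
  moreover have "(norm z)\<^sup>2 > 0" using False by simp
  ultimately have "(inner x z)\<^sup>2 \<le> 0"
    by (simp add: divide_le_0_iff not_less)
  then show ?thesis by simp
qed simp

text \<open>A minimising sequence for the distance to \<open>Y\<close> is Cauchy by the
  parallelogram law; minimality of its limit along every line in \<open>Y\<close> through that limit
  gives orthogonality.\<close>

lemma orthogonal_projection_exists:
  fixes Y :: "'a::{real_inner,banach} set"
  assumes "closed Y" "subspace Y"
  shows "\<exists>p\<in>Y. \<forall>y\<in>Y. inner (x - p) y = 0"
proof -
  define d where "d = (INF y\<in>Y. (norm (x - y))\<^sup>2)"
  have ne: "Y \<noteq> {}" using assms(2) subspace_0 by blast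
  have bdd: "bdd_below ((\<lambda>y. (norm (x - y))\<^sup>2) ` Y)"
    by (rule bdd_belowI[of _ 0]) auto
  have lb: "d \<le> (norm (x - y))\<^sup>2" if "y \<in> Y" for y
    unfolding d_def by (rule cINF_lower[OF bdd that])
  have "\<exists>y\<in>Y. (norm (x - y))\<^sup>2 < d + 1 / Suc n" for n
    using cINF_less_iff[OF ne bdd, of "d + 1 / Suc n"] by (auto simp: d_def)
  then obtain y where yY: "\<And>n. y n \<in> Y" and y: "\<And>n. (norm (x - y n))\<^sup>2 < d + 1 / Suc n"
    by metis
  have close: "(dist (y i) (y j))\<^sup>2 \<le> 4 / Suc n" if "n \<le> i" "n \<le> j" for i j n
  proof -
    \<comment> \<open>The midpoint of two near-minimisers is again in \<open>Y\<close>, so its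
      squared distance is at least \<open>d\<close>; the parallelogram law then leaves room only for
      a small difference.\<close>
    have mid: "(1/2) *\<^sub>R (y i + y j) \<in> Y"
      using assms(2) yY by (simp add: subspace_add subspace_scale)
    have "(norm ((x - y i) + (x - y j)))\<^sup>2 = 4 * (norm (x - (1/2) *\<^sub>R (y i + y j)))\<^sup>2"
    proof -
      have "(x - y i) + (x - y j) = 2 *\<^sub>R (x - (1/2) *\<^sub>R (y i + y j))"
        by (simp add: algebra_simps scaleR_2)
      then show ?thesis by (simp add: power2_eq_square)
    qed
    then have "4 * d + (norm ((x - y i) - (x - y j)))\<^sup>2
        \<le> 2 * (norm (x - y i))\<^sup>2 + 2 * (norm (x - y j))\<^sup>2"
      using parallelogram_law[of "x - y i" "x - y j"] lb[OF mid] by simp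
    also have "\<dots> \<le> 2 * (d + 1 / Suc n) + 2 * (d + 1 / Suc n)"
    proof -
      have "1 / real (Suc i) \<le> 1 / Suc n" "1 / real (Suc j) \<le> 1 / Suc n"
        using that by (auto simp: frac_le)
      then have "(norm (x - y i))\<^sup>2 \<le> d + 1 / Suc n" "(norm (x - y j))\<^sup>2 \<le> d + 1 / Suc n"
        using y[of i] y[of j] by auto
      then show ?thesis by simp
    qed
    finally show ?thesis by (simp add: dist_norm norm_minus_commute algebra_simps)
  qed
  have "Cauchy y"
  proof (rule metric_CauchyI)
    fix e :: real assume "0 < e"
    then obtain n where n: "4 / e\<^sup>2 < Suc n"
      by (meson less_Suc_eq_le lessI nat_less_real_le reals_Archimedean2 less_trans of_nat_less_iff)
    have "dist (y i) (y j) < e" if "n \<le> i" "n \<le> j" for i j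
    proof -
      have "(dist (y i) (y j))\<^sup>2 \<le> 4 / Suc n" by (rule close[OF that])
      also have "\<dots> < e\<^sup>2" using n \<open>0 < e\<close> by (simp add: field_simps)
      finally show ?thesis using \<open>0 < e\<close> by (meson less_imp_le power2_less_imp_less)
    qed
    then show "\<exists>M. \<forall>m\<ge>M. \<forall>n\<ge>M. dist (y m) (y n) < e" by blast
  qed
  then obtain p where p: "y \<longlonglongrightarrow> p"
    using convergent_eq_Cauchy by blast
  have pY: "p \<in> Y" using assms(1) yY p closed_sequentially by blast
  have "(\<lambda>n. (norm (x - y n))\<^sup>2) \<longlonglongrightarrow> (norm (x - p))\<^sup>2"
    by (intro tendsto_intros p)
  moreover have "(\<lambda>n. d + 1 / Suc n) \<longlonglongrightarrow> d + 0"
    by (intro tendsto_intros LIMSEQ_Suc[OF lim_1_over_n])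
  moreover have "\<exists>N. \<forall>n\<ge>N. (norm (x - y n))\<^sup>2 \<le> d + 1 / Suc n"
    using y less_imp_le by blast
  ultimately have "(norm (x - p))\<^sup>2 \<le> d + 0"
    by (rule LIMSEQ_le)
  then have le_d: "(norm (x - p))\<^sup>2 \<le> d" by simp
  have min: "norm (x - p) \<le> norm (x - q)" if "q \<in> Y" for q
    by (rule power2_le_imp_le[OF order_trans[OF le_d lb[OF that]]]) simp
  have "inner (x - p) z = 0" if "z \<in> Y" for z
  proof (rule inner_zero_of_norm_minimal)
    fix t
    have "p + t *\<^sub>R z \<in> Y" using assms(2) pY that by (simp add: subspace_add subspace_scale)
    from min[OF this] show "norm (x - p) \<le> norm (x - p - t *\<^sub>R z)" by (simp add: diff_diff_eq)
  qed
  then show ?thesis using pY by blast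
qed

definition proj :: "'a::{real_inner,banach} set \<Rightarrow> 'a \<Rightarrow> 'a" where
  "proj Y x = (SOME p. p \<in> Y \<and> (\<forall>y\<in>Y. inner (x - p) y = 0))"

context
  fixes Y :: "'a::{real_inner,banach} set"
  assumes Y: "closed Y" "subspace Y"
begin

lemma proj_spec: "proj Y x \<in> Y \<and> (\<forall>y\<in>Y. inner (x - proj Y x) y = 0)"
  unfolding proj_def by (rule someI_ex) (use orthogonal_projection_exists[OF Y, of x] in blast)

lemma proj_in [simp]: "proj Y x \<in> Y"
  using proj_spec by blast

lemma proj_orthogonal: "y \<in> Y \<Longrightarrow> inner (x - proj Y x) y = 0"
  using proj_spec by blast

lemma proj_eqI:
  assumes "p \<in> Y" "\<And>y. y \<in> Y \<Longrightarrow> inner (x - p) y = 0"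
  shows "proj Y x = p"
proof -
  have d: "proj Y x - p \<in> Y" using Y(2) assms(1) by (simp add: subspace_diff)
  have "inner (proj Y x - p) (proj Y x - p)
      = inner (x - p) (proj Y x - p) - inner (x - proj Y x) (proj Y x - p)"
    by (simp add: inner_diff)
  also have "\<dots> = 0" using assms(2)[OF d] proj_orthogonal[OF d] by simp
  finally show ?thesis by simp
qed

lemma proj_of_mem: "x \<in> Y \<Longrightarrow> proj Y x = x"
  by (rule proj_eqI) auto

lemma proj_of_orthogonal: "(\<And>y. y \<in> Y \<Longrightarrow> inner x y = 0) \<Longrightarrow> proj Y x = 0"
  by (rule proj_eqI) (auto simp: subspace_0 Y)

lemma inner_proj_commute: "inner (proj Y x) y = inner x (proj Y y)"
proof -
  have "inner (proj Y x) y = inner (proj Y x) (proj Y y)"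
    using proj_orthogonal[of "proj Y x" y] by (simp add: inner_diff inner_commute)
  also have "\<dots> = inner x (proj Y y)"
    using proj_orthogonal[of "proj Y y" x] by (simp add: inner_diff inner_commute)
  finally show ?thesis .
qed

lemma proj_norm_le: "norm (proj Y x) \<le> norm x"
proof -
  have "(norm (proj Y x))\<^sup>2 = inner x (proj Y x)"
    using proj_orthogonal[of "proj Y x" x] by (simp add: inner_diff power2_norm_eq_inner)
  also have "\<dots> \<le> norm x * norm (proj Y x)" by (rule norm_cauchy_schwarz)
  finally show ?thesis
    by (cases "proj Y x = 0") (auto simp: power2_eq_square)
qed

lemma bounded_linear_proj: "bounded_linear (proj Y)"
proof (rule bounded_linear_intro[where K = 1])
  show "proj Y (x + y) = proj Y x + proj Y y" for x y
    using proj_orthogonal[of _ x] proj_orthogonal[of _ y] Y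
    by (intro proj_eqI) (auto simp: subspace_add inner_add inner_diff)
  show "proj Y (r *\<^sub>R x) = r *\<^sub>R proj Y x" for r x
    using proj_orthogonal[of _ x] Y
    by (intro proj_eqI) (auto simp: subspace_scale inner_add inner_diff)
qed (simp add: proj_norm_le)

text \<open>\<open>T\<close> preserves \<open>Y\<close> and its orthogonal complement, so it
  respects the splitting of \<open>x\<close>. Invariance of the complement is a separate hypothesis
  because \<open>T\<close> need not be self-adjoint.\<close>

lemma proj_commute:
  assumes "bounded_linear T" "\<And>y. y \<in> Y \<Longrightarrow> T y \<in> Y"
    and "\<And>z. (\<And>y. y \<in> Y \<Longrightarrow> inner z y = 0) \<Longrightarrow> (\<And>y. y \<in> Y \<Longrightarrow> inner (T z) y = 0)"
  shows "proj Y (T x) = T (proj Y x)"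
proof -
  interpret T: bounded_linear T by fact
  show ?thesis
  proof (rule proj_eqI)
    fix y assume "y \<in> Y"
    then show "inner (T x - T (proj Y x)) y = 0"
      using assms(3)[of "x - proj Y x" y] proj_orthogonal by (simp add: T.diff)
  qed (simp add: assms(2))
qed

lemma proj_commute_adjoint:
  assumes "bounded_linear T" "\<And>y. y \<in> Y \<Longrightarrow> T y \<in> Y"
    and "\<And>y. y \<in> Y \<Longrightarrow> T' y \<in> Y" "\<And>x y. inner (T x) y = inner x (T' y)"
  shows "proj Y (T x) = T (proj Y x)"
  using assms by (intro proj_commute) auto

end

lemma riesz_representation:
  fixes l :: "'a::{real_inner,banach} \<Rightarrow> real"
  assumes "bounded_linear l"
  shows "\<exists>a. \<forall>x. l x = inner x a"
proof (cases "\<forall>x. l x = 0")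
  case True
  then show ?thesis by (intro exI[of _ 0]) simp
next
  case False
  then obtain x where x: "l x \<noteq> 0" by blast
  interpret l: bounded_linear l by fact
  define Y where "Y = {x. l x = 0}"
  have Y: "closed Y" "subspace Y"
    unfolding Y_def
    by (auto intro!: closed_Collect_eq continuous_intros linear_continuous_on assms
        simp: subspace_def l.add l.zero l.scaleR)
  define z where "z = x - proj Y x"
  have lz: "l z = l x"
    using proj_in[OF Y, of x] by (simp add: z_def l.diff Y_def)
  have orth: "inner z y = 0" if "l y = 0" for y
    unfolding z_def using proj_orthogonal[OF Y] that Y_def by blast
  have "z \<noteq> 0" using lz x l.zero by force
  have "l y = inner y ((l z / inner z z) *\<^sub>R z)" for y
  proof -
    have "l (y - (l y / l z) *\<^sub>R z) = 0" using lz x by (simp add: l.diff l.scaleR)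
    then have "inner z y = l y / l z * inner z z"
      using orth[of "y - (l y / l z) *\<^sub>R z"] by (simp add: inner_diff)
    then show ?thesis using \<open>z \<noteq> 0\<close> lz x by (simp add: inner_commute field_simps)
  qed
  then show ?thesis by blast
qed

text \<open>Source of the averaging operators: an average of translations is given as a scalar form,
  and the Riesz theorem for each fixed \<open>x\<close> turns it into an operator with the same
  bound.\<close>

lemma riesz_form:
  fixes b :: "'a::real_normed_vector \<Rightarrow> 'b::{real_inner,banach} \<Rightarrow> real"
  assumes "bounded_bilinear b" "\<And>x y. \<bar>b x y\<bar> \<le> K * norm x * norm y" "0 \<le> K"
  obtains A where "bounded_linear A" "\<And>x y. inner (A x) y = b x y" "\<And>x. norm (A x) \<le> K * norm x"
proof -
  interpret b: bounded_bilinear b by fact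
  have "\<exists>a. \<forall>y. b x y = inner y a" for x
    by (rule riesz_representation[OF b.bounded_linear_right])
  then obtain A where A: "\<And>x y. b x y = inner y (A x)" by metis
  then have A': "inner (A x) y = b x y" for x y by (simp add: inner_commute)
  have norm: "norm (A x) \<le> K * norm x" for x
  proof -
    have "(norm (A x))\<^sup>2 = b x (A x)" by (simp add: A power2_norm_eq_inner)
    also have "\<dots> \<le> K * norm x * norm (A x)" using assms(2) abs_le_D1 by blast
    finally show ?thesis using assms(3)
      by (cases "A x = 0") (auto simp: power2_eq_square)
  qed
  have "bounded_linear A"
  proof (rule bounded_linear_intro[where K = K])
    show "A (x + y) = A x + A y" for x y
      by (rule vector_eq_ldot[THEN iffD1]) (auto simp: A[symmetric] b.add_left inner_add)
    show "A (r *\<^sub>R x) = r *\<^sub>R A x" for r x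
      by (rule vector_eq_ldot[THEN iffD1]) (auto simp: A[symmetric] b.scaleR_left)
    show "norm (A x) \<le> norm x * K" for x using norm[of x] by (simp add: mult.commute)
  qed
  then show thesis using that A' norm by blast
qed

text \<open>Only the value of the adjoint at one vector is provided; that is enough to move an
  operator out of a weakly defined integral.\<close>

lemma adjoint_at_exists:
  fixes T :: "'a::{real_inner,banach} \<Rightarrow> 'b::real_inner"
  assumes "bounded_linear T"
  shows "\<exists>y'. \<forall>x. inner (T x) y = inner x y'"
  by (intro riesz_representation bounded_linear_compose[OF bounded_linear_inner_left assms])

section \<open>Spectral subspaces of self-adjoint operators\<close>

text \<open>
  The square root of \<open>b\<^sup>2\<close> is \<open>1 - t\<close>, where \<open>t\<close> is the limit of the iteration below with
  \<open>x = 1 - b\<^sup>2\<close>.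
\<close>

fun sqrt_iter :: "('a::real_normed_vector \<Rightarrow>\<^sub>L 'a) \<Rightarrow> nat \<Rightarrow> ('a \<Rightarrow>\<^sub>L 'a)" where
  "sqrt_iter x 0 = 0"
| "sqrt_iter x (Suc n) = (1/2) *\<^sub>R (x + (sqrt_iter x n o\<^sub>L sqrt_iter x n))"

text \<open>The same recursion in the scalar case x = 1. It is increasing, bounded by 1, and
  majorises the norms and the increments of the operator iteration.\<close>

fun sqrt_iter_real :: "nat \<Rightarrow> real" where
  "sqrt_iter_real 0 = 0"
| "sqrt_iter_real (Suc n) = (1 + (sqrt_iter_real n)\<^sup>2) / 2"

lemma sqrt_iter_real_bounds: "0 \<le> sqrt_iter_real n \<and> sqrt_iter_real n \<le> 1 \<and> sqrt_iter_real n \<le> sqrt_iter_real (Suc n)"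
proof (induction n)
  case (Suc n)
  then have "(sqrt_iter_real n)\<^sup>2 \<le> 1" "(sqrt_iter_real n)\<^sup>2 \<le> (sqrt_iter_real (Suc n))\<^sup>2"
    by (auto intro!: power_le_one power_mono simp del: sqrt_iter_real.simps)
  then show ?case by simp
qed simp

lemma blinfun_compose_add_left: "(a + b) o\<^sub>L c = (a o\<^sub>L c) + (b o\<^sub>L c)"
  and blinfun_compose_add_right: "a' o\<^sub>L (b' + c') = (a' o\<^sub>L b') + (a' o\<^sub>L c')"
  and blinfun_compose_scaleR_left: "(r *\<^sub>R a) o\<^sub>L c = r *\<^sub>R (a o\<^sub>L c)"
  and blinfun_compose_scaleR_right: "a o\<^sub>L (r *\<^sub>R c) = r *\<^sub>R (a o\<^sub>L c)"
  by (auto intro!: blinfun_eqI simp: blinfun.bilinear_simps)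

text \<open>The iterates are polynomials in \<open>x\<close>. The lemma serves twice: with
  \<open>y\<close> an iterate, to factor a difference of squares, and with a general
  \<open>y\<close>, to pass commutation to the limit.\<close>

lemma sqrt_iter_commute:
  assumes "y o\<^sub>L x = x o\<^sub>L y"
  shows "y o\<^sub>L sqrt_iter x n = sqrt_iter x n o\<^sub>L y"
proof (induction n)
  case (Suc n)
  have "y o\<^sub>L (sqrt_iter x n o\<^sub>L sqrt_iter x n) = (sqrt_iter x n o\<^sub>L sqrt_iter x n) o\<^sub>L y"
    proof (rule blinfun_eqI)
    fix v
    have "y (sqrt_iter x n v) = sqrt_iter x n (y v)" for v
      using arg_cong[OF Suc, of "\<lambda>f. blinfun_apply f v"] by simp
    then show "(y o\<^sub>L (sqrt_iter x n o\<^sub>L sqrt_iter x n)) v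
        = ((sqrt_iter x n o\<^sub>L sqrt_iter x n) o\<^sub>L y) v"
      by simp
  qed
  then show ?case
    using assms
    by (simp add: blinfun_compose_scaleR_left blinfun_compose_scaleR_right
        blinfun_compose_add_left blinfun_compose_add_right)
qed (simp add: blinfun_compose_zero)

lemma sqrt_iter_norm:
  assumes "norm x \<le> 1"
  shows "norm (sqrt_iter x n) \<le> sqrt_iter_real n"
proof (induction n)
  case (Suc n)
  have "norm (sqrt_iter x n o\<^sub>L sqrt_iter x n) \<le> (norm (sqrt_iter x n))\<^sup>2"
    using norm_blinfun_compose by (metis power2_eq_square)
  also have "\<dots> \<le> (sqrt_iter_real n)\<^sup>2" using Suc by (intro power_mono) auto
  finally have "norm (x + (sqrt_iter x n o\<^sub>L sqrt_iter x n)) \<le> 1 + (sqrt_iter_real n)\<^sup>2"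
    using assms by (intro order_trans[OF norm_triangle_ineq] add_mono) auto
  then show ?case by simp
qed simp

text \<open>Since the iterates commute, a^2 - b^2 = (a + b)(a - b). The scalar recursion obeys the
  same identity with \<open>r\<close> and \<open>s\<close>, so the bound propagates.\<close>

lemma sqrt_iter_norm_diff:
  assumes "norm x \<le> 1"
  shows "norm (sqrt_iter x (Suc n) - sqrt_iter x n) \<le> sqrt_iter_real (Suc n) - sqrt_iter_real n"
proof (induction n)
  case 0
  then show ?case using assms by (simp add: blinfun_compose_zero)
next
  case (Suc n)
  define a where "a = sqrt_iter x (Suc n)"
  define b where "b = sqrt_iter x n"
  define r where "r = sqrt_iter_real (Suc n)"
  define s where "s = sqrt_iter_real n"
  have ab: "a o\<^sub>L b = b o\<^sub>L a"
    unfolding a_def b_def by (intro sqrt_iter_commute[symmetric] sqrt_iter_commute[symmetric, THEN sym]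
        sqrt_iter_commute) simp
  have "sqrt_iter x (Suc (Suc n)) - sqrt_iter x (Suc n) = (1/2) *\<^sub>R (x + (a o\<^sub>L a)) - (1/2) *\<^sub>R (x + (b o\<^sub>L b))"
    by (simp add: a_def b_def)
  also have "\<dots> = (1/2) *\<^sub>R ((a o\<^sub>L a) - (b o\<^sub>L b))"
    by (simp add: algebra_simps)
  also have "(a o\<^sub>L a) - (b o\<^sub>L b) = (a + b) o\<^sub>L (a - b)"
    using ab by (simp add: blinfun_compose_add_left bounded_bilinear.diff_right[OF bounded_bilinear_blinfun_compose])
  finally have "norm (sqrt_iter x (Suc (Suc n)) - sqrt_iter x (Suc n))
      = 1/2 * norm ((a + b) o\<^sub>L (a - b))" by simp
  also have "\<dots> \<le> 1/2 * (norm (a + b) * norm (a - b))"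
    using norm_blinfun_compose by (intro mult_left_mono) auto
  also have "\<dots> \<le> 1/2 * ((r + s) * (r - s))"
  proof (intro mult_left_mono mult_mono)
    show "norm (a + b) \<le> r + s"
      unfolding a_def b_def r_def s_def
      by (intro order_trans[OF norm_triangle_ineq] add_mono sqrt_iter_norm assms)
    show "norm (a - b) \<le> r - s" using Suc by (simp add: a_def b_def r_def s_def)
    show "0 \<le> r + s" using sqrt_iter_real_bounds unfolding r_def s_def by (meson add_nonneg_nonneg)
  qed auto
  also have "\<dots> = sqrt_iter_real (Suc (Suc n)) - sqrt_iter_real (Suc n)"
    by (simp add: r_def s_def power2_eq_square algebra_simps)
  finally show ?case .
qed

lemma sqrt_iter_convergent:
  fixes x :: "'a::banach \<Rightarrow>\<^sub>L 'a"
  assumes "norm x \<le> 1"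
  shows "convergent (sqrt_iter x)"
proof -
  have "convergent sqrt_iter_real"
  proof (rule Bseq_monoseq_convergent)
    show "Bseq sqrt_iter_real"
      using sqrt_iter_real_bounds by (intro BseqI'[of _ 1]) auto
    show "monoseq sqrt_iter_real"
      using sqrt_iter_real_bounds incseq_SucI monoseq_iff by blast
  qed
  then have "summable (\<lambda>n. sqrt_iter_real (Suc n) - sqrt_iter_real n)"
    using telescope_summable convergent_def by blast
  then have "summable (\<lambda>n. sqrt_iter x (Suc n) - sqrt_iter x n)"
    by (rule summable_comparison_test') (rule sqrt_iter_norm_diff[OF assms])
  then have "convergent (\<lambda>n. \<Sum>k<n. sqrt_iter x (Suc k) - sqrt_iter x k)"
    by (simp add: summable_iff_convergent)
  then show ?thesis
    by (simp only: sum_lessThan_telescope) simp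
qed

definition self_adjoint :: "('a::real_inner \<Rightarrow> 'a) \<Rightarrow> bool" where
  "self_adjoint T \<longleftrightarrow> (\<forall>x y. inner (T x) y = inner x (T y))"

lemma sqrt_iter_self_adjoint:
  assumes "self_adjoint (blinfun_apply x)"
  shows "self_adjoint (blinfun_apply (sqrt_iter x n))"
  using assms
  by (induction n) (auto simp: self_adjoint_def blinfun.bilinear_simps inner_add)

lemma abs_operator_exists:
  fixes b :: "'a::{real_inner,banach} \<Rightarrow>\<^sub>L 'a"
  assumes sa: "self_adjoint (blinfun_apply b)" and nb: "norm b \<le> 1"
  obtains r where "self_adjoint (blinfun_apply r)" "r o\<^sub>L r = b o\<^sub>L b" "\<And>x. 0 \<le> inner (r x) x"
    "\<And>y. y o\<^sub>L b = b o\<^sub>L y \<Longrightarrow> y o\<^sub>L r = r o\<^sub>L y"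
proof -
  define x where "x = id_blinfun - (b o\<^sub>L b)"
  have x_apply: "x v = v - b (b v)" for v
    by (simp add: x_def blinfun.bilinear_simps)
  have b_le: "norm (b v) \<le> norm v" for v
    using norm_blinfun[of b v] nb mult_right_mono[OF nb norm_ge_zero[of v]] by linarith
  \<comment> \<open>In |v|^2 - 2 |b v|^2 + |b b v|^2 the last term is at most |b v|^2, so
    \<open>x\<close> is a contraction; the triangle inequality would give only the bound 2.\<close>
  have "norm (x v) \<le> 1 * norm v" for v
  proof -
    have "(norm (x v))\<^sup>2 = (norm v)\<^sup>2 - 2 * (norm (b v))\<^sup>2 + (norm (b (b v)))\<^sup>2"
      using sa unfolding power2_norm_eq_inner self_adjoint_def
      by (simp add: x_apply inner_diff inner_commute)
    also have "\<dots> \<le> (norm v)\<^sup>2"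
    proof -
      have "(norm (b (b v)))\<^sup>2 \<le> (norm (b v))\<^sup>2"
        by (intro power_mono b_le) simp
      moreover have "0 \<le> (norm (b v))\<^sup>2" by simp
      ultimately show ?thesis by linarith
    qed
    finally have "(norm (x v))\<^sup>2 \<le> (norm v)\<^sup>2" .
    then have "norm (x v) \<le> norm v" by (rule power2_le_imp_le) simp
    then show ?thesis by simp
  qed
  then have nx: "norm x \<le> 1" by (intro norm_blinfun_bound) auto
  have sax: "self_adjoint (blinfun_apply x)"
    using sa by (simp add: self_adjoint_def x_apply inner_diff)
  obtain t where t: "sqrt_iter x \<longlonglongrightarrow> t"
    using sqrt_iter_convergent[OF nx] by (auto simp: convergent_def)
  \<comment> \<open>Rewritten, this is (1 - t)^2 = 1 - x, and 1 - x is the square of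
    \<open>b\<close>.\<close>
  have t_eq: "t = (1/2) *\<^sub>R (x + (t o\<^sub>L t))"
  proof (rule LIMSEQ_unique)
    show "(\<lambda>n. sqrt_iter x (Suc n)) \<longlonglongrightarrow> t" using t by (rule LIMSEQ_Suc)
    show "(\<lambda>n. sqrt_iter x (Suc n)) \<longlonglongrightarrow> (1/2) *\<^sub>R (x + (t o\<^sub>L t))"
      by (auto intro!: tendsto_intros t bounded_bilinear.tendsto[OF bounded_bilinear_blinfun_compose])
  qed
  define r where "r = id_blinfun - t"
  have pt: "(\<lambda>n. sqrt_iter x n v) \<longlonglongrightarrow> t v" for v
    by (intro bounded_linear.tendsto[OF blinfun.bounded_linear_left] t)
  have nt: "norm t \<le> 1"
    by (rule LIMSEQ_le_const2[OF tendsto_norm[OF t]])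
      (use sqrt_iter_norm[OF nx] sqrt_iter_real_bounds order_trans in blast)
  show thesis
  proof
    have "self_adjoint (blinfun_apply t)"
      unfolding self_adjoint_def
    proof (intro allI)
      fix v w
      have "(\<lambda>n. inner (sqrt_iter x n v) w) \<longlonglongrightarrow> inner (t v) w"
        and "(\<lambda>n. inner v (sqrt_iter x n w)) \<longlonglongrightarrow> inner v (t w)"
        by (intro tendsto_intros pt)+
      moreover have "inner (sqrt_iter x n v) w = inner v (sqrt_iter x n w)" for n
        using sqrt_iter_self_adjoint[OF sax] self_adjoint_def by blast
      ultimately show "inner (t v) w = inner v (t w)"
        using LIMSEQ_unique by auto
    qed
    then show "self_adjoint (blinfun_apply r)"
      by (simp add: self_adjoint_def r_def blinfun.bilinear_simps inner_diff)
    have "t + t = x + (t o\<^sub>L t)" using t_eq by (metis field_sum_of_halves scaleR_half_double scaleR_add_right)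
    then have "t v + t v = x v + t (t v)" for v
      by (metis blinfun.add_left blinfun_apply_blinfun_compose)
    then show "r o\<^sub>L r = b o\<^sub>L b"
      by (intro blinfun_eqI) (simp add: r_def blinfun.bilinear_simps x_apply algebra_simps)
    show "0 \<le> inner (r v) v" for v
    proof -
      have "inner (t v) v \<le> norm (t v) * norm v" by (rule norm_cauchy_schwarz)
      also have "\<dots> \<le> (1 * norm v) * norm v"
        using norm_blinfun[of t v] mult_right_mono[OF nt norm_ge_zero[of v]]
        by (intro mult_right_mono) auto
      finally show ?thesis
        by (simp add: r_def blinfun.bilinear_simps inner_diff dot_square_norm power2_eq_square)
    qed
    fix y assume yb: "y o\<^sub>L b = b o\<^sub>L y"
    have yb': "y (b v) = b (y v)" for v
      using yb by (metis blinfun_apply_blinfun_compose)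
    have yx: "y o\<^sub>L x = x o\<^sub>L y"
      by (intro blinfun_eqI) (simp add: x_apply blinfun.bilinear_simps yb')
    have "y o\<^sub>L t = t o\<^sub>L y"
    proof (rule LIMSEQ_unique)
      show "(\<lambda>n. y o\<^sub>L sqrt_iter x n) \<longlonglongrightarrow> (y o\<^sub>L t)"
        by (intro bounded_bilinear.tendsto[OF bounded_bilinear_blinfun_compose] t tendsto_const)
      show "(\<lambda>n. y o\<^sub>L sqrt_iter x n) \<longlonglongrightarrow> (t o\<^sub>L y)"
        unfolding sqrt_iter_commute[OF yx]
        by (intro bounded_bilinear.tendsto[OF bounded_bilinear_blinfun_compose] t tendsto_const)
    qed
    then show "y o\<^sub>L r = r o\<^sub>L y"
      by (intro blinfun_eqI) (metis (no_types, lifting) blinfun.diff_left blinfun.diff_right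
          blinfun_apply_blinfun_compose id_blinfun.rep_eq id_apply r_def)
  qed
qed

text \<open>
  With \<open>b\<close> a multiple of \<open>a - c\<close> and \<open>r = \<bar>b\<bar>\<close>, the projection is onto the closure of the
  range of \<open>r + b\<close>; as \<open>(r - b) (r + b) = 0\<close>, the operators \<open>b\<close> and \<open>r\<close> agree there,
  while \<open>b = - r\<close> on the kernel of \<open>r + b\<close>.
\<close>

lemma spectral_projection_exists:
  fixes a :: "'a::{real_inner,banach} \<Rightarrow>\<^sub>L 'a"
  assumes sa: "self_adjoint (blinfun_apply a)"
  obtains p where "bounded_linear p" "self_adjoint p" "\<And>x. p (p x) = p x"
    "\<And>x. c * (norm (p x))\<^sup>2 \<le> inner (a (p x)) (p x)"
    "\<And>x. inner (a (x - p x)) (x - p x) \<le> c * (norm (x - p x))\<^sup>2"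
    "\<And>y. bounded_linear y \<Longrightarrow> (\<And>x. y (a x) = a (y x)) \<Longrightarrow> (\<And>x. y (p x) = p (y x))"
proof -
  \<comment> \<open>The summand 1 keeps \<open>s\<close> positive when \<open>a\<close> is the
    multiple \<open>c\<close> of the identity; dividing by \<open>s\<close> brings \<open>b\<close>
    into the unit ball, as \<open>abs_operator_exists\<close> requires.\<close>
  define s where "s = norm (a - c *\<^sub>R id_blinfun) + 1"
  have "s > 0" unfolding s_def by (meson norm_ge_zero add_nonneg_pos zero_less_one)
  define b where "b = (1 / s) *\<^sub>R (a - c *\<^sub>R id_blinfun)"
  have b_apply: "b v = (1 / s) *\<^sub>R (a v - c *\<^sub>R v)" for v
    by (simp add: b_def blinfun.bilinear_simps)
  have a_eq: "inner (a v) v = s * inner (b v) v + c * (norm v)\<^sup>2" for v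
    using \<open>s > 0\<close> by (simp add: b_apply inner_diff power2_norm_eq_inner)
  have "norm b \<le> 1"
    using \<open>s > 0\<close> by (simp add: b_def s_def)
  have sab: "self_adjoint (blinfun_apply b)"
    using sa by (simp add: self_adjoint_def b_apply inner_diff)
  obtain r where sar: "self_adjoint (blinfun_apply r)" and rr: "r o\<^sub>L r = b o\<^sub>L b"
    and r_pos: "\<And>x. 0 \<le> inner (r x) x"
    and r_comm: "\<And>y. y o\<^sub>L b = b o\<^sub>L y \<Longrightarrow> y o\<^sub>L r = r o\<^sub>L y"
    using abs_operator_exists[OF sab \<open>norm b \<le> 1\<close>] by blast
  have br: "b (r v) = r (b v)" for v
    using r_comm[of b] by (metis blinfun_apply_blinfun_compose)
  have rr': "r (r v) = b (b v)" for v
    using rr by (metis blinfun_apply_blinfun_compose)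
  define S where "S = r + b"
  have S_apply: "S v = r v + b v" for v by (simp add: S_def blinfun.add_left)
  have saS: "inner (S x) y = inner x (S y)" for x y
    using sar sab by (simp add: S_apply self_adjoint_def inner_add)
  define Y where "Y = closure (range (blinfun_apply S))"
  have subR: "subspace (range (blinfun_apply S))"
    by (intro linear_subspace_image bounded_linear.linear blinfun.bounded_linear_right) auto
  have Y: "closed Y" "subspace Y"
    by (auto simp: Y_def intro: subspace_closure subR)
  have onY: "0 \<le> inner (b y) y" if "y \<in> Y" for y
  proof -
    have "closed {y. 0 \<le> inner (b y) y}"
      by (intro closed_Collect_le continuous_intros)
    moreover have "range (blinfun_apply S) \<subseteq> {y. 0 \<le> inner (b y) y}"
    proof clarify
      fix w
      have "b (S w) = r (S w)" by (simp add: S_apply blinfun.add_right br rr')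
      then show "0 \<le> inner (b (S w)) (S w)" using r_pos by simp
    qed
    ultimately show ?thesis
      using that closure_minimal unfolding Y_def by blast
  qed
  \<comment> \<open>\<open>S\<close> is self-adjoint, so the orthogonal complement of its range is
    its kernel.\<close>
  have perp: "S z = 0" if "\<And>y. y \<in> Y \<Longrightarrow> inner z y = 0" for z
  proof -
    have "inner (S z) (S z) = inner z (S (S z))" by (simp add: saS)
    also have "\<dots> = 0" unfolding Y_def[symmetric]
      by (rule that) (simp add: Y_def subsetD[OF closure_subset])
    finally show ?thesis by simp
  qed
  have perp': "inner z y = 0" if "S z = 0" "y \<in> Y" for z y
  proof -
    have "closed {y. inner z y = 0}" by (intro closed_Collect_eq continuous_intros)
    moreover have "range (blinfun_apply S) \<subseteq> {y. inner z y = 0}"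
      using saS[of z] that(1) by auto
    ultimately show ?thesis
      using that closure_minimal unfolding Y_def by blast
  qed
  have onZ: "inner (b z) z \<le> 0" if "S z = 0" for z
  proof -
    have "b z = - r z" using that by (simp add: S_apply eq_neg_iff_add_eq_0 add.commute)
    then show ?thesis using r_pos[of z] by simp
  qed
  show thesis
  proof
    show "bounded_linear (proj Y)" by (rule bounded_linear_proj[OF Y])
    show "self_adjoint (proj Y)" by (simp add: self_adjoint_def inner_proj_commute[OF Y])
    show "proj Y (proj Y x) = proj Y x" for x
      by (simp add: proj_of_mem[OF Y] proj_in[OF Y])
    show "c * (norm (proj Y x))\<^sup>2 \<le> inner (a (proj Y x)) (proj Y x)" for x
      using onY[OF proj_in[OF Y, of x]] \<open>s > 0\<close> by (simp add: a_eq)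
    show "inner (a (x - proj Y x)) (x - proj Y x) \<le> c * (norm (x - proj Y x))\<^sup>2" for x
      using onZ[OF perp, of "x - proj Y x"] proj_orthogonal[OF Y] \<open>s > 0\<close>
      by (simp add: a_eq mult_le_0_iff)
    fix y :: "'a \<Rightarrow> 'a" and x
    assume bl: "bounded_linear y" and ya: "\<And>x. y (a x) = a (y x)"
    interpret y: bounded_linear y by fact
    have "Blinfun y o\<^sub>L b = b o\<^sub>L Blinfun y"
      by (intro blinfun_eqI) (simp add: bounded_linear_Blinfun_apply[OF bl] b_apply y.scaleR y.diff ya)
    then have "y (b v) = b (y v)" "y (r v) = r (y v)" for v
      using r_comm[of "Blinfun y"] bounded_linear_Blinfun_apply[OF bl]
      by (metis blinfun_apply_blinfun_compose)+
    then have yS: "y (S v) = S (y v)" for v by (simp add: S_apply y.add)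
    have "proj Y (y x) = y (proj Y x)"
    proof (rule proj_commute[OF Y bl])
      show "y v \<in> Y" if "v \<in> Y" for v
      proof -
        have "y ` closure (range (blinfun_apply S)) \<subseteq> Y"
          unfolding Y_def
          by (intro image_closure_subset linear_continuous_on bl closed_closure)
            (use yS closure_subset in \<open>fastforce\<close>)
        then show ?thesis using that unfolding Y_def by blast
      qed
      show "inner (y z) v = 0" if "\<And>v. v \<in> Y \<Longrightarrow> inner z v = 0" "v \<in> Y" for z v
        using perp[of z] that perp'[of "y z"] yS y.zero by metis
    qed
    then show "y (proj Y x) = proj Y (y x)" ..
  qed
qed

section \<open>Orthonormal sequences\<close>

text \<open>\<open>sgn\<close> normalises and sends 0 to 0, so a vector that depends on its
  predecessors contributes a zero entry and the indices need no thinning. This is why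
  \<open>orthonormal_or_zero\<close> admits zeros.\<close>

fun gram_schmidt :: "(nat \<Rightarrow> 'a::real_inner) \<Rightarrow> nat \<Rightarrow> 'a" where
  "gram_schmidt q n = sgn (q n - (\<Sum>i<n. inner (q n) (gram_schmidt q i) *\<^sub>R gram_schmidt q i))"

declare gram_schmidt.simps [simp del]

definition orthonormal_or_zero :: "(nat \<Rightarrow> 'a::real_inner) \<Rightarrow> bool" where
  "orthonormal_or_zero e \<longleftrightarrow> (\<forall>i j. i \<noteq> j \<longrightarrow> inner (e i) (e j) = 0) \<and> (\<forall>i. e i = 0 \<or> norm (e i) = 1)"

lemma inner_sum_orthonormal:
  fixes e :: "nat \<Rightarrow> 'a::real_inner"
  assumes "\<And>i j. i < n \<Longrightarrow> j < n \<Longrightarrow> i \<noteq> j \<Longrightarrow> inner (e i) (e j) = 0"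
    and "\<And>i. e i = 0 \<or> norm (e i) = 1" and "k < n"
  shows "inner (\<Sum>i<n. c i *\<^sub>R e i) (e k) = c k * inner (e k) (e k)"
proof -
  have "inner (\<Sum>i<n. c i *\<^sub>R e i) (e k) = (\<Sum>i<n. if i = k then c k * inner (e k) (e k) else 0)"
    unfolding inner_sum_left using assms by (intro sum.cong) auto
  then show ?thesis using assms(3) by simp
qed

lemma inner_self_mult:
  assumes "e = 0 \<or> norm e = 1"
  shows "inner x e * inner e e = inner x e"
  using assms by (auto simp: dot_square_norm)

lemma orthonormal_gram_schmidt: "orthonormal_or_zero (gram_schmidt q)"
proof -
  let ?e = "gram_schmidt q"
  have nrm: "?e i = 0 \<or> norm (?e i) = 1" for i
    by (subst (1 2) gram_schmidt.simps) (auto simp: norm_sgn sgn_zero_iff)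
  have "\<forall>i j. i < n \<longrightarrow> j < n \<longrightarrow> i \<noteq> j \<longrightarrow> inner (?e i) (?e j) = 0" for n
  proof (induction n)
    case (Suc n)
    have "inner (?e n) (?e j) = 0" if "j < n" for j
    proof -
      have "inner (\<Sum>i<n. inner (q n) (?e i) *\<^sub>R ?e i) (?e j) = inner (q n) (?e j)"
        using inner_sum_orthonormal[of n ?e j "\<lambda>i. inner (q n) (?e i)"] Suc that nrm
          inner_self_mult[OF nrm] by auto
      then show ?thesis
        by (subst gram_schmidt.simps) (simp add: sgn_div_norm inner_diff)
    qed
    then show ?case using Suc by (auto simp: less_Suc_eq inner_commute)
  qed simp
  then have "inner (?e i) (?e j) = 0" if "i \<noteq> j" for i j
    using that by (meson less_Suc_eq_le linear max.cobounded1 max.cobounded2)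
  then show ?thesis using nrm by (auto simp: orthonormal_or_zero_def)
qed

lemma inner_sgn_scaleR_sgn: "inner z (sgn z) *\<^sub>R sgn z = (z :: 'a::real_inner)"
proof (cases "z = 0")
  case False
  then have "inverse (norm z) * (norm z * norm z) * inverse (norm z) = 1" by (simp add: field_simps)
  then show ?thesis by (simp add: sgn_div_norm dot_square_norm power2_eq_square)
qed simp

text \<open>The residual \<open>?d\<close> is a multiple of the n-th entry, and its coefficient is
  that of \<open>q n\<close> because the earlier entries are orthogonal to this one.\<close>

lemma gram_schmidt_expansion:
  "q n = (\<Sum>i<Suc n. inner (q n) (gram_schmidt q i) *\<^sub>R gram_schmidt q i)"
proof -
  let ?e = "gram_schmidt q"
  let ?d = "q n - (\<Sum>i<n. inner (q n) (?e i) *\<^sub>R ?e i)"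
  have e_n: "?e n = sgn ?d" by (rule gram_schmidt.simps)
  have orth: "inner (?e i) (?e n) = 0" if "i < n" for i
    using orthonormal_gram_schmidt[of q] that unfolding orthonormal_or_zero_def by auto
  have "inner (q n) (?e n) = inner ?d (?e n)"
    by (simp add: inner_diff inner_sum_left orth)
  also have "\<dots> *\<^sub>R ?e n = ?d"
    unfolding e_n by (rule inner_sgn_scaleR_sgn)
  finally show ?thesis by simp
qed

context
  fixes e :: "nat \<Rightarrow> 'a::real_inner"
  assumes on: "orthonormal_or_zero e"
begin

lemma inner_partial_sum:
  "inner x (\<Sum>i<n. inner y (e i) *\<^sub>R e i) = (\<Sum>i<n. inner x (e i) * inner y (e i))"
  by (simp add: inner_sum_right mult.commute)

lemma partial_sum_orthogonal:
  assumes "k < n" shows "inner (x - (\<Sum>i<n. inner x (e i) *\<^sub>R e i)) (e k) = 0"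
  using on inner_sum_orthonormal[of n e k "\<lambda>i. inner x (e i)"] assms inner_self_mult[of "e k" x]
  unfolding orthonormal_or_zero_def by (simp add: inner_diff)

lemma norm_diff_partial_sum:
  "(norm (x - (\<Sum>i<n. inner x (e i) *\<^sub>R e i)))\<^sup>2 = (norm x)\<^sup>2 - (\<Sum>i<n. (inner x (e i))\<^sup>2)"
proof -
  let ?p = "\<Sum>i<n. inner x (e i) *\<^sub>R e i"
  have "inner (x - ?p) ?p = 0"
    using partial_sum_orthogonal by (simp add: inner_sum_right)
  then have "(norm (x - ?p))\<^sup>2 = inner x x - inner x ?p"
    by (simp add: power2_norm_eq_inner inner_diff inner_commute)
  then show ?thesis
    unfolding power2_norm_eq_inner by (simp add: inner_partial_sum power2_eq_square)
qed

lemma bessel_inequality: "(\<Sum>i<n. (inner x (e i))\<^sup>2) \<le> (norm x)\<^sup>2"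
  using norm_diff_partial_sum[of x n] by (smt (verit) zero_le_power2)

text \<open>Cauchy-Schwarz on the partial sums, followed by Bessel in both factors. The bound is
  uniform in \<open>n\<close> and later dominates partial sums under an integral.\<close>

lemma bessel_inequality2: "\<bar>\<Sum>i<n. inner x (e i) * inner y (e i)\<bar> \<le> norm x * norm y"
proof -
  have "\<bar>\<Sum>i<n. inner x (e i) * inner y (e i)\<bar> \<le> (\<Sum>i<n. \<bar>inner x (e i)\<bar> * \<bar>inner y (e i)\<bar>)"
    by (metis (mono_tags, lifting) abs_mult sum_abs sum.cong)
  also have "\<dots> \<le> L2_set (\<lambda>i. inner x (e i)) {..<n} * L2_set (\<lambda>i. inner y (e i)) {..<n}"
    by (rule L2_set_mult_ineq)
  also have "\<dots> \<le> norm x * norm y"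
    unfolding L2_set_def using bessel_inequality
    by (intro mult_mono real_le_lsqrt sum_nonneg real_sqrt_ge_zero) auto
  finally show ?thesis .
qed

text \<open>Only \<open>y\<close> has to be approximable; \<open>x\<close> is arbitrary. The error
  is <x, y - P_n y>, and as soon as P_n reproduces q_m, y - P_n y equals (y - q_m) - P_n (y - q_m),
  whose norm is at most |y - q_m|.\<close>

lemma parseval_sums:
  assumes "y \<in> closure (range q)"
    and q: "\<And>n. q n = (\<Sum>i<Suc n. inner (q n) (e i) *\<^sub>R e i)"
  shows "(\<lambda>i. inner x (e i) * inner y (e i)) sums inner x y"
  unfolding sums_def
proof (rule LIMSEQ_I)
  fix r :: real assume "0 < r"
  define d where "d = r / (norm x + 1)"
  have "d > 0" using \<open>0 < r\<close> by (simp add: d_def add_nonneg_pos)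
  then obtain m where m: "norm (q m - y) < d"
    using assms(1) unfolding closure_approachable by (auto simp: dist_norm)
  let ?P = "\<lambda>n x. \<Sum>i<n. inner x (e i) *\<^sub>R e i"
  have "norm ((\<Sum>i<n. inner x (e i) * inner y (e i)) - inner x y) < r" if "Suc m \<le> n" for n
  proof -
    have Pq: "?P n (q m) = q m"
    proof -
      have z: "inner (q m) (e i) = 0" if "i \<in> {..<n} - {..<Suc m}" for i
      proof -
        have "inner (\<Sum>j<Suc m. inner (q m) (e j) *\<^sub>R e j) (e i) = 0"
          using that on unfolding inner_sum_left
          by (intro sum.neutral) (auto simp: orthonormal_or_zero_def)
        then show ?thesis using q[of m] by simp
      qed
      have "?P n (q m) = ?P (Suc m) (q m)"
        by (rule sum.mono_neutral_right) (use z \<open>Suc m \<le> n\<close> in auto)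
      then show ?thesis using q[of m] by simp
    qed
    have "y - ?P n y = (y - q m) - ?P n (y - q m)"
      by (simp add: inner_diff scaleR_diff_left sum_subtractf Pq)
    then have "(norm (y - ?P n y))\<^sup>2 = (norm ((y - q m) - ?P n (y - q m)))\<^sup>2"
      by (simp only:)
    also have "\<dots> \<le> (norm (y - q m))\<^sup>2"
      unfolding norm_diff_partial_sum by (simp add: sum_nonneg)
    finally have "(norm (y - ?P n y))\<^sup>2 \<le> (norm (y - q m))\<^sup>2" .
    then have "norm (y - ?P n y) \<le> norm (y - q m)" by (rule power2_le_imp_le) simp
    then have "norm (y - ?P n y) \<le> d" using m by (simp add: norm_minus_commute)
    moreover have "inner x y - (\<Sum>i<n. inner x (e i) * inner y (e i)) = inner x (y - ?P n y)"
      by (simp add: inner_diff inner_partial_sum)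
    ultimately have "\<bar>inner x y - (\<Sum>i<n. inner x (e i) * inner y (e i))\<bar> \<le> norm x * d"
      using Cauchy_Schwarz_ineq2[of x "y - ?P n y"] by (smt (verit) mult_left_mono norm_ge_zero)
    also have "\<dots> < r"
    proof -
      have "norm x + 1 > 0" by (simp add: add_nonneg_pos)
      then show ?thesis using \<open>0 < r\<close> by (simp add: d_def pos_divide_less_eq algebra_simps)
    qed
    finally show ?thesis by (simp add: abs_minus_commute)
  qed
  then show "\<exists>no. \<forall>n\<ge>no. norm ((\<Sum>i<n. inner x (e i) * inner y (e i)) - inner x y) < r"
    by blast
qed

end

text \<open>The space may be non-separable, but compact sets are totally bounded: the finite nets
  for all accuracies and all \<open>K j\<close> form a countable set whose closure contains every
  \<open>K j\<close>, and Gram-Schmidt is applied to it.\<close>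

lemma orthonormal_sequence_for_compacts:
  fixes K :: "nat \<Rightarrow> 'a::real_inner set"
  assumes "\<And>j. compact (K j)"
  obtains e where "orthonormal_or_zero e"
    "\<And>x y. y \<in> (\<Union>j. K j) \<Longrightarrow> (\<lambda>i. inner x (e i) * inner y (e i)) sums inner x y"
proof -
  have "\<exists>k. finite k \<and> K j \<subseteq> (\<Union>x\<in>k. ball x (1 / Suc n))" for j n :: nat
    using seq_compact_imp_totally_bounded[of "K j"] assms
    by (meson compact_imp_seq_compact of_nat_0_less_iff zero_less_Suc zero_less_divide_1_iff)
  then obtain F where F: "\<And>j n. finite (F j n)" "\<And>j n. K j \<subseteq> (\<Union>x\<in>F j n. ball x (1 / Suc n))"
    by metis
  define C where "C = insert 0 (\<Union>j n. F j n)"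
  have "countable (\<Union>n. F j n)" for j
    by (rule countable_UN) (simp_all add: countable_finite F(1))
  then have "countable C" unfolding C_def by (simp add: countable_UN)
  moreover have "C \<noteq> {}" by (auto simp: C_def)
  ultimately obtain q :: "nat \<Rightarrow> 'a" where q: "range q = C" by (metis range_from_nat_into)
  have "y \<in> closure (range q)" if "y \<in> (\<Union>j. K j)" for y
    unfolding closure_approachable
  proof (intro allI impI)
    fix d :: real assume "d > 0"
    then obtain n where n: "1 / Suc n < d" by (meson nat_approx_posE)
    obtain j where "y \<in> K j" using \<open>y \<in> (\<Union>j. K j)\<close> by blast
    then obtain x where "x \<in> F j n" "dist x y < 1 / Suc n" using F(2)[of j n] by auto
    then show "\<exists>x\<in>range q. dist x y < d" unfolding q C_def using n by force
  qed
  then show thesis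
    using that[of "gram_schmidt q"] orthonormal_gram_schmidt[of q]
      parseval_sums[OF orthonormal_gram_schmidt _ gram_schmidt_expansion] by blast
qed

section \<open>Square-integrable functions\<close>

lemma measurable_cnj [measurable]: "cnj \<in> borel_measurable borel"
  by (intro borel_measurable_continuous_onI continuous_intros)

lemma L2_measurable: "f \<in> L2 M \<Longrightarrow> f \<in> borel_measurable M"
  and L2_integrable: "f \<in> L2 M \<Longrightarrow> integrable M (\<lambda>x. (cmod (f x))\<^sup>2)"
  by (auto simp: L2_def)

lemma L2_dominated:
  assumes "integrable M h" "f \<in> borel_measurable M" "\<And>x. x \<in> space M \<Longrightarrow> (cmod (f x))\<^sup>2 \<le> h x"
  shows "f \<in> L2 M"
proof -
  have "integrable M (\<lambda>x. (cmod (f x))\<^sup>2)"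
    by (rule Bochner_Integration.integrable_bound[OF assms(1)])
      (use assms in \<open>auto intro!: AE_I2 order_trans[OF assms(3)]\<close>)
  then show ?thesis using assms(2) by (simp add: L2_def)
qed

lemma L2_zero [simp]: "(\<lambda>_. 0) \<in> L2 M"
  by (simp add: L2_def)

lemma L2_add:
  assumes "f \<in> L2 M" "g \<in> L2 M" shows "(\<lambda>x. f x + g x) \<in> L2 M"
proof (rule L2_dominated)
  show "integrable M (\<lambda>x. 2 * (cmod (f x))\<^sup>2 + 2 * (cmod (g x))\<^sup>2)"
    using assms by (auto simp: L2_def)
  show "(\<lambda>x. f x + g x) \<in> borel_measurable M" using assms by (auto simp: L2_def)
  show "(cmod (f x + g x))\<^sup>2 \<le> 2 * (cmod (f x))\<^sup>2 + 2 * (cmod (g x))\<^sup>2" for x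
    using parallelogram_law[of "f x" "g x"] by (smt (verit) zero_le_power2)
qed

lemma L2_cmult:
  assumes "f \<in> L2 M" shows "(\<lambda>x. c * f x) \<in> L2 M"
  using assms by (auto simp: L2_def norm_mult power_mult_distrib)

lemma L2_uminus: "f \<in> L2 M \<Longrightarrow> (\<lambda>x. - f x) \<in> L2 M"
  using L2_cmult[of f M "-1"] by simp

lemma L2_diff: "f \<in> L2 M \<Longrightarrow> g \<in> L2 M \<Longrightarrow> (\<lambda>x. f x - g x) \<in> L2 M"
  using L2_add[OF _ L2_uminus, of f M g] by simp

lemma L2_inner_integrable:
  assumes "f \<in> L2 M" "g \<in> L2 M" shows "integrable M (\<lambda>x. f x * cnj (g x))"
proof (rule Bochner_Integration.integrable_bound)
  show "integrable M (\<lambda>x. (cmod (f x))\<^sup>2 + (cmod (g x))\<^sup>2)" using assms by (auto simp: L2_def)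
  show "(\<lambda>x. f x * cnj (g x)) \<in> borel_measurable M" using assms by (auto simp: L2_def)
  have "a * b \<le> a\<^sup>2 + b\<^sup>2" if "0 \<le> a" "0 \<le> b" for a b :: real
    using sum_squares_bound[of a b] mult_nonneg_nonneg[OF that] by linarith
  then show "AE x in M. norm (f x * cnj (g x)) \<le> norm ((cmod (f x))\<^sup>2 + (cmod (g x))\<^sup>2)"
    by (auto simp: norm_mult)
qed

lemma L2_inner_add_left: "f \<in> L2 M \<Longrightarrow> g \<in> L2 M \<Longrightarrow> h \<in> L2 M \<Longrightarrow>
    L2_inner M (\<lambda>x. f x + g x) h = L2_inner M f h + L2_inner M g h"
  by (simp add: L2_inner_def distrib_right L2_inner_integrable)

lemma L2_inner_cmult_left: "L2_inner M (\<lambda>x. c * f x) h = c * L2_inner M f h"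
  by (simp add: L2_inner_def mult.assoc)

lemma L2_inner_commute: "L2_inner M f g = cnj (L2_inner M g f)"
  unfolding L2_inner_def by (simp add: Bochner_Integration.integral_cnj[symmetric] mult.commute del: Bochner_Integration.integral_cnj)

lemma L2_inner_cmult_right: "L2_inner M f (\<lambda>x. c * h x) = cnj c * L2_inner M f h"
  by (subst (1 2) L2_inner_commute) (simp add: L2_inner_cmult_left)

lemma L2_inner_diff_left: "f \<in> L2 M \<Longrightarrow> g \<in> L2 M \<Longrightarrow> h \<in> L2 M \<Longrightarrow>
    L2_inner M (\<lambda>x. f x - g x) h = L2_inner M f h - L2_inner M g h"
  by (simp add: L2_inner_def left_diff_distrib L2_inner_integrable)

lemma L2_inner_diff_right: "f \<in> L2 M \<Longrightarrow> g \<in> L2 M \<Longrightarrow> h \<in> L2 M \<Longrightarrow>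
    L2_inner M h (\<lambda>x. f x - g x) = L2_inner M h f - L2_inner M h g"
  by (subst (1 2 3) L2_inner_commute) (simp add: L2_inner_diff_left)

lemma L2_inner_self: "L2_inner M f f = of_real ((L2_nrm M f)\<^sup>2)"
proof -
  have "L2_inner M f f = (\<integral>x. of_real ((cmod (f x))\<^sup>2) \<partial>M)"
    unfolding L2_inner_def by (simp only: complex_norm_square)
  also have "\<dots> = of_real (\<integral>x. (cmod (f x))\<^sup>2 \<partial>M)" by (rule integral_complex_of_real)
  also have "(\<integral>x. (cmod (f x))\<^sup>2 \<partial>M) = (L2_nrm M f)\<^sup>2"
    by (simp add: L2_nrm_def)
  finally show ?thesis .
qed

lemma L2_nrm_nonneg [simp]: "0 \<le> L2_nrm M f"
  by (simp add: L2_nrm_def)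

lemma L2_nrm_power2: "(L2_nrm M f)\<^sup>2 = (\<integral>x. (cmod (f x))\<^sup>2 \<partial>M)"
  by (simp add: L2_nrm_def)

lemma L2_eq_refl [simp]: "L2_eq M f f"
  by (simp add: L2_eq_def)

lemma L2_eq_sym: "L2_eq M f g \<Longrightarrow> L2_eq M g f"
  by (auto simp: L2_eq_def elim: AE_mp)

lemma L2_eq_trans:
  assumes "L2_eq M f g" "L2_eq M g h" shows "L2_eq M f h"
  using assms unfolding L2_eq_def by eventually_elim simp

lemma L2_inner_cong:
  assumes "L2_eq M f f'" "L2_eq M g g'" "f \<in> L2 M" "f' \<in> L2 M" "g \<in> L2 M" "g' \<in> L2 M"
  shows "L2_inner M f g = L2_inner M f' g'"
  unfolding L2_inner_def
proof (rule integral_cong_AE)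
  show "(\<lambda>x. f x * cnj (g x)) \<in> borel_measurable M" "(\<lambda>x. f' x * cnj (g' x)) \<in> borel_measurable M"
    using assms by (auto simp: L2_def)
  show "AE x in M. f x * cnj (g x) = f' x * cnj (g' x)"
    using assms(1,2) unfolding L2_eq_def by eventually_elim simp
qed

lemma L2_nrm_cong:
  assumes "L2_eq M f f'" "f \<in> L2 M" "f' \<in> L2 M"
  shows "L2_nrm M f = L2_nrm M f'"
proof -
  have "complex_of_real ((L2_nrm M f)\<^sup>2) = of_real ((L2_nrm M f')\<^sup>2)"
    using L2_inner_cong[OF assms(1) assms(1) assms(2,3) assms(2,3)] by (simp only: L2_inner_self)
  then show ?thesis by (simp only: of_real_eq_iff) simp
qed

lemma L2_eq_zero_iff:
  assumes "f \<in> L2 M" shows "L2_nrm M f = 0 \<longleftrightarrow> L2_eq M f (\<lambda>_. 0)"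
proof -
  have "L2_nrm M f = 0 \<longleftrightarrow> (\<integral>x. (cmod (f x))\<^sup>2 \<partial>M) = 0" by (simp add: L2_nrm_def)
  also have "\<dots> \<longleftrightarrow> (AE x in M. (cmod (f x))\<^sup>2 = 0)"
    using assms by (intro integral_nonneg_eq_0_iff_AE) (auto simp: L2_def)
  finally show ?thesis by (simp add: L2_eq_def)
qed

section \<open>The direct sum of measure spaces\<close>

text \<open>The index set may be uncountable. So measurability is asked slice by slice, and the mass
  is an unordered sum, written as an integral over the counting measure.\<close>

definition direct_sum :: "('i \<Rightarrow> 'a measure) \<Rightarrow> ('i \<times> 'a) measure" where
  "direct_sum M = measure_of (SIGMA i:UNIV. space (M i))
     {A. A \<subseteq> (SIGMA i:UNIV. space (M i)) \<and> (\<forall>i. Pair i -` A \<in> sets (M i))}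
     (\<lambda>A. \<integral>\<^sup>+i. emeasure (M i) (Pair i -` A) \<partial>count_space UNIV)"

lemma direct_sum_sigma_algebra:
  "sigma_algebra (SIGMA i:UNIV. space (M i))
     {A. A \<subseteq> (SIGMA i:UNIV. space (M i)) \<and> (\<forall>i. Pair i -` A \<in> sets (M i))}"
  (is "sigma_algebra ?\<Omega> ?\<A>")
proof (unfold sigma_algebra_iff2, intro conjI ballI allI impI)
  fix A assume A: "A \<in> ?\<A>"
  have "Pair i -` (?\<Omega> - A) = space (M i) - Pair i -` A" for i by auto
  then show "?\<Omega> - A \<in> ?\<A>" using A by auto
next
  fix A :: "nat \<Rightarrow> _" assume A: "range A \<subseteq> ?\<A>"
  have "Pair i -` (\<Union>n. A n) = (\<Union>n. Pair i -` A n)" for i by auto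
  moreover have "(\<Union>n. Pair i -` A n) \<in> sets (M i)" for i using A by (intro sets.countable_UN) auto
  ultimately show "(\<Union>n. A n) \<in> ?\<A>" using A by auto
qed auto

lemma space_direct_sum: "space (direct_sum M) = (SIGMA i:UNIV. space (M i))"
  unfolding direct_sum_def by (rule space_measure_of) auto

lemma sets_direct_sum: "sets (direct_sum M)
    = {A. A \<subseteq> (SIGMA i:UNIV. space (M i)) \<and> (\<forall>i. Pair i -` A \<in> sets (M i))}"
  unfolding direct_sum_def
  by (subst sets_measure_of) (auto simp only: sigma_algebra.sigma_sets_eq[OF direct_sum_sigma_algebra])

lemma emeasure_direct_sum:
  assumes "A \<in> sets (direct_sum M)"
  shows "emeasure (direct_sum M) A = (\<integral>\<^sup>+i. emeasure (M i) (Pair i -` A) \<partial>count_space UNIV)"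
  unfolding direct_sum_def
proof (rule emeasure_measure_of_sigma[OF direct_sum_sigma_algebra])
  show "positive {A. A \<subseteq> (SIGMA i:UNIV. space (M i)) \<and> (\<forall>i. Pair i -` A \<in> sets (M i))}
     (\<lambda>A. \<integral>\<^sup>+ i. emeasure (M i) (Pair i -` A) \<partial>count_space UNIV)"
    by (simp add: positive_def)
  show "countably_additive {A. A \<subseteq> (SIGMA i:UNIV. space (M i)) \<and> (\<forall>i. Pair i -` A \<in> sets (M i))}
     (\<lambda>A. \<integral>\<^sup>+ i. emeasure (M i) (Pair i -` A) \<partial>count_space UNIV)"
    unfolding countably_additive_def
  proof (intro allI impI)
    fix A :: "nat \<Rightarrow> _"
    assume A: "range A \<subseteq> {A. A \<subseteq> (SIGMA i:UNIV. space (M i)) \<and> (\<forall>i. Pair i -` A \<in> sets (M i))}"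
      and disj: "disjoint_family A"
    have "(\<Sum>n. \<integral>\<^sup>+ i. emeasure (M i) (Pair i -` A n) \<partial>count_space UNIV)
        = (\<integral>\<^sup>+ i. (\<Sum>n. emeasure (M i) (Pair i -` A n)) \<partial>count_space UNIV)"
      by (rule nn_integral_suminf[symmetric]) simp
    also have "\<dots> = (\<integral>\<^sup>+ i. emeasure (M i) (Pair i -` (\<Union>n. A n)) \<partial>count_space UNIV)"
    proof (rule nn_integral_cong)
      fix i
      have "Pair i -` (\<Union>n. A n) = (\<Union>n. Pair i -` A n)" by auto
      moreover have "disjoint_family (\<lambda>n. Pair i -` A n)"
        using disj unfolding disjoint_family_on_def by blast
      ultimately show "(\<Sum>n. emeasure (M i) (Pair i -` A n)) = emeasure (M i) (Pair i -` (\<Union>n. A n))"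
        using A by (simp add: suminf_emeasure image_subset_iff)
    qed
    finally show "(\<Sum>n. \<integral>\<^sup>+ i. emeasure (M i) (Pair i -` A n) \<partial>count_space UNIV)
        = (\<integral>\<^sup>+ i. emeasure (M i) (Pair i -` (\<Union>n. A n)) \<partial>count_space UNIV)" .
  qed
  show "A \<in> {A. A \<subseteq> (SIGMA i:UNIV. space (M i)) \<and> (\<forall>i. Pair i -` A \<in> sets (M i))}"
    using assms by (simp add: sets_direct_sum)
qed

lemma measurable_direct_sum_iff:
  "f \<in> measurable (direct_sum M) L \<longleftrightarrow> (\<forall>i. (\<lambda>x. f (i, x)) \<in> measurable (M i) L)"
proof -
  have "Pair i -` (f -` A \<inter> space (direct_sum M)) = (\<lambda>x. f (i, x)) -` A \<inter> space (M i)" for i A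
    by (auto simp: space_direct_sum)
  then show ?thesis
    unfolding measurable_def by (auto simp: space_direct_sum sets_direct_sum Pi_iff)
qed

lemma measurable_Pair_direct_sum: "Pair i \<in> measurable (M i) (direct_sum M)"
  using measurable_direct_sum_iff[of "\<lambda>x. x" M "direct_sum M"] by simp

lemma slice_in_sets: "{i} \<times> space (M i) \<in> sets (direct_sum M)"
proof -
  have "Pair j -` ({i} \<times> space (M i)) = (if i = j then space (M j) else {})" for j by auto
  then show ?thesis by (auto simp: sets_direct_sum)
qed

text \<open>A summand is the restriction of the sum to its slice, written as a density. Integrals of
  functions carried by one slice thereby reduce to integrals over that summand.\<close>

lemma distr_Pair_direct_sum:
  "distr (M i) (direct_sum M) (Pair i) = density (direct_sum M) (indicator ({i} \<times> space (M i)))"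
proof (rule measure_eqI)
  fix A assume "A \<in> sets (distr (M i) (direct_sum M) (Pair i))"
  then have A: "A \<in> sets (direct_sum M)" by simp
  then have int: "({i} \<times> space (M i)) \<inter> A \<in> sets (direct_sum M)"
    using slice_in_sets[of i M] by auto
  have sl: "Pair j -` (({i} \<times> space (M i)) \<inter> A) = (if i = j then Pair j -` A \<inter> space (M i) else {})" for j
    by auto
  have "emeasure (density (direct_sum M) (indicator ({i} \<times> space (M i)))) A
      = emeasure (direct_sum M) (({i} \<times> space (M i)) \<inter> A)"
    using A slice_in_sets[of i M]
    by (subst emeasure_density) (auto simp: indicator_inter_arith[symmetric] simp flip: nn_integral_indicator)
  also have "\<dots> = (\<integral>\<^sup>+j. emeasure (M i) (Pair i -` A \<inter> space (M i)) * indicator {i} j \<partial>count_space UNIV)"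
    unfolding emeasure_direct_sum[OF int] sl by (intro nn_integral_cong) (auto split: split_indicator)
  also have "\<dots> = emeasure (M i) (Pair i -` A \<inter> space (M i))"
    by (simp add: nn_integral_cmult)
  finally show "emeasure (distr (M i) (direct_sum M) (Pair i)) A
      = emeasure (density (direct_sum M) (indicator ({i} \<times> space (M i)))) A"
    by (simp add: emeasure_distr[OF measurable_Pair_direct_sum A])
qed simp

lemma
  fixes f :: "'i \<times> 'a \<Rightarrow> 'b::{banach, second_countable_topology}"
  assumes f: "f \<in> borel_measurable (direct_sum M)" and z: "\<And>j x. j \<noteq> i \<Longrightarrow> f (j, x) = 0"
  shows integrable_direct_sum_slice: "integrable (direct_sum M) f \<longleftrightarrow> integrable (M i) (\<lambda>x. f (i, x))"
    and integral_direct_sum_slice: "integral\<^sup>L (direct_sum M) f = (\<integral>x. f (i, x) \<partial>M i)"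
proof -
  let ?S = "{i} \<times> space (M i)"
  have S: "?S \<in> sets (direct_sum M)" by (rule slice_in_sets)
  have ind: "indicator ?S w *\<^sub>R f w = f w" if "w \<in> space (direct_sum M)" for w
    using that z by (cases w; cases "fst w = i") (auto simp: space_direct_sum split: split_indicator)
  have *: "density (direct_sum M) (indicator ?S) = density (direct_sum M) (\<lambda>w. ennreal (indicator ?S w))"
    by (simp add: ennreal_indicator)
  show "integrable (direct_sum M) f \<longleftrightarrow> integrable (M i) (\<lambda>x. f (i, x))"
  proof -
    have "integrable (M i) (\<lambda>x. f (i, x)) \<longleftrightarrow> integrable (distr (M i) (direct_sum M) (Pair i)) f"
      by (rule integrable_distr_eq[OF measurable_Pair_direct_sum f, symmetric])
    also have "\<dots> \<longleftrightarrow> integrable (direct_sum M) (\<lambda>w. indicator ?S w *\<^sub>R f w)"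
      unfolding distr_Pair_direct_sum *
      by (rule integrable_density) (use f S in auto)
    also have "\<dots> \<longleftrightarrow> integrable (direct_sum M) f"
      by (rule Bochner_Integration.integrable_cong) (auto simp: ind)
    finally show ?thesis ..
  qed
  show "integral\<^sup>L (direct_sum M) f = (\<integral>x. f (i, x) \<partial>M i)"
  proof -
    have "(\<integral>x. f (i, x) \<partial>M i) = integral\<^sup>L (distr (M i) (direct_sum M) (Pair i)) f"
      by (rule integral_distr[OF measurable_Pair_direct_sum f, symmetric])
    also have "\<dots> = (\<integral>w. indicator ?S w *\<^sub>R f w \<partial>direct_sum M)"
      unfolding distr_Pair_direct_sum *
      by (rule integral_density) (use f S in auto)
    also have "\<dots> = integral\<^sup>L (direct_sum M) f"
      by (rule Bochner_Integration.integral_cong) (auto simp: ind)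
    finally show ?thesis ..
  qed
qed

lemma AE_direct_sum_slice:
  assumes "AE w in direct_sum M. P w" shows "AE x in M i. P (i, x)"
proof -
  obtain A where A: "{w\<in>space (direct_sum M). \<not> P w} \<subseteq> A" "A \<in> sets (direct_sum M)"
    "emeasure (direct_sum M) A = 0" using assms by (auto elim!: AE_E)
  have "AE j in count_space UNIV. emeasure (M j) (Pair j -` A) = 0"
    using A(2,3) by (simp add: emeasure_direct_sum nn_integral_0_iff_AE)
  then have "emeasure (M i) (Pair i -` A) = 0" by (simp add: AE_count_space)
  moreover have "Pair i -` A \<in> sets (M i)" using A(2) by (simp add: sets_direct_sum)
  ultimately show ?thesis
    using A(1) by (intro AE_I[of _ _ "Pair i -` A"]) (auto simp: space_direct_sum)
qed

lemma AE_direct_sum_slice_only: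
  assumes "AE x in M i. P (i, x)" "\<And>j x. j \<noteq> i \<Longrightarrow> P (j, x)"
  shows "AE w in direct_sum M. P w"
proof -
  obtain A where A: "{x\<in>space (M i). \<not> P (i, x)} \<subseteq> A" "A \<in> sets (M i)" "emeasure (M i) A = 0"
    using assms by (auto elim!: AE_E)
  have sl: "Pair j -` ({i} \<times> A) = (if i = j then A else {})" for j by auto
  have S: "{i} \<times> A \<in> sets (direct_sum M)"
    using A(2) sets.sets_into_space[OF A(2)] by (auto simp: sets_direct_sum sl)
  have "emeasure (direct_sum M) ({i} \<times> A) = (\<integral>\<^sup>+j. 0 \<partial>count_space (UNIV :: 'b set))"
    unfolding emeasure_direct_sum[OF S] sl by (intro nn_integral_cong) (use A(3) in auto)
  then show ?thesis
    using A(1) assms(2) S by (intro AE_I[of _ _ "{i} \<times> A"]) (fastforce simp: space_direct_sum)+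
qed

section \<open>A Hilbert space type containing all spaces of square-integrable functions\<close>

text \<open>
  A type cannot depend on the measure \<open>m\<close>, so all measures on \<open>'a\<close> are put side by side, each
  in countably many copies: the functions \<open>((i, m), x) \<mapsto> f x\<close> form the \<open>i\<close>-th copy of \<open>L2 m\<close>,
  and the copies of a fixed \<open>m\<close> make up its amplification.
\<close>

abbreviation all_measures :: "((nat \<times> 'a measure) \<times> 'a) measure" where
  "all_measures \<equiv> direct_sum snd"

definition hsum_rel :: "((nat \<times> 'a measure) \<times> 'a \<Rightarrow> complex) \<Rightarrow> ((nat \<times> 'a measure) \<times> 'a \<Rightarrow> complex) \<Rightarrow> bool"
  where "hsum_rel F G \<longleftrightarrow> F \<in> L2 all_measures \<and> G \<in> L2 all_measures \<and> L2_eq all_measures F G"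

quotient_type 'a hsum = "(nat \<times> 'a measure) \<times> 'a \<Rightarrow> complex" / partial: hsum_rel
proof (rule part_equivpI)
  show "\<exists>F. hsum_rel F F"
    by (intro exI[of _ "\<lambda>_. 0"]) (simp add: hsum_rel_def)
  show "symp hsum_rel" by (auto simp: symp_def hsum_rel_def intro: L2_eq_sym)
  show "transp hsum_rel" by (auto simp: transp_def hsum_rel_def intro: L2_eq_trans)
qed

lemma hsum_rel_self [simp]: "hsum_rel F F \<longleftrightarrow> F \<in> L2 all_measures"
  by (simp add: hsum_rel_def)

lemma hsum_rel_add: "hsum_rel F F' \<Longrightarrow> hsum_rel G G' \<Longrightarrow>
    hsum_rel (\<lambda>w. F w + G w) (\<lambda>w. F' w + G' w)"
  unfolding hsum_rel_def L2_eq_def by (auto intro: L2_add)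

lemma hsum_rel_cmult: "hsum_rel F F' \<Longrightarrow> hsum_rel (\<lambda>w. c * F w) (\<lambda>w. c * F' w)"
  unfolding hsum_rel_def L2_eq_def by (auto intro: L2_cmult)

instantiation hsum :: (type) real_vector
begin

lift_definition zero_hsum :: "'a hsum" is "\<lambda>_. 0" by simp
lift_definition plus_hsum :: "'a hsum \<Rightarrow> 'a hsum \<Rightarrow> 'a hsum" is "\<lambda>F G w. F w + G w"
  by (rule hsum_rel_add)
lift_definition uminus_hsum :: "'a hsum \<Rightarrow> 'a hsum" is "\<lambda>F w. - 1 * F w"
  by (rule hsum_rel_cmult)
lift_definition scaleR_hsum :: "real \<Rightarrow> 'a hsum \<Rightarrow> 'a hsum" is "\<lambda>r F w. of_real r * F w"
  by (rule hsum_rel_cmult)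
definition "x - y = x + - (y :: 'a hsum)"

instance
proof
  fix a b c x y :: "'a hsum" and r s :: real
  show "a + b + c = a + (b + c)"
    by transfer (auto simp: add.assoc L2_add)
  show "a + b = b + a"
    by transfer (auto simp: add.commute L2_add)
  show "0 + a = a" by transfer simp
  show "- a + a = 0" by transfer simp
  show "a - b = a + - b" by (rule minus_hsum_def)
  show "r *\<^sub>R (x + y) = r *\<^sub>R x + r *\<^sub>R y"
    by transfer (auto simp: distrib_left intro: L2_add L2_cmult)
  show "(r + s) *\<^sub>R x = r *\<^sub>R x + s *\<^sub>R x"
    by transfer (auto simp: distrib_right intro: L2_add L2_cmult)
  show "r *\<^sub>R s *\<^sub>R x = (r * s) *\<^sub>R x"
    by transfer (auto simp: mult.assoc intro: L2_cmult)
  show "1 *\<^sub>R x = x" by transfer simp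
qed

end

instantiation hsum :: (type) real_inner
begin

text \<open>Only the real part is an inner product of a real space. The imaginary part of the
  complex one is recovered by multiplying an argument by the imaginary unit through
  \<open>cmul\<close>.\<close>

lift_definition inner_hsum :: "'a hsum \<Rightarrow> 'a hsum \<Rightarrow> real"
  is "\<lambda>F G. Re (L2_inner all_measures F G)"
  by (auto simp: hsum_rel_def intro!: arg_cong[where f = Re] L2_inner_cong)
definition "norm (x :: 'a hsum) = sqrt (inner x x)"
definition "sgn (x :: 'a hsum) = scaleR (inverse (norm x)) x"
definition "dist x y = norm (x - y :: 'a hsum)"
definition "(uniformity :: ('a hsum \<times> 'a hsum) filter) = (INF e\<in>{0<..}. principal {(x, y). dist x y < e})"
definition "open (U :: 'a hsum set) \<longleftrightarrow> (\<forall>x\<in>U. \<forall>\<^sub>F (x', y) in uniformity. x' = x \<longrightarrow> y \<in> U)"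

instance
proof
  fix x y z :: "'a hsum" and r :: real
  show "sgn x = x /\<^sub>R norm x" by (rule sgn_hsum_def)
  show "dist x y = norm (x - y)" by (rule dist_hsum_def)
  show "(uniformity :: ('a hsum \<times> 'a hsum) filter) = (INF e\<in>{0<..}. principal {(x, y). dist x y < e})"
    by (rule uniformity_hsum_def)
  show "open U \<longleftrightarrow> (\<forall>x\<in>U. \<forall>\<^sub>F (x', y) in uniformity. x' = x \<longrightarrow> y \<in> U)" for U :: "'a hsum set"
    by (rule open_hsum_def)
  show "inner x y = inner y x"
    by transfer (metis L2_inner_commute complex_cnj(1) Re_complex_of_real cnj.simps(1))
  show "inner (x + y) z = inner x z + inner y z"
    by transfer (simp add: L2_inner_add_left)
  show "inner (r *\<^sub>R x) y = r * inner x y"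
    by transfer (simp add: L2_inner_cmult_left)
  show "0 \<le> inner x x" by transfer (simp add: L2_inner_self)
  show "inner x x = 0 \<longleftrightarrow> x = 0"
    by transfer (simp add: L2_inner_self hsum_rel_def L2_eq_zero_iff flip: of_real_power)
  show "norm x = sqrt (inner x x)" by (rule norm_hsum_def)
qed

end

text \<open>The complex structure survives as a family of operators on a real Hilbert space; a
  bounded real-linear operator is complex linear when it commutes with them.\<close>

lift_definition cmul :: "complex \<Rightarrow> 'a hsum \<Rightarrow> 'a hsum" is "\<lambda>c F w. c * F w"
  by (rule hsum_rel_cmult)

lemma abs_rep_hsum [simp]: "abs_hsum (rep_hsum F) = F"
  by (rule Quotient_abs_rep[OF Quotient_hsum])

lemma rep_hsum_L2 [simp]: "rep_hsum F \<in> L2 all_measures"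
  using Quotient_rep_reflp[OF Quotient_hsum, of F] by simp

lemma rep_abs_hsum: "F \<in> L2 all_measures \<Longrightarrow> L2_eq all_measures (rep_hsum (abs_hsum F)) F"
  using Quotient_rep_abs[OF Quotient_hsum, of F] by (simp add: hsum_rel_def)

lemma abs_hsum_eqI: "F \<in> L2 all_measures \<Longrightarrow> G \<in> L2 all_measures \<Longrightarrow> L2_eq all_measures F G \<Longrightarrow>
    abs_hsum F = abs_hsum G"
  using Quotient_rel_abs[OF Quotient_hsum, of F G] by (simp add: hsum_rel_def)

lemma abs_hsum_add: "F \<in> L2 all_measures \<Longrightarrow> G \<in> L2 all_measures \<Longrightarrow>
    abs_hsum F + abs_hsum G = abs_hsum (\<lambda>w. F w + G w)"
  by (simp add: plus_hsum.abs_eq)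

lemma abs_hsum_cmult: "F \<in> L2 all_measures \<Longrightarrow> cmul c (abs_hsum F) = abs_hsum (\<lambda>w. c * F w)"
  by (simp add: cmul.abs_eq)

lemma scaleR_eq_cmul: "r *\<^sub>R F = cmul (of_real r) F"
  by transfer (simp add: L2_cmult)

lemma abs_hsum_diff: "F \<in> L2 all_measures \<Longrightarrow> G \<in> L2 all_measures \<Longrightarrow>
    abs_hsum F - abs_hsum G = abs_hsum (\<lambda>w. F w - G w)"
  by (simp add: minus_hsum_def uminus_hsum.abs_eq plus_hsum.abs_eq L2_uminus)

lemma inner_abs_hsum: "F \<in> L2 all_measures \<Longrightarrow> G \<in> L2 all_measures \<Longrightarrow>
    inner (abs_hsum F) (abs_hsum G) = Re (L2_inner all_measures F G)"
  by (simp add: inner_hsum.abs_eq)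

lemma norm_abs_hsum: "F \<in> L2 all_measures \<Longrightarrow> norm (abs_hsum F) = L2_nrm all_measures F"
  by (simp add: norm_eq_sqrt_inner inner_abs_hsum L2_inner_self flip: of_real_power)

lemma rep_hsum_add: "L2_eq all_measures (rep_hsum (F + G)) (\<lambda>w. rep_hsum F w + rep_hsum G w)"
  using rep_abs_hsum[OF L2_add[OF rep_hsum_L2[of F] rep_hsum_L2[of G]]]
  by (simp flip: abs_hsum_add)

lemma rep_hsum_cmul: "L2_eq all_measures (rep_hsum (cmul c F)) (\<lambda>w. c * rep_hsum F w)"
  using rep_abs_hsum[OF L2_cmult[OF rep_hsum_L2[of F], of c]]
  by (simp flip: abs_hsum_cmult)

lemma inner_rep_hsum: "inner F G = Re (L2_inner all_measures (rep_hsum F) (rep_hsum G))"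
  using inner_abs_hsum[of "rep_hsum F" "rep_hsum G"] by simp

lemma cmul_one [simp]: "cmul 1 F = F"
  by transfer simp

lemma cmul_cmul: "cmul c (cmul d F) = cmul (c * d) F"
  by transfer (simp add: L2_cmult mult.assoc)

lemma cmul_add_right: "cmul c (F + G) = cmul c F + cmul c G"
  by transfer (simp add: L2_cmult L2_add distrib_left)

lemma inner_cmul_commute: "inner (cmul c F) G = inner F (cmul (cnj c) G)"
  by transfer (simp add: L2_inner_cmult_left L2_inner_cmult_right)

lemma L2_nrm_cmult: "L2_nrm M (\<lambda>x. c * f x) = cmod c * L2_nrm M f"
  by (simp add: L2_nrm_def norm_mult power_mult_distrib real_sqrt_mult)

lemma norm_cmul: "norm (cmul c F) = cmod c * norm F"
  using norm_abs_hsum[OF L2_cmult[OF rep_hsum_L2[of F]], of c] norm_abs_hsum[OF rep_hsum_L2[of F]]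
    abs_hsum_cmult[OF rep_hsum_L2[of F], of c] by (simp add: L2_nrm_cmult)

lemma bounded_linear_cmul: "bounded_linear (cmul c)"
  by (rule bounded_linear_intro[where K = "cmod c"])
    (simp_all add: cmul_add_right norm_cmul scaleR_eq_cmul cmul_cmul mult.commute)

text \<open>Even with the weights 2^k the squared increments have a summable integral, so their
  weighted sum is finite almost everywhere; there the increments are at most a constant times
  2^(-k/2), hence summable.\<close>

lemma AE_convergent_of_fast_Cauchy:
  fixes f :: "nat \<Rightarrow> 'b \<Rightarrow> complex"
  assumes L2: "\<And>k. f k \<in> L2 M" and fast: "\<And>k. L2_nrm M (\<lambda>x. f (Suc k) x - f k x) \<le> (1/2) ^ k"
  shows "AE x in M. convergent (\<lambda>k. f k x)"
proof -
  have [measurable]: "f k \<in> borel_measurable M" for k using L2 by (simp add: L2_def)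
  define d where "d k x = (cmod (f (Suc k) x - f k x))\<^sup>2" for k x
  have dint: "integrable M (d k)" for k
    unfolding d_def by (rule L2_integrable[OF L2_diff[OF L2 L2]])
  have "(\<integral>\<^sup>+x. (\<Sum>k. ennreal (2 ^ k * d k x)) \<partial>M) = (\<Sum>k. \<integral>\<^sup>+x. ennreal (2 ^ k * d k x) \<partial>M)"
    by (rule nn_integral_suminf) (simp add: d_def)
  also have "\<dots> \<le> (\<Sum>k. ennreal ((1/2) ^ k))"
  proof (intro suminf_le allI summableI)
    fix k
    have "(\<integral>\<^sup>+x. ennreal (2 ^ k * d k x) \<partial>M) = ennreal (\<integral>x. 2 ^ k * d k x \<partial>M)"
      by (rule nn_integral_eq_integral) (use L2_integrable[OF L2_diff[OF L2 L2]] in \<open>auto simp: d_def\<close>)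
    also have "(\<integral>x. 2 ^ k * d k x \<partial>M) = 2 ^ k * (L2_nrm M (\<lambda>x. f (Suc k) x - f k x))\<^sup>2"
      by (simp add: L2_nrm_power2 d_def)
    also have "\<dots> \<le> 2 ^ k * ((1/2) ^ k)\<^sup>2"
      by (intro mult_left_mono power_mono fast) auto
    also have "\<dots> = (1/2) ^ k" by (simp add: power2_eq_square power_divide)
    finally show "(\<integral>\<^sup>+x. ennreal (2 ^ k * d k x) \<partial>M) \<le> ennreal ((1/2) ^ k)"
      by (simp add: ennreal_leI)
  qed
  also have "\<dots> = ennreal (\<Sum>k. (1/2) ^ k)"
    by (rule suminf_ennreal2) (auto intro: summable_geometric)
  finally have fin: "(\<integral>\<^sup>+x. (\<Sum>k. ennreal (2 ^ k * d k x)) \<partial>M) \<noteq> \<infinity>"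
    by (auto simp: top_unique)
  have "AE x in M. (\<Sum>k. ennreal (2 ^ k * d k x)) \<noteq> \<infinity>"
    by (rule nn_integral_PInf_AE[OF _ fin]) (simp add: d_def)
  then show ?thesis
  proof eventually_elim
    case (elim x)
    define s where "s = enn2real (\<Sum>k. ennreal (2 ^ k * d k x))"
    have bd: "cmod (f (Suc k) x - f k x) \<le> sqrt s * (sqrt (1/2)) ^ k" for k
    proof -
      have "ennreal (2 ^ k * d k x) \<le> (\<Sum>k. ennreal (2 ^ k * d k x))"
        using sum_le_suminf[of "\<lambda>k. ennreal (2 ^ k * d k x)" "{k}"] by simp
      also have "\<dots> = ennreal s" using elim by (simp add: s_def ennreal_enn2real_if)
      finally have "2 ^ k * d k x \<le> s"
        by (simp add: s_def)
      then have "d k x \<le> s * (1/2) ^ k" by (simp add: field_simps power_divide)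
      then have "sqrt (d k x) \<le> sqrt (s * (1/2) ^ k)" by simp
      then show ?thesis by (simp add: d_def real_sqrt_mult real_sqrt_power)
    qed
    have "sqrt (1/2 :: real) < 1" by (simp add: real_sqrt_divide)
    then have "summable (\<lambda>k. sqrt s * (sqrt (1/2)) ^ k)"
      by (intro summable_mult summable_geometric) auto
    then have "summable (\<lambda>k. f (Suc k) x - f k x)"
      by (rule summable_comparison_test') (rule bd)
    then have "convergent (\<lambda>n. \<Sum>k<n. f (Suc k) x - f k x)"
      by (simp add: summable_iff_convergent)
    then have "convergent (\<lambda>n. f n x - f 0 x)" by (simp only: sum_lessThan_telescope[of "\<lambda>n. f n x"])
    then have "convergent (\<lambda>n. (f n x - f 0 x) + f 0 x)" by (intro convergent_add convergent_const)
    then show ?case by simp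
  qed
qed

text \<open>The Riesz-Fischer argument: Fatou's lemma for f j - f k, as j grows, shows both that the
  pointwise limit is square-integrable and that it is approached at the stated rate.\<close>

lemma L2_limit_of_fast_Cauchy:
  fixes f :: "nat \<Rightarrow> 'b \<Rightarrow> complex"
  assumes L2: "\<And>k. f k \<in> L2 M"
    and fast: "\<And>k j. k \<le> j \<Longrightarrow> L2_nrm M (\<lambda>x. f j x - f k x) \<le> (1/2) ^ k"
  obtains g where "g \<in> L2 M" "\<And>k. L2_nrm M (\<lambda>x. f k x - g x) \<le> (1/2) ^ k"
proof -
  have [measurable]: "f k \<in> borel_measurable M" for k using L2 by (simp add: L2_def)
  have conv: "AE x in M. convergent (\<lambda>k. f k x)"
    by (rule AE_convergent_of_fast_Cauchy[OF L2 fast]) simp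
  define g where "g x = lim (\<lambda>k. f k x)" for x
  have [measurable]: "g \<in> borel_measurable M" unfolding g_def by measurable
  have bound: "(\<integral>\<^sup>+x. ennreal ((cmod (f k x - g x))\<^sup>2) \<partial>M) \<le> ennreal (((1/2) ^ k)\<^sup>2)" for k
  proof -
    have "(\<integral>\<^sup>+x. ennreal ((cmod (f k x - g x))\<^sup>2) \<partial>M)
        = (\<integral>\<^sup>+x. liminf (\<lambda>j. ennreal ((cmod (f j x - f k x))\<^sup>2)) \<partial>M)"
    proof (rule nn_integral_cong_AE)
      from conv show "AE x in M. ennreal ((cmod (f k x - g x))\<^sup>2)
          = liminf (\<lambda>j. ennreal ((cmod (f j x - f k x))\<^sup>2))"
      proof eventually_elim
        case (elim x)
        then have "(\<lambda>j. f j x) \<longlonglongrightarrow> g x" by (simp add: g_def convergent_LIMSEQ_iff)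
        then have "(\<lambda>j. ennreal ((cmod (f j x - f k x))\<^sup>2)) \<longlonglongrightarrow> ennreal ((cmod (g x - f k x))\<^sup>2)"
          by (intro tendsto_intros tendsto_ennrealI)
        from lim_imp_Liminf[OF sequentially_bot this] show ?case by (simp only: norm_minus_commute)
      qed
    qed
    also have "\<dots> \<le> liminf (\<lambda>j. \<integral>\<^sup>+x. ennreal ((cmod (f j x - f k x))\<^sup>2) \<partial>M)"
      by (rule nn_integral_liminf) simp
    also have "\<dots> \<le> liminf (\<lambda>j. ennreal (((1/2) ^ k)\<^sup>2))"
    proof (rule Liminf_mono)
      have "(\<integral>\<^sup>+x. ennreal ((cmod (f j x - f k x))\<^sup>2) \<partial>M) \<le> ennreal (((1/2) ^ k)\<^sup>2)" if "k \<le> j" for j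
      proof -
        have "(\<integral>\<^sup>+x. ennreal ((cmod (f j x - f k x))\<^sup>2) \<partial>M) = ennreal (\<integral>x. (cmod (f j x - f k x))\<^sup>2 \<partial>M)"
          by (rule nn_integral_eq_integral) (use L2_integrable[OF L2_diff[OF L2 L2]] in auto)
        also have "\<dots> = ennreal ((L2_nrm M (\<lambda>x. f j x - f k x))\<^sup>2)" by (simp add: L2_nrm_power2)
        also have "\<dots> \<le> ennreal (((1/2) ^ k)\<^sup>2)" by (intro ennreal_leI power_mono fast that) simp
        finally show ?thesis .
      qed
      then show "\<forall>\<^sub>F j in sequentially. (\<integral>\<^sup>+x. ennreal ((cmod (f j x - f k x))\<^sup>2) \<partial>M) \<le> ennreal (((1/2) ^ k)\<^sup>2)"
        using eventually_sequentially by blast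
    qed
    finally show ?thesis by (simp only: Liminf_const[OF sequentially_bot])
  qed
  have diff: "(\<lambda>x. f k x - g x) \<in> L2 M" for k
    unfolding L2_def
    by (auto intro!: integrableI_bounded order.strict_trans1[OF bound] simp: ennreal_less_top)
  have g: "g \<in> L2 M"
    using L2_diff[OF L2[of 0] diff[of 0]] by simp
  have "L2_nrm M (\<lambda>x. f k x - g x) \<le> (1/2) ^ k" for k
  proof -
    have "ennreal (\<integral>x. (cmod (f k x - g x))\<^sup>2 \<partial>M) \<le> ennreal (((1/2) ^ k)\<^sup>2)"
      using bound[of k] L2_integrable[OF diff] by (subst nn_integral_eq_integral[symmetric]) auto
    then have "(L2_nrm M (\<lambda>x. f k x - g x))\<^sup>2 \<le> ((1/2) ^ k)\<^sup>2"
      unfolding L2_nrm_power2 by (subst (asm) ennreal_le_iff) auto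
    then show ?thesis by (rule power2_le_imp_le) simp
  qed
  with g show thesis by (rule that)
qed

instance hsum :: (type) banach
proof
  fix X :: "nat \<Rightarrow> 'a hsum" assume X: "Cauchy X"
  have "\<exists>N. \<forall>i\<ge>N. \<forall>j\<ge>N. norm (X i - X j) < (1/2) ^ k" for k
    using CauchyD[OF X, of "(1/2) ^ k"] by simp
  then obtain N where N: "\<And>k i j. N k \<le> i \<Longrightarrow> N k \<le> j \<Longrightarrow> norm (X i - X j) < (1/2) ^ k" by metis
  \<comment> \<open>Summing the \<open>N i\<close> makes \<open>r k\<close> at least every earlier
    \<open>N\<close>, and the summand \<open>k\<close> makes \<open>r\<close> strictly
    increasing.\<close>
  define r where "r k = (\<Sum>i\<le>k. N i) + k" for k
  have r: "strict_mono r" by (rule strict_mono_Suc_iff[THEN iffD2]) (simp add: r_def)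
  have Nr: "N k \<le> r j" if "k \<le> j" for k j
    using member_le_sum[of k "{..j}" N] that by (simp add: r_def trans_le_add1)
  define f where "f k = rep_hsum (X (r k))" for k
  have fL2: "f k \<in> L2 all_measures" for k by (simp add: f_def)
  have nd: "L2_nrm all_measures (\<lambda>x. f j x - f k x) = norm (X (r j) - X (r k))" for j k
    using norm_abs_hsum[OF L2_diff[OF fL2 fL2], of j k] abs_hsum_diff[OF fL2 fL2, of j k]
    by (simp add: f_def)
  have fast: "L2_nrm all_measures (\<lambda>x. f j x - f k x) \<le> (1/2) ^ k" if "k \<le> j" for j k
    unfolding nd by (rule less_imp_le[OF N[OF Nr[OF that] Nr[OF order_refl]]])
  obtain g where g: "g \<in> L2 all_measures" "\<And>k. L2_nrm all_measures (\<lambda>x. f k x - g x) \<le> (1/2) ^ k"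
    by (rule L2_limit_of_fast_Cauchy[OF fL2 fast]) (assumption, rule that)
  have "norm (X (r k) - abs_hsum g) \<le> (1/2) ^ k" for k
    using g(2)[of k] norm_abs_hsum[OF L2_diff[OF fL2 g(1)], of k] abs_hsum_diff[OF fL2 g(1), of k]
    by (simp add: f_def)
  then have "(\<lambda>k. X (r k) - abs_hsum g) \<longlonglongrightarrow> 0"
    by (intro Lim_null_comparison[OF always_eventually LIMSEQ_realpow_zero[of "1/2"]]) auto
  then have "(X \<circ> r) \<longlonglongrightarrow> abs_hsum g" by (simp add: LIM_zero_iff o_def)
  then show "convergent X"
    using Cauchy_converges_subseq[OF X r] by (auto simp: convergent_def)
qed

section \<open>Copies of \<open>L2 m\<close> inside the Hilbert space type\<close>

definition slice_extend :: "'a measure \<Rightarrow> nat \<Rightarrow> ('a \<Rightarrow> complex) \<Rightarrow> (nat \<times> 'a measure) \<times> 'a \<Rightarrow> complex" where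
  "slice_extend m i f w = (if fst w = (i, m) then f (snd w) else 0)"

definition embed :: "'a measure \<Rightarrow> nat \<Rightarrow> ('a \<Rightarrow> complex) \<Rightarrow> 'a hsum" where
  "embed m i f = abs_hsum (slice_extend m i f)"

text \<open>Reads off a chosen representative, so identities between restrictions hold only up to
  \<open>L2_eq\<close>.\<close>

definition restr :: "'a measure \<Rightarrow> nat \<Rightarrow> 'a hsum \<Rightarrow> 'a \<Rightarrow> complex" where
  "restr m i F x = rep_hsum F ((i, m), x)"

lemma slice_extend_L2 [simp]:
  assumes "f \<in> L2 m" shows "slice_extend m i f \<in> L2 all_measures"
proof -
  have meas: "slice_extend m i f \<in> borel_measurable all_measures"
    unfolding measurable_direct_sum_iff
  proof
    fix p :: "nat \<times> 'a measure"
    show "(\<lambda>x. slice_extend m i f (p, x)) \<in> borel_measurable (snd p)"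
      using L2_measurable[OF assms] by (cases "p = (i, m)") (simp_all add: slice_extend_def)
  qed
  have "(\<lambda>w. (cmod (slice_extend m i f w))\<^sup>2) \<in> borel_measurable all_measures"
    using meas by measurable
  then have "integrable all_measures (\<lambda>w. (cmod (slice_extend m i f w))\<^sup>2)"
    using L2_integrable[OF assms]
    by (subst integrable_direct_sum_slice[where i = "(i, m)"]) (auto simp: slice_extend_def)
  then show ?thesis using meas by (simp add: L2_def)
qed

lemma restr_L2 [simp]: "restr m i F \<in> L2 m"
proof -
  have rep: "rep_hsum F \<in> borel_measurable all_measures" by (rule L2_measurable[OF rep_hsum_L2])
  have meas: "restr m i F \<in> borel_measurable m"
    using rep[unfolded measurable_direct_sum_iff, rule_format, of "(i, m)"]
    by (simp add: restr_def[abs_def])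
  have "integrable all_measures (\<lambda>w. indicator ({(i, m)} \<times> space m) w *\<^sub>R (cmod (rep_hsum F w))\<^sup>2)"
    using slice_in_sets[of "(i, m)" snd]
    by (intro integrable_mult_indicator L2_integrable[OF rep_hsum_L2]) simp
  then have "integrable m (\<lambda>x. indicator ({(i, m)} \<times> space m) ((i, m), x) *\<^sub>R (cmod (rep_hsum F ((i, m), x)))\<^sup>2)"
    by (subst (asm) integrable_direct_sum_slice[where i = "(i, m)"])
      (use rep slice_in_sets[of "(i, m)" snd] in \<open>auto intro!: borel_measurable_scaleR\<close>)
  then have "integrable m (\<lambda>x. (cmod (restr m i F x))\<^sup>2)"
    by (rule Bochner_Integration.integrable_cong[THEN iffD1, rotated -1])
      (auto simp: restr_def split: split_indicator)
  then show ?thesis using meas by (simp add: L2_def)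
qed

lemma restr_cong_AE:
  assumes "L2_eq all_measures (rep_hsum F) G" shows "L2_eq m (restr m i F) (\<lambda>x. G ((i, m), x))"
  using AE_direct_sum_slice[OF assms[unfolded L2_eq_def], where i = "(i, m)", unfolded snd_conv]
  by (simp add: L2_eq_def restr_def)

lemma restr_add: "L2_eq m (restr m i (F + G)) (\<lambda>x. restr m i F x + restr m i G x)"
  using restr_cong_AE[OF rep_hsum_add] by (simp add: restr_def)

lemma restr_cmul: "L2_eq m (restr m i (cmul c F)) (\<lambda>x. c * restr m i F x)"
  using restr_cong_AE[OF rep_hsum_cmul] by (simp add: restr_def)

lemma embed_cong:
  assumes "L2_eq m f g" "f \<in> L2 m" "g \<in> L2 m" shows "embed m i f = embed m i g"
  unfolding embed_def
proof (rule abs_hsum_eqI)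
  show "L2_eq all_measures (slice_extend m i f) (slice_extend m i g)"
    unfolding L2_eq_def
    by (rule AE_direct_sum_slice_only[where i = "(i, m)"])
      (use assms(1) in \<open>unfold snd_conv, auto simp: slice_extend_def L2_eq_def\<close>)
qed (simp_all add: assms)

lemma embed_add: "f \<in> L2 m \<Longrightarrow> g \<in> L2 m \<Longrightarrow> embed m i (\<lambda>x. f x + g x) = embed m i f + embed m i g"
  unfolding embed_def
  by (subst abs_hsum_add) (auto intro!: arg_cong[where f = abs_hsum] simp: slice_extend_def)

lemma embed_cmult: "f \<in> L2 m \<Longrightarrow> embed m i (\<lambda>x. c * f x) = cmul c (embed m i f)"
  unfolding embed_def
  by (subst abs_hsum_cmult) (auto intro!: arg_cong[where f = abs_hsum] simp: slice_extend_def)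

lemma embed_zero: "embed m i (\<lambda>_. 0) = 0"
  using embed_cmult[of "\<lambda>_. 0" m i 0] embed_cmult[of "\<lambda>_. 0" m i "of_real 0"]
  by (simp only: scaleR_eq_cmul[symmetric] mult_zero_left) simp

lemma embed_diff: "f \<in> L2 m \<Longrightarrow> g \<in> L2 m \<Longrightarrow> embed m i (\<lambda>x. f x - g x) = embed m i f - embed m i g"
  unfolding embed_def
  by (subst abs_hsum_diff) (auto intro!: arg_cong[where f = abs_hsum] simp: slice_extend_def)

lemma embed_scaleR: "f \<in> L2 m \<Longrightarrow> embed m i (\<lambda>x. of_real c * f x) = c *\<^sub>R embed m i f"
  by (simp add: embed_cmult scaleR_eq_cmul)

lemma restr_embed: "f \<in> L2 m \<Longrightarrow> L2_eq m (restr m i (embed m i f)) f"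
  using restr_cong_AE[OF rep_abs_hsum[OF slice_extend_L2[of f m i]], of m i]
  by (simp add: embed_def slice_extend_def)

lemma restr_embed_other: "f \<in> L2 m \<Longrightarrow> i \<noteq> j \<Longrightarrow> L2_eq m (restr m j (embed m i f)) (\<lambda>_. 0)"
  using restr_cong_AE[OF rep_abs_hsum[OF slice_extend_L2[of f m i]], of m j]
  by (simp add: embed_def slice_extend_def)

lemma inner_embed:
  assumes "g \<in> L2 m" shows "inner F (embed m i g) = Re (L2_inner m (restr m i F) g)"
proof -
  have "inner F (embed m i g) = Re (L2_inner all_measures (rep_hsum F) (slice_extend m i g))"
    using inner_abs_hsum[of "rep_hsum F" "slice_extend m i g"] assms by (simp add: embed_def)
  also have "L2_inner all_measures (rep_hsum F) (slice_extend m i g)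
      = (\<integral>x. rep_hsum F ((i, m), x) * cnj (slice_extend m i g ((i, m), x)) \<partial>snd (i, m))"
    unfolding L2_inner_def
  proof (rule integral_direct_sum_slice)
    show "(\<lambda>w. rep_hsum F w * cnj (slice_extend m i g w)) \<in> borel_measurable all_measures"
      using L2_measurable[OF rep_hsum_L2[of F]] L2_measurable[OF slice_extend_L2[OF assms, of i]]
      by measurable
  qed (auto simp: slice_extend_def)
  also have "\<dots> = L2_inner m (restr m i F) g"
    by (simp add: L2_inner_def restr_def slice_extend_def)
  finally show ?thesis .
qed

lemma inner_embed_embed:
  assumes "f \<in> L2 m" "g \<in> L2 m" shows "inner (embed m i f) (embed m i g) = Re (L2_inner m f g)"
  using L2_inner_cong[OF restr_embed[OF assms(1)] L2_eq_refl] assms by (simp add: inner_embed)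

lemma inner_embed_other:
  assumes "f \<in> L2 m" "g \<in> L2 m" "i \<noteq> j" shows "inner (embed m i f) (embed m j g) = 0"
proof -
  have "inner (embed m i f) (embed m j g) = Re (L2_inner m (\<lambda>_. 0) g)"
    using L2_inner_cong[OF restr_embed_other[OF assms(1,3)] L2_eq_refl] assms by (simp add: inner_embed)
  then show ?thesis by (simp add: L2_inner_def)
qed

lemma norm_embed: "f \<in> L2 m \<Longrightarrow> norm (embed m i f) = L2_nrm m f"
  by (simp add: norm_eq_sqrt_inner inner_embed_embed L2_inner_self flip: of_real_power)

lemma embed_eq_iff:
  assumes "f \<in> L2 m" "g \<in> L2 m" shows "embed m i f = embed m i g \<longleftrightarrow> L2_eq m f g"
proof
  assume "embed m i f = embed m i g"
  then show "L2_eq m f g"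
    using restr_embed[OF assms(1), of i] restr_embed[OF assms(2), of i] L2_eq_sym L2_eq_trans
    by metis
qed (simp add: assms embed_cong)

lemma norm_embed_restr: "norm (embed m i (restr m i F)) \<le> norm F"
proof -
  let ?G = "embed m i (restr m i F)"
  have "(norm ?G)\<^sup>2 = inner F ?G"
  proof -
    have "inner ?G ?G = Re (L2_inner m (restr m i F) (restr m i F))"
      by (rule inner_embed_embed) simp_all
    also have "\<dots> = inner F ?G" by (rule inner_embed[symmetric]) simp
    finally show ?thesis by (simp add: power2_norm_eq_inner)
  qed
  also have "\<dots> \<le> norm F * norm ?G" by (rule norm_cauchy_schwarz)
  finally show ?thesis by (cases "?G = 0") (auto simp: power2_eq_square)
qed

lemma restr_nrm_le: "L2_nrm m (restr m i F) \<le> norm F"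
  using norm_embed_restr[of m i F] by (simp add: norm_embed)

section \<open>Bounded operators\<close>

lemma
  assumes "bounded_op m T"
  shows bounded_op_L2: "f \<in> L2 m \<Longrightarrow> T f \<in> L2 m"
    and bounded_op_add: "f \<in> L2 m \<Longrightarrow> g \<in> L2 m \<Longrightarrow> L2_eq m (T (\<lambda>x. f x + g x)) (\<lambda>x. T f x + T g x)"
    and bounded_op_cmult: "f \<in> L2 m \<Longrightarrow> L2_eq m (T (\<lambda>x. c * f x)) (\<lambda>x. c * T f x)"
  using assms by (auto simp: bounded_op_def)

lemma bounded_op_bound:
  assumes "bounded_op m T"
  obtains C where "0 \<le> C" "\<And>f. f \<in> L2 m \<Longrightarrow> L2_nrm m (T f) \<le> C * L2_nrm m f"
proof -
  obtain C where C: "\<And>f. f \<in> L2 m \<Longrightarrow> L2_nrm m (T f) \<le> C * L2_nrm m f"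
    using assms unfolding bounded_op_def by (elim conjE exE) (rule that, blast)
  show thesis
  proof (rule that)
    fix f assume "f \<in> L2 m"
    then have "L2_nrm m (T f) \<le> C * L2_nrm m f" by (rule C)
    also have "\<dots> \<le> \<bar>C\<bar> * L2_nrm m f" by (intro mult_right_mono) simp_all
    finally show "L2_nrm m (T f) \<le> \<bar>C\<bar> * L2_nrm m f" .
  qed simp
qed

lemma bounded_op_diff:
  assumes "bounded_op m T" "f \<in> L2 m" "g \<in> L2 m"
  shows "L2_eq m (T (\<lambda>x. f x - g x)) (\<lambda>x. T f x - T g x)"
  using bounded_op_add[OF assms(1,2) L2_cmult[OF assms(3), of "-1"]]
    bounded_op_cmult[OF assms(1,3), of "-1"]
  unfolding L2_eq_def by eventually_elim simp

lemma bounded_op_cong: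
  assumes T: "bounded_op m T" and "L2_eq m f g" "f \<in> L2 m" "g \<in> L2 m"
  shows "L2_eq m (T f) (T g)"
proof -
  have d: "(\<lambda>x. f x - g x) \<in> L2 m" using assms by (simp add: L2_diff)
  have "L2_nrm m (\<lambda>x. f x - g x) = 0"
    unfolding L2_eq_zero_iff[OF d] using assms(2) by (simp add: L2_eq_def)
  moreover obtain C where "L2_nrm m (T (\<lambda>x. f x - g x)) \<le> C * L2_nrm m (\<lambda>x. f x - g x)"
    using bounded_op_bound[OF T] d by metis
  ultimately have "L2_nrm m (T (\<lambda>x. f x - g x)) = 0"
    using L2_nrm_nonneg[of m "T (\<lambda>x. f x - g x)"] by simp
  then have "L2_eq m (T (\<lambda>x. f x - g x)) (\<lambda>_. 0)"
    using L2_eq_zero_iff[OF bounded_op_L2[OF T d]] by simp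
  then show ?thesis
    using bounded_op_diff[OF assms(1,3,4)] unfolding L2_eq_def by eventually_elim simp
qed

text \<open>\<open>T\<close> on the i-th copy of \<open>L2 m\<close> and zero on everything
  orthogonal to that copy; for the identity it is the projection onto the copy.\<close>

definition lift_op :: "'a measure \<Rightarrow> nat \<Rightarrow> 'a operator \<Rightarrow> 'a hsum \<Rightarrow> 'a hsum" where
  "lift_op m i T F = embed m i (T (restr m i F))"

lemma lift_op_embed:
  assumes "bounded_op m T" "f \<in> L2 m" shows "lift_op m i T (embed m i f) = embed m i (T f)"
  unfolding lift_op_def
  by (intro embed_cong bounded_op_cong[OF assms(1)] restr_embed assms bounded_op_L2[OF assms(1)]) simp_all

lemma bounded_linear_lift_op:
  assumes T: "bounded_op m T" shows "bounded_linear (lift_op m i T)"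
proof -
  note TL2 = bounded_op_L2[OF T]
  obtain C where C: "0 \<le> C" "\<And>f. f \<in> L2 m \<Longrightarrow> L2_nrm m (T f) \<le> C * L2_nrm m f"
    using bounded_op_bound[OF T] by blast
  show ?thesis
  proof (rule bounded_linear_intro[where K = C])
    fix F G :: "'a hsum" and r :: real
    have "embed m i (T (restr m i (F + G))) = embed m i (T (\<lambda>x. restr m i F x + restr m i G x))"
      by (intro embed_cong bounded_op_cong[OF T] restr_add TL2 L2_add restr_L2)
    also have "\<dots> = embed m i (\<lambda>x. T (restr m i F) x + T (restr m i G) x)"
      by (intro embed_cong bounded_op_add[OF T] TL2 L2_add restr_L2)
    finally show "lift_op m i T (F + G) = lift_op m i T F + lift_op m i T G"
      by (simp add: lift_op_def embed_add TL2)
    have "embed m i (T (restr m i (r *\<^sub>R F))) = embed m i (T (\<lambda>x. of_real r * restr m i F x))"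
      unfolding scaleR_eq_cmul by (intro embed_cong bounded_op_cong[OF T] restr_cmul TL2 L2_cmult restr_L2)
    also have "\<dots> = embed m i (\<lambda>x. of_real r * T (restr m i F) x)"
      by (intro embed_cong bounded_op_cmult[OF T] TL2 L2_cmult restr_L2)
    finally show "lift_op m i T (r *\<^sub>R F) = r *\<^sub>R lift_op m i T F"
      by (simp add: lift_op_def embed_scaleR TL2)
    have "norm (lift_op m i T F) \<le> C * L2_nrm m (restr m i F)"
      using C(2)[OF restr_L2] by (simp add: lift_op_def norm_embed TL2)
    also have "\<dots> \<le> C * norm F" by (intro mult_left_mono restr_nrm_le C)
    finally show "norm (lift_op m i T F) \<le> norm F * C" by (simp add: mult.commute)
  qed
qed

lemma bounded_op_cmult_id: "bounded_op m (\<lambda>f x. c * f x)"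
  unfolding bounded_op_def
  by (auto simp: L2_cmult L2_nrm_cmult algebra_simps intro!: exI[of _ "cmod c"])

lemma bounded_op_id: "bounded_op m (\<lambda>f. f)"
  using bounded_op_cmult_id[of m 1] by simp

text \<open>The matrix entry of \<open>Q\<close> from copy \<open>j\<close> to copy
  \<open>i\<close>.\<close>

definition restr_op :: "'a measure \<Rightarrow> nat \<Rightarrow> nat \<Rightarrow> ('a hsum \<Rightarrow> 'a hsum) \<Rightarrow> 'a operator" where
  "restr_op m i j Q f = restr m i (Q (embed m j f))"

text \<open>\<open>Q\<close> is only real linear, so complex homogeneity of the entry is a
  hypothesis; it is asked for after restriction to copy \<open>i\<close>.\<close>

lemma bounded_op_restr_op:
  assumes Q: "bounded_linear Q"
    and cm: "\<And>c f. f \<in> L2 m \<Longrightarrow> L2_eq m (restr m i (Q (cmul c (embed m j f)))) (restr m i (cmul c (Q (embed m j f))))"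
  shows "bounded_op m (restr_op m i j Q)"
proof -
  interpret Q: bounded_linear Q by fact
  obtain K where K: "\<And>x. norm (Q x) \<le> norm x * K" using Q.bounded by blast
  show ?thesis
    unfolding bounded_op_def restr_op_def
  proof (intro conjI ballI allI exI[of _ K])
    fix f g :: "'a \<Rightarrow> complex" and c assume f: "f \<in> L2 m"
    show "restr m i (Q (embed m j f)) \<in> L2 m" by simp
    show "L2_nrm m (restr m i (Q (embed m j f))) \<le> K * L2_nrm m f"
      using order_trans[OF restr_nrm_le K[of "embed m j f"]] f by (simp add: norm_embed mult.commute)
    show "L2_eq m (restr m i (Q (embed m j (\<lambda>x. c * f x)))) (\<lambda>x. c * restr m i (Q (embed m j f)) x)"
      using L2_eq_trans[OF cm restr_cmul] f by (simp add: embed_cmult)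
    show "L2_eq m (restr m i (Q (embed m j (\<lambda>x. f x + g x)))) (\<lambda>x. restr m i (Q (embed m j f)) x + restr m i (Q (embed m j g)) x)"
      if "g \<in> L2 m"
      using restr_add f that by (simp add: embed_add Q.add)
  qed
qed

lemma L2_inner_eq_of_Re:
  assumes "\<And>c. Re (L2_inner M (\<lambda>x. c * f x) g) = Re (L2_inner M (\<lambda>x. c * f' x) g')"
  shows "L2_inner M f g = L2_inner M f' g'"
  using assms[of 1] assms[of \<i>] by (simp add: L2_inner_cmult_left complex_eq_iff)

section \<open>Haar measure and translations\<close>

text \<open>The tube lemma for the group law: finitely many product neighbourhoods of points (0, k)
  cover {0} x K, and the intersection of their first factors is the required
  \<open>V\<close>.\<close>

lemma compact_translate_nhds:
  fixes K :: "'a::topological_group_add set"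
  assumes "compact K" "open O'" "K \<subseteq> O'"
  obtains V where "open V" "0 \<in> V" "\<And>t k. t \<in> V \<Longrightarrow> k \<in> K \<Longrightarrow> t + k \<in> O'"
proof -
  define W where "W = (\<lambda>p::'a \<times> 'a. fst p + snd p) -` O'"
  have "open W"
    unfolding W_def by (intro open_vimage assms continuous_intros)
  have "\<exists>A B. open A \<and> open B \<and> 0 \<in> A \<and> k \<in> B \<and> A \<times> B \<subseteq> W" if "k \<in> K" for k
  proof -
    have "(0, k) \<in> W" using that assms(3) by (auto simp: W_def)
    then show ?thesis using \<open>open W\<close> by (metis mem_Sigma_iff open_prod_elim)
  qed
  then obtain A B where AB: "\<And>k. k \<in> K \<Longrightarrow> open (A k) \<and> open (B k) \<and> 0 \<in> A k \<and> k \<in> B k \<and> A k \<times> B k \<subseteq> W"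
    by metis
  obtain C where C: "C \<subseteq> K" "finite C" "K \<subseteq> (\<Union>k\<in>C. B k)"
    using compactE_image[OF assms(1), of K B] AB by blast
  show thesis
  proof (rule that[of "\<Inter>k\<in>C. A k"])
    show "open (\<Inter>k\<in>C. A k)" using C AB by (intro open_INT) auto
    show "0 \<in> (\<Inter>k\<in>C. A k)" using C AB by auto
    fix t k assume "t \<in> (\<Inter>k\<in>C. A k)" "k \<in> K"
    then obtain c where "c \<in> C" "k \<in> B c" "t \<in> A c" using C by blast
    then have "(t, k) \<in> W" using AB C by blast
    then show "t + k \<in> O'" by (simp add: W_def)
  qed
qed

lemma continuous_on_left_translate: "continuous_on S ((+) (x :: 'a::topological_group_add))"
  by (intro continuous_intros)

lemma vimage_left_translate: "(+) x -` A = (+) (- x :: 'a::group_add) ` A"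
  by (force simp: add.assoc[symmetric])

lemma open_left_translate: "open U \<Longrightarrow> open ((+) (x :: 'a::topological_group_add) ` U)"
  using open_vimage[OF _ continuous_on_left_translate[of UNIV "- x"], of U]
  by (simp add: vimage_left_translate)

lemma compact_left_translate: "compact K \<Longrightarrow> compact ((+) (x :: 'a::topological_group_add) ` K)"
  by (intro compact_continuous_image continuous_on_left_translate)

lemma measure_less_of_emeasure_less:
  assumes "emeasure M A < ennreal e" "0 < e" shows "measure M A < e"
  using assms unfolding measure_def by (cases "emeasure M A") (auto simp: ennreal_less_iff)

locale haar =
  fixes m :: "'a::{topological_group_add, t2_space} measure"
  assumes left_Haar: "left_Haar_measure m"
begin

lemma sets_m [measurable_cong, simp]: "sets m = sets borel"
  using left_Haar by (simp add: left_Haar_measure_def)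

lemma space_m [simp]: "space m = UNIV"
  using sets_eq_imp_space_eq[OF sets_m] by simp

lemma emeasure_left_translate: "A \<in> sets borel \<Longrightarrow> emeasure m ((+) x ` A) = emeasure m A"
  using left_Haar by (simp add: left_Haar_measure_def)

lemma emeasure_compact: "compact K \<Longrightarrow> emeasure m K < top"
  using left_Haar by (simp add: left_Haar_measure_def)

lemma compact_sets: "compact K \<Longrightarrow> K \<in> sets (borel :: 'a measure)"
  by (rule borel_closed[OF compact_imp_closed])

lemma emeasure_outer: "A \<in> sets borel \<Longrightarrow> emeasure m A = (INF U\<in>{U. open U \<and> A \<subseteq> U}. emeasure m U)"
  using left_Haar by (simp add: left_Haar_measure_def)

lemma emeasure_inner: "open U \<Longrightarrow> emeasure m U = (SUP K\<in>{K. compact K \<and> K \<subseteq> U}. emeasure m K)"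
  using left_Haar unfolding left_Haar_measure_def by blast

lemma measurable_left_translate [measurable]: "(+) x \<in> m \<rightarrow>\<^sub>M m"
  using borel_measurable_continuous_onI[OF continuous_on_left_translate[of UNIV x]]
    measurable_cong_sets[OF sets_m sets_m] by blast

lemma distr_left_translate: "distr m m ((+) x) = m"
proof (rule measure_eqI)
  fix A assume "A \<in> sets (distr m m ((+) x))"
  then have A: "A \<in> sets m" by simp
  show "emeasure (distr m m ((+) x)) A = emeasure m A"
    using A emeasure_left_translate[of A "- x"]
    by (simp add: emeasure_distr[OF measurable_left_translate A] vimage_left_translate)
qed simp

lemma integral_left_translate:
  fixes f :: "'a \<Rightarrow> 'b::{banach, second_countable_topology}"
  assumes "f \<in> borel_measurable m" shows "(\<integral>y. f (x + y) \<partial>m) = integral\<^sup>L m f"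
  using integral_distr[OF measurable_left_translate assms, of x] by (simp add: distr_left_translate)

lemma integrable_left_translate:
  fixes f :: "'a \<Rightarrow> 'b::{banach, second_countable_topology}"
  assumes "f \<in> borel_measurable m" shows "integrable m (\<lambda>y. f (x + y)) \<longleftrightarrow> integrable m f"
  using integrable_distr_eq[OF measurable_left_translate assms, of x] by (simp add: distr_left_translate)

lemma left_regular_L2 [simp]:
  assumes "f \<in> L2 m" shows "left_regular x f \<in> L2 m"
proof -
  have f: "f \<in> borel_measurable m" by (rule L2_measurable[OF assms])
  have "(\<lambda>y. f (- x + y)) \<in> borel_measurable m"
    by (rule measurable_compose[OF measurable_left_translate f])
  moreover have "integrable m (\<lambda>y. (cmod (f (- x + y)))\<^sup>2)"
    using L2_integrable[OF assms] f by (subst integrable_left_translate) auto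
  ultimately show ?thesis by (simp add: L2_def left_regular_def)
qed

lemma L2_inner_left_regular:
  assumes "f \<in> L2 m" "g \<in> L2 m"
  shows "L2_inner m (left_regular x f) (left_regular x g) = L2_inner m f g"
  unfolding L2_inner_def left_regular_def
  by (rule integral_left_translate[of "\<lambda>y. f y * cnj (g y)"])
    (rule borel_measurable_integrable[OF L2_inner_integrable[OF assms]])

lemma left_regular_left_regular: "left_regular x (left_regular y f) = left_regular (x + y) f"
  by (simp add: left_regular_def add.assoc minus_add fun_eq_iff del: add_uminus_conv_diff)

lemma left_regular_zero [simp]: "left_regular 0 f = f"
  by (simp add: left_regular_def)

lemma L2_inner_left_regular_left:
  assumes "f \<in> L2 m" "g \<in> L2 m"
  shows "L2_inner m (left_regular x f) g = L2_inner m f (left_regular (- x) g)"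
  using L2_inner_left_regular[OF assms(1) left_regular_L2[OF assms(2), of "- x"], of x]
  by (simp add: left_regular_left_regular)

lemma L2_nrm_left_regular: "f \<in> L2 m \<Longrightarrow> L2_nrm m (left_regular x f) = L2_nrm m f"
  using L2_inner_left_regular[of f f x]
  by (simp add: L2_inner_self flip: of_real_power)

lemma bounded_op_left_regular: "bounded_op m (left_regular x)"
  unfolding bounded_op_def
  by (intro conjI ballI allI exI[of _ 1]) (simp_all add: L2_nrm_left_regular, simp_all add: left_regular_def)

lemma norm_embed_left_regular: "f \<in> L2 m \<Longrightarrow> norm (embed m i (left_regular x f)) = norm (embed m i f)"
  by (simp add: norm_embed L2_nrm_left_regular)

lemma left_regular_add: "left_regular x (\<lambda>y. f y + g y) = (\<lambda>y. left_regular x f y + left_regular x g y)"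
  and left_regular_diff: "left_regular x (\<lambda>y. f y - g y) = (\<lambda>y. left_regular x f y - left_regular x g y)"
  and left_regular_cmult: "left_regular x (\<lambda>y. c * f y) = (\<lambda>y. c * left_regular x f y)"
  by (simp_all add: left_regular_def)

text \<open>Finitely many translates of \<open>U\<close> cover any given compact set. If
  \<open>U\<close> were null, so would be all compact sets and, by inner regularity of the whole
  space, the measure itself.\<close>

lemma emeasure_open_pos:
  assumes "open U" "U \<noteq> {}" shows "emeasure m U \<noteq> 0"
proof
  assume z: "emeasure m U = 0"
  obtain x where "x \<in> U" using assms by blast
  have "emeasure m K = 0" if Kc: "compact K" for K
  proof -
    have "K \<subseteq> (\<Union>g\<in>K. (+) (g + - x) ` U)"
    proof
      fix g assume "g \<in> K"
      then show "g \<in> (\<Union>g\<in>K. (+) (g + - x) ` U)"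
        using \<open>x \<in> U\<close> by (intro UN_I[of g] image_eqI[of _ _ x]) (auto simp: add.assoc simp del: add_uminus_conv_diff)
    qed
    then obtain C where C: "C \<subseteq> K" "finite C" "K \<subseteq> (\<Union>g\<in>C. (+) (g + - x) ` U)"
      using compactE_image[OF Kc, of K "\<lambda>g. (+) (g + - x) ` U"] open_left_translate[OF assms(1)] by blast
    have "emeasure m K \<le> emeasure m (\<Union>g\<in>C. (+) (g + - x) ` U)"
      using C(3) open_left_translate[OF assms(1)]
      by (intro emeasure_mono) (auto intro!: borel_open open_UN simp del: add_uminus_conv_diff)
    also have "\<dots> \<le> (\<Sum>g\<in>C. emeasure m ((+) (g + - x) ` U))"
      using C assms(1) by (intro emeasure_subadditive_finite) (auto intro!: open_left_translate borel_open)
    also have "\<dots> = 0" using assms(1) z by (simp add: emeasure_left_translate del: add_uminus_conv_diff)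
    finally show ?thesis by simp
  qed
  then have "emeasure m UNIV \<le> 0"
    unfolding emeasure_inner[OF open_UNIV] by (intro SUP_least) simp
  then show False using left_Haar by (simp add: left_Haar_measure_def)
qed

lemma open_superset:
  assumes "A \<in> sets borel" "emeasure m A < top" "0 < e"
  obtains U where "open U" "A \<subseteq> U" "emeasure m U < top" "measure m (U - A) < e"
proof -
  have "emeasure m A < emeasure m A + ennreal e"
    using assms(2,3) by (simp add: ennreal_add_left_cancel_less)
  then have "(INF U\<in>{U. open U \<and> A \<subseteq> U}. emeasure m U) < emeasure m A + ennreal e"
    by (simp only: emeasure_outer[OF assms(1), symmetric])
  then obtain U where U: "open U" "A \<subseteq> U" "emeasure m U < emeasure m A + ennreal e"
    by (auto simp: INF_less_iff)
  have Ufin: "emeasure m U < top"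
    by (rule less_trans[OF U(3)]) (use assms(2) in simp)
  have "emeasure m (U - A) = emeasure m U - emeasure m A"
    using U assms by (intro emeasure_Diff) auto
  also have "\<dots> < ennreal e"
    using U(3) assms(2,3) Ufin
    by (cases "emeasure m U"; cases "emeasure m A")
      (auto simp: ennreal_minus ennreal_less_iff simp flip: ennreal_plus intro!: ennreal_lessI)
  finally have "measure m (U - A) < e"
    using assms(3) by (rule measure_less_of_emeasure_less)
  with U Ufin show thesis by (intro that)
qed

lemma compact_subset_open:
  assumes "open U" "emeasure m U < top" "0 < e"
  obtains K where "compact K" "K \<subseteq> U" "measure m (U - K) < e"
proof (cases "emeasure m U = 0")
  case True
  then show thesis using that[of "{}"] assms(3) by (simp add: measure_def)
next
  case False
  have "emeasure m U - ennreal e < emeasure m U"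
    using False assms(2,3) by (intro ennreal_between) (auto simp: zero_less_iff_neq_zero)
  then obtain K where K: "compact K" "K \<subseteq> U" "emeasure m U - ennreal e < emeasure m K"
    using emeasure_inner[OF assms(1)] by (auto simp: less_SUP_iff)
  have "emeasure m (U - K) = emeasure m U - emeasure m K"
    using K assms emeasure_compact[OF K(1)] by (intro emeasure_Diff) (auto simp: compact_sets)
  also have "\<dots> < ennreal e"
  proof -
    obtain a b where ab: "emeasure m U = ennreal a" "0 \<le> a" "emeasure m K = ennreal b" "0 \<le> b"
      using assms(2) emeasure_compact[OF K(1)] by (cases "emeasure m U"; cases "emeasure m K") auto
    have "ennreal (a - e) < ennreal b" using K(3) ab assms(3) by (simp add: ennreal_minus)
    then have "a - e < b" using ennreal_leI leD by (meson not_le)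
    then show ?thesis using ab assms(3) by (auto simp: ennreal_minus intro!: ennreal_lessI)
  qed
  finally have "measure m (U - K) < e"
    using assms(3) by (rule measure_less_of_emeasure_less)
  then show thesis using K that by blast
qed

section \<open>Continuity of left translation in the square mean\<close>

definition translation_continuous :: "('a \<Rightarrow> complex) \<Rightarrow> bool" where
  "translation_continuous f \<longleftrightarrow> f \<in> L2 m \<and>
     ((\<lambda>t. embed m 0 (left_regular t f)) \<longlongrightarrow> embed m 0 f) (nhds 0)"

lemma translation_continuous_add:
  assumes "translation_continuous f" "translation_continuous g"
  shows "translation_continuous (\<lambda>x. f x + g x)"
proof -
  have L2: "f \<in> L2 m" "g \<in> L2 m" using assms by (auto simp: translation_continuous_def)
  have "((\<lambda>t. embed m 0 (left_regular t f) + embed m 0 (left_regular t g)) \<longlongrightarrow> embed m 0 f + embed m 0 g) (nhds 0)"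
    using assms by (intro tendsto_add) (auto simp: translation_continuous_def)
  then show ?thesis using L2
    by (simp add: translation_continuous_def L2_add left_regular_add embed_add)
qed

lemma translation_continuous_cmult:
  assumes "translation_continuous f" shows "translation_continuous (\<lambda>x. c * f x)"
proof -
  have L2: "f \<in> L2 m" using assms by (auto simp: translation_continuous_def)
  have "((\<lambda>t. cmul c (embed m 0 (left_regular t f))) \<longlongrightarrow> cmul c (embed m 0 f)) (nhds 0)"
    using assms by (intro bounded_linear.tendsto[OF bounded_linear_cmul]) (auto simp: translation_continuous_def)
  then show ?thesis using L2
    by (simp add: translation_continuous_def L2_cmult left_regular_cmult embed_cmult)
qed

lemma translation_continuous_sum:
  assumes "finite V" "\<And>v. v \<in> V \<Longrightarrow> translation_continuous (f v)"
  shows "translation_continuous (\<lambda>x. \<Sum>v\<in>V. f v x)"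
  using assms
proof (induction V)
  case empty
  then show ?case by (simp add: translation_continuous_def left_regular_def)
qed (simp add: translation_continuous_add)

lemma translation_continuous_limit:
  assumes f: "f \<in> L2 m" and ap: "\<And>e. 0 < e \<Longrightarrow> \<exists>g. translation_continuous g \<and> L2_nrm m (\<lambda>x. f x - g x) < e"
  shows "translation_continuous f"
  unfolding translation_continuous_def
proof (intro conjI f tendstoI)
  fix e :: real assume "0 < e"
  then obtain g where g: "translation_continuous g" and d: "L2_nrm m (\<lambda>x. f x - g x) < e / 3"
    using ap[of "e / 3"] by auto
  have gL2: "g \<in> L2 m" using g by (simp add: translation_continuous_def)
  have 1: "dist (embed m 0 (left_regular t f)) (embed m 0 (left_regular t g)) < e / 3" for t
  proof -
    have "embed m 0 (left_regular t f) - embed m 0 (left_regular t g)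
        = embed m 0 (left_regular t (\<lambda>x. f x - g x))"
      by (simp add: left_regular_diff embed_diff f gL2)
    then show ?thesis
      using d by (simp add: dist_norm norm_embed L2_nrm_left_regular L2_diff f gL2)
  qed
  have "\<forall>\<^sub>F t in nhds 0. dist (embed m 0 (left_regular t g)) (embed m 0 g) < e / 3"
    using g \<open>0 < e\<close> unfolding translation_continuous_def by (intro tendstoD) auto
  then show "\<forall>\<^sub>F t in nhds 0. dist (embed m 0 (left_regular t f)) (embed m 0 f) < e"
  proof eventually_elim
    case (elim t)
    show ?case
      using 1[of t] 1[of 0] elim
        dist_triangle[of "embed m 0 (left_regular t f)" "embed m 0 f" "embed m 0 (left_regular t g)"]
        dist_triangle[of "embed m 0 (left_regular t g)" "embed m 0 f" "embed m 0 g"]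
      by (simp add: dist_commute)
  qed
qed

lemma L2_indicator: "A \<in> sets m \<Longrightarrow> emeasure m A < top \<Longrightarrow> (\<lambda>x. indicator A x :: complex) \<in> L2 m"
proof -
  assume A: "A \<in> sets m" "emeasure m A < top"
  have "(\<lambda>x. (cmod (indicator A x))\<^sup>2) = (indicator A :: 'a \<Rightarrow> real)"
    by (auto simp: fun_eq_iff split: split_indicator)
  then show ?thesis using A by (simp add: L2_def)
qed

lemma L2_nrm_indicator_diff:
  assumes "A \<in> sets m" "B \<in> sets m" "C \<in> sets m" "(A - B) \<union> (B - A) \<subseteq> C" "emeasure m C < top"
  shows "(L2_nrm m (\<lambda>x. indicator A x - indicator B x))\<^sup>2 \<le> measure m C"
proof -
  have "(L2_nrm m (\<lambda>x. indicator A x - indicator B x))\<^sup>2 = (\<integral>x. (cmod (indicator A x - indicator B x))\<^sup>2 \<partial>m)"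
    by (rule L2_nrm_power2)
  also have "\<dots> \<le> (\<integral>x. indicator C x \<partial>m)"
    using assms by (intro integral_mono') (auto split: split_indicator)
  finally show ?thesis using assms by simp
qed

text \<open>When t + K and - t + K both lie in an open \<open>U\<close> containing \<open>K\<close>,
  the sets \<open>K\<close> and t + K differ only inside U - K and its translate by
  \<open>t\<close>, and outer regularity makes these small.\<close>

lemma translation_continuous_compact:
  assumes K: "compact K" shows "translation_continuous (indicator K)"
  unfolding translation_continuous_def
proof (intro conjI tendstoI)
  have Km: "K \<in> sets m" "emeasure m K < top" using K by (auto simp: compact_sets emeasure_compact)
  then show KL2: "indicator K \<in> L2 m" by (rule L2_indicator)
  fix e :: real assume "0 < e"
  then have e: "0 < e\<^sup>2 / 2" by simp
  \<comment> \<open>Half of e^2 for U - K and half for its translate by \<open>t\<close>, which has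
    the same measure.\<close>
  obtain U where U: "open U" "K \<subseteq> U" and Ufin: "emeasure m U < top" and UK: "measure m (U - K) < e\<^sup>2 / 2"
    using open_superset[OF Km[unfolded sets_m] e] by blast
  obtain V where V: "open V" "0 \<in> V" "\<And>t k. t \<in> V \<Longrightarrow> k \<in> K \<Longrightarrow> t + k \<in> U"
    using compact_translate_nhds[OF K U(1,2)] by metis
  have "open (V \<inter> uminus -` V)"
    using V by (intro open_Int open_vimage continuous_intros)
  moreover have "0 \<in> V \<inter> uminus -` V" using V by simp
  moreover have "dist (embed m 0 (left_regular t (indicator K))) (embed m 0 (indicator K)) < e"
    if t: "t \<in> V \<inter> uminus -` V" for t
  proof -
    let ?C = "(U - K) \<union> (+) t ` (U - K)"
    have reg: "left_regular t (indicator K) = (indicator ((+) t ` K) :: 'a \<Rightarrow> complex)"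
      using vimage_left_translate[of "- t" K]
      by (auto simp: left_regular_def fun_eq_iff indicator_def)
    have tUK: "(+) t ` (U - K) \<in> sets m"
      using U K vimage_left_translate[of "- t" "U - K"] measurable_sets[OF measurable_left_translate[of "- t"], of "U - K"]
      by (simp add: compact_sets borel_open sets.Diff compact_imp_closed)
    have UKs: "U - K \<in> sets m" using U K by (simp add: borel_open sets.Diff compact_imp_closed)
    have fin: "emeasure m (U - K) < top"
      using Ufin U by (intro le_less_trans[OF emeasure_mono Ufin]) auto
    have fint: "emeasure m ((+) t ` (U - K)) < top" and meq: "measure m ((+) t ` (U - K)) = measure m (U - K)"
      using fin UKs emeasure_left_translate[of "U - K" t] by (auto simp: measure_def)
    have sub: "((+) t ` K - K) \<union> (K - (+) t ` K) \<subseteq> ?C"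
    proof -
      have "k \<in> (+) t ` (U - K)" if "k \<in> K" "k \<notin> (+) t ` K" for k
      proof -
        have "- t + k \<in> U - K"
          using V(3)[of "- t" k] t that by (auto simp: image_iff)
        then show ?thesis by (force simp: image_iff add.assoc[symmetric] simp del: add_uminus_conv_diff)
      qed
      then show ?thesis using V(3) t by auto
    qed
    have "(L2_nrm m (\<lambda>x. indicator ((+) t ` K) x - indicator K x))\<^sup>2 \<le> measure m ?C"
    proof (rule L2_nrm_indicator_diff[OF _ _ _ sub])
      show "emeasure m ?C < top"
        using emeasure_subadditive[OF UKs tUK] fin fint
        by (auto intro: le_less_trans)
    qed (use K tUK UKs compact_sets[OF compact_left_translate[OF K]] in \<open>auto simp: compact_sets\<close>)
    also have "\<dots> \<le> measure m (U - K) + measure m ((+) t ` (U - K))"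
      using fin fint UKs tUK by (intro measure_Un_le) auto
    also have "\<dots> < e\<^sup>2" using UK meq by simp
    finally have "L2_nrm m (\<lambda>x. indicator ((+) t ` K) x - indicator K x) < e"
      using \<open>0 < e\<close> by (simp add: power2_less_imp_less)
    moreover have tK: "(indicator ((+) t ` K) :: 'a \<Rightarrow> complex) \<in> L2 m"
      using compact_left_translate[OF K] by (intro L2_indicator) (auto simp: compact_sets emeasure_compact)
    ultimately show ?thesis
      unfolding reg dist_norm by (simp add: norm_embed L2_diff KL2 flip: embed_diff)
  qed
  ultimately show "\<forall>\<^sub>F t in nhds 0. dist (embed m 0 (left_regular t (indicator K))) (embed m 0 (indicator K)) < e"
    by (auto simp: eventually_nhds)
qed

text \<open>Inner regularity is available for open sets only. So \<open>A\<close> is compared with a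
  compact \<open>K\<close> inside an open \<open>U\<close> containing \<open>A\<close>;
  \<open>K\<close> need not lie in \<open>A\<close>, but both differ little from
  \<open>U\<close>.\<close>

lemma translation_continuous_indicator:
  assumes A: "A \<in> sets m" "emeasure m A < top" shows "translation_continuous (indicator A)"
proof (rule translation_continuous_limit[OF L2_indicator[OF A]])
  fix e :: real assume "0 < e"
  then have e: "0 < e\<^sup>2 / 2" by simp
  obtain U where U: "open U" "A \<subseteq> U" and Ufin: "emeasure m U < top" and UA: "measure m (U - A) < e\<^sup>2 / 2"
    using open_superset[OF A[unfolded sets_m] e] by blast
  obtain K where K: "compact K" "K \<subseteq> U" "measure m (U - K) < e\<^sup>2 / 2"
    using compact_subset_open[OF U(1) Ufin e] by blast
  have s: "U - A \<in> sets m" "U - K \<in> sets m"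
    using U A K by (auto simp: borel_open compact_imp_closed)
  have fin: "emeasure m ((U - A) \<union> (U - K)) < top"
    using U by (intro le_less_trans[OF emeasure_mono Ufin]) auto
  have fin': "emeasure m (U - A) < top" "emeasure m (U - K) < top"
    using U by (auto intro!: le_less_trans[OF emeasure_mono Ufin])
  have "(L2_nrm m (\<lambda>x. indicator A x - indicator K x))\<^sup>2 \<le> measure m ((U - A) \<union> (U - K))"
    using A K U s fin by (intro L2_nrm_indicator_diff) (auto simp: compact_sets compact_imp_closed)
  also have "\<dots> \<le> measure m (U - A) + measure m (U - K)"
    using fin' s by (intro measure_Un_le) auto
  also have "\<dots> < e\<^sup>2" using UA K by simp
  finally have "L2_nrm m (\<lambda>x. indicator A x - indicator K x) < e"
    using \<open>0 < e\<close> by (simp add: power2_less_imp_less)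
  then show "\<exists>g. translation_continuous g \<and> L2_nrm m (\<lambda>x. indicator A x - g x) < e"
    using translation_continuous_compact[OF K(1)] by blast
qed

lemma L2_emeasure_superlevel:
  assumes "f \<in> L2 m" "0 < c" shows "emeasure m {x. c \<le> cmod (f x)} < top"
proof -
  have "emeasure m {x\<in>space m. (cmod (f x))\<^sup>2 \<ge> c\<^sup>2} \<le> ennreal ((1/c\<^sup>2) * (\<integral>x. (cmod (f x))\<^sup>2 \<partial>m))"
    using assms(2) by (intro integral_Markov_inequality L2_integrable[OF assms(1)]) auto
  also have "\<dots> < top" by simp
  also have "{x\<in>space m. (cmod (f x))\<^sup>2 \<ge> c\<^sup>2} = {x. c \<le> cmod (f x)}"
    using assms(2) by (auto intro: power_mono dest: power2_le_imp_le)
  finally show ?thesis .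
qed

lemma translation_continuous_simple:
  assumes "simple_function m s" "s \<in> L2 m" shows "translation_continuous s"
proof -
  have meas: "s -` {v} \<in> sets m" for v
    using simple_functionD(2)[OF assms(1), of "{v}"] by simp
  have "translation_continuous (\<lambda>x. v * indicator (s -` {v}) x)" for v
  proof (cases "v = 0")
    case True
    then show ?thesis by (simp add: translation_continuous_def left_regular_def)
  next
    case False
    have [measurable]: "s \<in> borel_measurable m" by (rule L2_measurable[OF assms(2)])
    have "{x\<in>space m. cmod v \<le> cmod (s x)} \<in> sets m" by measurable
    then have "emeasure m (s -` {v}) \<le> emeasure m {x. cmod v \<le> cmod (s x)}"
      by (intro emeasure_mono) auto
    also have "\<dots> < top" using L2_emeasure_superlevel[OF assms(2)] False by simp
    finally show ?thesis
      by (intro translation_continuous_cmult translation_continuous_indicator meas)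
  qed
  then have "translation_continuous (\<lambda>x. \<Sum>v\<in>range s. v * indicator (s -` {v}) x)"
    using simple_functionD(1)[OF assms(1)] by (intro translation_continuous_sum) simp_all
  also have "(\<lambda>x. \<Sum>v\<in>range s. v * indicator (s -` {v}) x) = s"
  proof
    fix x
    have "(\<Sum>v\<in>range s. v * indicator (s -` {v}) x) = (\<Sum>v\<in>range s. if v = s x then s x else 0)"
      by (intro sum.cong) (auto split: split_indicator)
    also have "\<dots> = s x" using simple_functionD(1)[OF assms(1)] by simp
    finally show "(\<Sum>v\<in>range s. v * indicator (s -` {v}) x) = s x" .
  qed
  finally show ?thesis .
qed

lemma translation_continuous_L2:
  assumes f: "f \<in> L2 m" shows "translation_continuous f"
proof (rule translation_continuous_limit[OF f])
  fix e :: real assume "0 < e"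
  have [measurable]: "f \<in> borel_measurable m" by (rule L2_measurable[OF f])
  obtain F where F: "\<And>i. simple_function m (F i)" "\<And>x. (\<lambda>i. F i x) \<longlonglongrightarrow> f x"
    "\<And>i x. dist (F i x) 0 \<le> 2 * dist (f x) 0"
    using borel_measurable_implies_sequence_metric[of f m 0] by auto
  have [measurable]: "F i \<in> borel_measurable m" for i by (rule borel_measurable_simple_function[OF F(1)])
  have FL2: "F i \<in> L2 m" for i
  proof (rule L2_dominated)
    show "integrable m (\<lambda>x. 4 * (cmod (f x))\<^sup>2)" using L2_integrable[OF f] by simp
    show "(cmod (F i x))\<^sup>2 \<le> 4 * (cmod (f x))\<^sup>2" for x
      using power_mono[OF F(3)[of i x], of 2] by (simp add: power_mult_distrib)
  qed simp
  have "(\<lambda>i. \<integral>x. (cmod (f x - F i x))\<^sup>2 \<partial>m) \<longlonglongrightarrow> (\<integral>x. 0 \<partial>m)"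
  \<comment> \<open>The factor 9 is the square of 1 + 2, since |F i| is at most 2 |f|.\<close>
  proof (rule integral_dominated_convergence[where w = "\<lambda>x. 9 * (cmod (f x))\<^sup>2"])
    show "integrable m (\<lambda>x. 9 * (cmod (f x))\<^sup>2)" using L2_integrable[OF f] by simp
    have "(\<lambda>i. (cmod (f x - F i x))\<^sup>2) \<longlonglongrightarrow> (cmod (f x - f x))\<^sup>2" for x
      by (intro tendsto_intros F)
    then show "AE x in m. (\<lambda>i. (cmod (f x - F i x))\<^sup>2) \<longlonglongrightarrow> 0" by simp
    fix i
    have "(cmod (f x - F i x))\<^sup>2 \<le> (3 * cmod (f x))\<^sup>2" for x
      using F(3)[of i x] norm_triangle_ineq4[of "f x" "F i x"] by (intro power_mono) auto
    then show "AE x in m. norm ((cmod (f x - F i x))\<^sup>2) \<le> 9 * (cmod (f x))\<^sup>2"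
      by (simp add: power_mult_distrib)
  qed measurable
  then have "(\<lambda>i. L2_nrm m (\<lambda>x. f x - F i x)) \<longlonglongrightarrow> sqrt 0"
    unfolding L2_nrm_def by (intro tendsto_real_sqrt) simp
  then have "\<forall>\<^sub>F i in sequentially. L2_nrm m (\<lambda>x. f x - F i x) < e"
    using order_tendstoD(2)[of _ 0 sequentially e] \<open>0 < e\<close> by simp
  then obtain i where "L2_nrm m (\<lambda>x. f x - F i x) < e"
    by (meson eventually_happens sequentially_bot)
  then show "\<exists>g. translation_continuous g \<and> L2_nrm m (\<lambda>x. f x - g x) < e"
    using translation_continuous_simple[OF F(1) FL2] by blast
qed

lemma translation_tendsto:
  assumes f: "f \<in> L2 m"
  shows "((\<lambda>t. embed m 0 (left_regular t f)) \<longlongrightarrow> embed m 0 f) (nhds 0)"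
  using translation_continuous_L2[OF f] by (simp add: translation_continuous_def)

lemma continuous_on_translation:
  assumes f: "f \<in> L2 m"
  shows "continuous_on UNIV (\<lambda>t. embed m 0 (left_regular t f))"
  unfolding continuous_on_def
proof
  fix t :: 'a
  have "((\<lambda>s. - t + s) \<longlongrightarrow> - t + t) (nhds t)"
    by (intro tendsto_add tendsto_const) (rule filterlim_ident)
  then have "filterlim (\<lambda>s. - t + s) (nhds 0) (nhds t)" by simp
  from filterlim_compose[OF translation_tendsto[OF f] this]
  have lim: "((\<lambda>s. embed m 0 (left_regular (- t + s) f)) \<longlongrightarrow> embed m 0 f) (nhds t)" .
  have eq: "dist (embed m 0 (left_regular s f)) (embed m 0 (left_regular t f))
      = dist (embed m 0 (left_regular (- t + s) f)) (embed m 0 f)" for s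
  proof -
    have "embed m 0 (left_regular (- t + s) f) - embed m 0 f
        = embed m 0 (left_regular (- t) (\<lambda>y. left_regular s f y - left_regular t f y))"
      by (simp add: left_regular_diff left_regular_left_regular embed_diff f)
    then have "norm (embed m 0 (left_regular (- t + s) f) - embed m 0 f)
        = norm (embed m 0 (left_regular s f) - embed m 0 (left_regular t f))"
      by (simp add: norm_embed_left_regular L2_diff f embed_diff)
    then show ?thesis by (simp add: dist_norm)
  qed
  have "((\<lambda>s. embed m 0 (left_regular s f)) \<longlongrightarrow> embed m 0 (left_regular t f)) (nhds t)"
    using lim unfolding tendsto_iff eq .
  then show "((\<lambda>s. embed m 0 (left_regular s f)) \<longlongrightarrow> embed m 0 (left_regular t f)) (at t within UNIV)"
    using tendsto_mono[of "at t within UNIV" "nhds t"] by (simp add: at_within_le_nhds)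
qed

text \<open>The group need not be sigma-compact, but each superlevel set of |f| has finite measure,
  hence lies in an open set of finite measure, and such a set is exhausted by countably many compact
  sets up to a null set.\<close>

lemma L2_sigma_compact_support:
  assumes f: "f \<in> L2 m"
  obtains K :: "nat \<Rightarrow> 'a set" where "\<And>j. compact (K j)" "AE x in m. f x \<noteq> 0 \<longrightarrow> x \<in> (\<Union>j. K j)"
proof -
  have [measurable]: "f \<in> borel_measurable m" by (rule L2_measurable[OF f])
  define A where "A k = {x. 1 / Suc k \<le> cmod (f x)}" for k :: nat
  have "{x\<in>space m. 1 / Suc k \<le> cmod (f x)} \<in> sets m" for k by measurable
  then have Am: "A k \<in> sets borel" for k by (simp add: A_def)
  have Afin: "emeasure m (A k) < top" for k
    unfolding A_def by (rule L2_emeasure_superlevel[OF f]) simp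
  have "\<exists>U. open U \<and> A k \<subseteq> U \<and> emeasure m U < top" for k
    using open_superset[OF Am Afin, of 1] zero_less_one by metis
  then obtain U where U: "\<And>k. open (U k)" "\<And>k. A k \<subseteq> U k" "\<And>k. emeasure m (U k) < top" by metis
  have "\<exists>K. compact K \<and> K \<subseteq> U k \<and> measure m (U k - K) < 1 / Suc n" for k n :: nat
    using compact_subset_open[OF U(1,3), of "1 / Suc n" k] by (metis of_nat_0_less_iff zero_less_Suc zero_less_divide_1_iff)
  then obtain C where C: "\<And>k n. compact (C k n)" "\<And>k n. C k n \<subseteq> U k" "\<And>k n. measure m (U k - C k n) < 1 / Suc n"
    by metis
  have null: "(U k - (\<Union>n. C k n)) \<in> null_sets m" for k
  proof -
    let ?N = "U k - (\<Union>n. C k n)"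
    have s: "?N \<in> sets m" using U(1) C(1) unfolding sets_m
      by (intro sets.Diff sets.countable_UN) (auto intro: borel_open compact_sets)
    have fin: "emeasure m (U k - C k n) < top" for n
      using U by (intro le_less_trans[OF emeasure_mono U(3)[of k]]) auto
    have "measure m ?N \<le> 1 / Suc n" for n
    proof -
      have "measure m ?N \<le> measure m (U k - C k n)"
        using fin[of n] s U(1) C(1)
        by (intro measure_mono_fmeasurable) (auto simp: fmeasurable_def borel_open compact_sets)
      then show ?thesis using C(3)[of k n] by simp
    qed
    then have "measure m ?N \<le> 0"
      by (intro LIMSEQ_le_const[OF LIMSEQ_Suc[OF lim_1_over_n]]) auto
    moreover have "emeasure m ?N < top"
      using U s by (intro le_less_trans[OF emeasure_mono U(3)[of k]]) auto
    ultimately have "emeasure m ?N = 0"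
      using emeasure_eq_ennreal_measure[of m ?N] measure_nonneg[of m ?N]
      by (simp add: less_top[symmetric] order_antisym)
    then show ?thesis using s by (simp add: null_sets_def)
  qed
  show thesis
  proof (rule that[of "\<lambda>j. case prod_decode j of (k, n) \<Rightarrow> C k n"])
    show "compact (case prod_decode j of (k, n) \<Rightarrow> C k n)" for j
      using C(1) by (simp split: prod.split)
    have "AE x in m. \<forall>k. x \<notin> U k - (\<Union>n. C k n)"
      unfolding AE_all_countable using AE_not_in[OF null] by blast
    then show "AE x in m. f x \<noteq> 0 \<longrightarrow> x \<in> (\<Union>j. case prod_decode j of (k, n) \<Rightarrow> C k n)"
    proof eventually_elim
      case (elim x)
      show ?case
      proof
        assume "f x \<noteq> 0"
        then obtain k where "1 / Suc k < cmod (f x)" by (meson nat_approx_posE zero_less_norm_iff)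
        then have "x \<in> U k" using U(2) by (force simp: A_def)
        then obtain n where "x \<in> C k n" using elim by blast
        then show "x \<in> (\<Union>j. case prod_decode j of (k, n) \<Rightarrow> C k n)"
          by (intro UN_I[of "prod_encode (k, n)"]) auto
      qed
    qed
  qed
qed

text \<open>All points have the same mass. A compact neighbourhood of the identity has finite mass
  and is infinite, since otherwise {0} would be open; so points are null, and outer regularity at
  {0} gives \<open>U\<close>.\<close>

lemma small_nhds_of_nondiscrete:
  assumes lc: "locally_compact_space (euclidean :: 'a topology)" and nd: "\<not> open {0 :: 'a}" and "0 < e"
  obtains U where "open U" "0 \<in> U" "emeasure m U < top" "measure m U < e"
proof -
  obtain U0 K where U0: "open U0" "(0::'a) \<in> U0" "U0 \<subseteq> K" "compact K"
  proof -
    have "\<exists>U K. open U \<and> compact K \<and> (0::'a) \<in> U \<and> U \<subseteq> K"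
      using lc by (simp add: locally_compact_space_def)
    then show thesis using that by blast
  qed
  have "infinite U0"
  proof
    assume "finite U0"
    then have "open (U0 - (U0 - {0}))" using U0(1) by (intro open_Diff finite_imp_closed) auto
    moreover have "U0 - (U0 - {0}) = {0}" using U0(2) by auto
    ultimately show False using nd by simp
  qed
  have z: "emeasure m {0} < top"
    using emeasure_compact[of "{0}"] by simp
  have "measure m {0} = 0"
  proof (rule ccontr)
    assume "measure m {0} \<noteq> 0"
    then have pos: "0 < measure m {0}" by (simp add: zero_less_measure_iff)
    obtain n :: nat where n: "measure m K < n * measure m {0}"
      using ex_less_of_nat_mult[OF pos] by blast
    obtain F where F: "F \<subseteq> U0" "finite F" "card F = n"
      using infinite_arbitrarily_large[OF \<open>infinite U0\<close>] by blast
    have pt: "emeasure m {x} = emeasure m {0}" for x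
      using emeasure_left_translate[of "{0}" x] by simp
    have "measure m F = (\<Sum>x\<in>F. measure m {x})"
    proof (rule measure_eq_sum_singleton[OF F(2)])
      show "emeasure m {x} \<noteq> \<infinity>" for x using z by (subst pt) simp
    qed simp
    also have "\<dots> = (\<Sum>x\<in>F. measure m {0})"
      by (rule sum.cong[OF refl]) (rule arg_cong[where f = enn2real, OF pt, folded measure_def])
    also have "\<dots> = n * measure m {0}" using F(3) by simp
    finally have "measure m F = n * measure m {0}" .
    moreover have "measure m F \<le> measure m K"
    proof (rule measure_mono_fmeasurable)
      show "F \<subseteq> K" using F U0 by blast
      show "F \<in> sets m" using F(2) by (simp add: borel_closed finite_imp_closed)
      show "K \<in> fmeasurable m"
        using compact_sets[OF U0(4)] emeasure_compact[OF U0(4)] by (simp add: fmeasurable_def)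
    qed
    ultimately show False using n by simp
  qed
  have "{0} \<in> sets (borel :: 'a measure)" by simp
  then obtain U where U: "open U" "{0} \<subseteq> U" "emeasure m U < top" "measure m (U - {0}) < e"
    using z assms(3) by (rule open_superset)
  have "measure m U \<le> measure m (U - {0}) + measure m {0}"
  proof -
    have "measure m ((U - {0}) \<union> {0}) \<le> measure m (U - {0}) + measure m {0}"
      using U(1) by (intro measure_Un_le) (simp_all add: borel_open)
    moreover have "(U - {0}) \<union> {0} = U" using U(2) by auto
    ultimately show ?thesis by simp
  qed
  then show thesis using that[of U] U \<open>measure m {0} = 0\<close> by auto
qed

end

lemma L2_inner_cauchy_schwarz:
  assumes "f \<in> L2 M" "g \<in> L2 M" shows "cmod (L2_inner M f g) \<le> L2_nrm M f * L2_nrm M g"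
proof (cases "L2_inner M f g = 0")
  case False
  \<comment> \<open>Rotating by this phase makes the complex inner product real and non-negative, so
    that the real Cauchy-Schwarz inequality applies.\<close>
  define c where "c = cnj (sgn (L2_inner M f g))"
  have c1: "cmod c = 1" using False by (simp add: c_def norm_sgn)
  have "c * L2_inner M f g = of_real (cmod (L2_inner M f g))"
    using False by (simp add: c_def sgn_eq complex_norm_square[symmetric] power2_eq_square mult.commute field_simps)
  then have "cmod (L2_inner M f g) = Re (L2_inner M (\<lambda>x. c * f x) g)"
    by (simp add: L2_inner_cmult_left)
  also have "\<dots> = inner (embed M 0 (\<lambda>x. c * f x)) (embed M 0 g)"
    using assms by (simp add: inner_embed_embed L2_cmult)
  also have "\<dots> \<le> norm (embed M 0 (\<lambda>x. c * f x)) * norm (embed M 0 g)" by (rule norm_cauchy_schwarz)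
  also have "\<dots> = L2_nrm M f * L2_nrm M g" using assms by (simp add: norm_embed L2_cmult L2_nrm_cmult c1)
  finally show ?thesis .
qed simp

lemma summable_orthogonal:
  fixes x :: "nat \<Rightarrow> 'a::{real_inner,banach}"
  assumes orth: "\<And>i j. i \<noteq> j \<Longrightarrow> inner (x i) (x j) = 0" and s: "summable (\<lambda>i. (norm (x i))\<^sup>2)"
  shows "summable x"
  unfolding summable_Cauchy
proof (intro allI impI)
  fix e :: real assume "0 < e"
  then obtain N where N: "\<And>m n. N \<le> m \<Longrightarrow> norm (\<Sum>i=m..<n. (norm (x i))\<^sup>2) < e\<^sup>2"
    using s unfolding summable_Cauchy by (metis zero_less_power)
  have "norm (sum x {m..<n}) < e" if "N \<le> m" for m n
  proof -
    have "(norm (sum x {m..<n}))\<^sup>2 = (\<Sum>i=m..<n. (norm (x i))\<^sup>2)"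
      by (rule norm_sum_Pythagorean) (auto simp: pairwise_def orthogonal_def orth)
    also have "\<dots> < e\<^sup>2" using N[OF that, of n] by simp
    finally show ?thesis using \<open>0 < e\<close> by (simp add: power2_less_imp_less)
  qed
  then show "\<exists>N. \<forall>m\<ge>N. \<forall>n. norm (sum x {m..<n}) < e" by blast
qed

section \<open>Amplification\<close>

definition square_summable :: "'a measure \<Rightarrow> (nat \<Rightarrow> 'a \<Rightarrow> complex) \<Rightarrow> bool" where
  "square_summable M f \<longleftrightarrow> (\<forall>i. f i \<in> L2 M) \<and> summable (\<lambda>i. (L2_nrm M (f i))\<^sup>2)"

text \<open>A square-summable sequence as a single vector of the countable amplification, where the
  sum of the <T f_i, g_i> becomes a single inner product.\<close>

definition amplify :: "'a measure \<Rightarrow> (nat \<Rightarrow> 'a \<Rightarrow> complex) \<Rightarrow> 'a hsum" where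
  "amplify M f = (\<Sum>i. embed M i (f i))"

lemma square_summableD: "square_summable M f \<Longrightarrow> f i \<in> L2 M"
  by (simp add: square_summable_def)

lemma sums_amplify:
  assumes "square_summable M f" shows "(\<lambda>i. embed M i (f i)) sums amplify M f"
  unfolding amplify_def
proof (rule summable_sums, rule summable_orthogonal)
  show "inner (embed M i (f i)) (embed M j (f j)) = 0" if "i \<noteq> j" for i j
    by (intro inner_embed_other square_summableD[OF assms] that)
  show "summable (\<lambda>i. (norm (embed M i (f i)))\<^sup>2)"
    using assms unfolding norm_embed[OF square_summableD[OF assms]] by (simp add: square_summable_def)
qed

lemma inner_embed_amplify:
  assumes "f \<in> L2 M" "square_summable M g"
  shows "inner (embed M i f) (amplify M g) = Re (L2_inner M f (g i))"
proof -
  have "(\<lambda>j. inner (embed M i f) (embed M j (g j))) sums inner (embed M i f) (amplify M g)"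
    by (intro bounded_linear.sums[OF bounded_linear_inner_right] sums_amplify assms)
  moreover have "(\<lambda>j. inner (embed M i f) (embed M j (g j))) sums (\<Sum>j\<in>{i}. inner (embed M i f) (embed M j (g j)))"
  proof (rule sums_finite)
    show "inner (embed M i f) (embed M j (g j)) = 0" if "j \<notin> {i}" for j
      by (rule inner_embed_other) (use that assms in \<open>auto simp: square_summableD\<close>)
  qed simp
  ultimately have "inner (embed M i f) (amplify M g) = (\<Sum>j\<in>{i}. inner (embed M i f) (embed M j (g j)))"
    by (rule sums_unique2)
  then show ?thesis by (simp add: inner_embed_embed square_summableD[OF assms(2)] assms(1))
qed

lemma summable_L2_inner:
  assumes "square_summable M f" "square_summable M g"
  shows "summable (\<lambda>i. L2_inner M (f i) (g i))"
proof (rule summable_comparison_test')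
  show "summable (\<lambda>i. (L2_nrm M (f i))\<^sup>2 + (L2_nrm M (g i))\<^sup>2)"
    using assms by (intro summable_add) (auto simp: square_summable_def)
  fix i
  have "norm (L2_inner M (f i) (g i)) \<le> L2_nrm M (f i) * L2_nrm M (g i)"
    using assms by (intro L2_inner_cauchy_schwarz) (auto simp: square_summableD)
  also have "\<dots> \<le> (L2_nrm M (f i))\<^sup>2 + (L2_nrm M (g i))\<^sup>2"
    using sum_squares_bound[of "L2_nrm M (f i)" "L2_nrm M (g i)"]
      mult_nonneg_nonneg[OF L2_nrm_nonneg[of M "f i"] L2_nrm_nonneg[of M "g i"]] by linarith
  finally show "norm (L2_inner M (f i) (g i)) \<le> (L2_nrm M (f i))\<^sup>2 + (L2_nrm M (g i))\<^sup>2" .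
qed

lemma inner_amplify:
  assumes "square_summable M f" "square_summable M g"
  shows "inner (amplify M f) (amplify M g) = Re (\<Sum>i. L2_inner M (f i) (g i))"
proof -
  have "(\<lambda>i. inner (embed M i (f i)) (amplify M g)) sums inner (amplify M f) (amplify M g)"
    by (intro bounded_linear.sums[OF bounded_linear_inner_left] sums_amplify assms)
  then have "(\<lambda>i. Re (L2_inner M (f i) (g i))) sums inner (amplify M f) (amplify M g)"
    using assms by (simp add: inner_embed_amplify square_summableD)
  moreover have "(\<lambda>i. Re (L2_inner M (f i) (g i))) sums Re (\<Sum>i. L2_inner M (f i) (g i))"
    by (intro sums_Re summable_sums summable_L2_inner assms)
  ultimately show ?thesis by (rule sums_unique2)
qed

lemma square_summable_cmult: "square_summable M f \<Longrightarrow> square_summable M (\<lambda>i x. c * f i x)"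
  by (simp add: square_summable_def L2_cmult L2_nrm_cmult power_mult_distrib summable_mult)

lemma cmul_amplify:
  assumes "square_summable M f" shows "cmul c (amplify M f) = amplify M (\<lambda>i x. c * f i x)"
proof -
  have "(\<lambda>i. cmul c (embed M i (f i))) sums cmul c (amplify M f)"
    by (intro bounded_linear.sums[OF bounded_linear_cmul] sums_amplify assms)
  then have "(\<lambda>i. embed M i (\<lambda>x. c * f i x)) sums cmul c (amplify M f)"
    using assms by (simp add: embed_cmult square_summableD)
  then show ?thesis
    using sums_amplify[OF square_summable_cmult[OF assms]] sums_unique2 by blast
qed

lemma square_summable_op:
  assumes "bounded_op M T" "square_summable M f" shows "square_summable M (\<lambda>i. T (f i))"
proof -
  obtain C where C: "0 \<le> C" "\<And>f. f \<in> L2 M \<Longrightarrow> L2_nrm M (T f) \<le> C * L2_nrm M f"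
    using bounded_op_bound[OF assms(1)] by blast
  have "summable (\<lambda>i. C\<^sup>2 * (L2_nrm M (f i))\<^sup>2)"
    using assms(2) by (intro summable_mult) (simp add: square_summable_def)
  then have "summable (\<lambda>i. (L2_nrm M (T (f i)))\<^sup>2)"
    by (rule summable_comparison_test')
      (use C(2)[OF square_summableD[OF assms(2)]] in \<open>auto simp flip: power_mult_distrib intro!: power_mono\<close>)
  then show ?thesis
    using assms bounded_op_L2[OF assms(1)] by (simp add: square_summable_def)
qed

lemma lift_op_amplify:
  assumes T: "bounded_op M T" and f: "square_summable M f"
  shows "lift_op M i T (amplify M f) = embed M i (T (f i))"
proof -
  have z: "lift_op M i T (embed M j (f j)) = 0" if "j \<noteq> i" for j
  proof -
    have "lift_op M i T (embed M j (f j)) = lift_op M i T (embed M i (\<lambda>_. 0))"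
      using restr_embed_other[OF square_summableD[OF f] that] restr_embed[of "\<lambda>_. 0" M i]
      unfolding lift_op_def
      by (intro embed_cong bounded_op_cong[OF T] bounded_op_L2[OF T] restr_L2)
        (auto intro: L2_eq_trans L2_eq_sym)
    also have "\<dots> = 0"
      by (simp add: embed_zero linear_simps(3)[OF bounded_linear_lift_op[OF T]])
    finally show ?thesis .
  qed
  have "(\<lambda>j. lift_op M i T (embed M j (f j))) sums lift_op M i T (amplify M f)"
    by (intro bounded_linear.sums[OF bounded_linear_lift_op[OF T]] sums_amplify f)
  moreover have "(\<lambda>j. lift_op M i T (embed M j (f j))) sums (\<Sum>j\<in>{i}. lift_op M i T (embed M j (f j)))"
    by (intro sums_finite) (auto simp: z)
  ultimately have "lift_op M i T (amplify M f) = (\<Sum>j\<in>{i}. lift_op M i T (embed M j (f j)))"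
    by (rule sums_unique2)
  then show ?thesis by (simp add: lift_op_embed[OF T square_summableD[OF f]])
qed

section \<open>Translations on the amplification and uniqueness of normal functionals\<close>

context haar
begin

text \<open>Moves every copy of \<open>m\<close> at once and leaves the slices of all other measures
  alone, which makes it measure preserving on \<open>all_measures\<close>; translation thereby
  becomes an isometry of the whole type.\<close>

definition shift :: "'a \<Rightarrow> (nat \<times> 'a measure) \<times> 'a \<Rightarrow> (nat \<times> 'a measure) \<times> 'a" where
  "shift x w = (fst w, if snd (fst w) = m then x + snd w else snd w)"

lemma measurable_shift: "shift x \<in> all_measures \<rightarrow>\<^sub>M all_measures"
  unfolding measurable_direct_sum_iff
proof
  fix p :: "nat \<times> 'a measure"
  show "(\<lambda>y. shift x (p, y)) \<in> snd p \<rightarrow>\<^sub>M all_measures"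
  proof (cases "snd p = m")
    case True
    then show ?thesis
      using measurable_compose[OF measurable_left_translate measurable_Pair_direct_sum[of p snd, unfolded True], of x]
      by (simp add: shift_def)
  next
    case False
    then show ?thesis using measurable_Pair_direct_sum[of p snd] by (simp add: shift_def)
  qed
qed

lemma distr_shift: "distr all_measures all_measures (shift x) = all_measures"
proof (rule measure_eqI)
  fix A assume "A \<in> sets (distr all_measures all_measures (shift x))"
  then have A: "A \<in> sets all_measures" by simp
  have B: "shift x -` A \<inter> space all_measures \<in> sets all_measures"
    by (rule measurable_sets[OF measurable_shift A])
  have slice: "emeasure (snd p) (Pair p -` (shift x -` A \<inter> space all_measures)) = emeasure (snd p) (Pair p -` A)" for p
  proof (cases "snd p = m")
    case True
    have "Pair p -` (shift x -` A \<inter> space all_measures) = (+) x -` (Pair p -` A)"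
      using True by (auto simp: shift_def space_direct_sum)
    moreover have "Pair p -` A \<in> sets (snd p)" using A unfolding sets_direct_sum by blast
    ultimately show ?thesis
      using True emeasure_left_translate by (simp add: vimage_left_translate)
  next
    case False
    have "Pair p -` (shift x -` A \<inter> space all_measures) = Pair p -` A"
      using False A by (auto simp: shift_def space_direct_sum sets_direct_sum)
    then show ?thesis by simp
  qed
  show "emeasure (distr all_measures all_measures (shift x)) A = emeasure all_measures A"
    by (simp only: emeasure_distr[OF measurable_shift A] emeasure_direct_sum[OF A] emeasure_direct_sum[OF B] slice)
qed simp

definition translate :: "'a \<Rightarrow> 'a hsum \<Rightarrow> 'a hsum" where
  "translate x F = abs_hsum (\<lambda>w. rep_hsum F (shift (- x) w))"

lemma shift_L2:
  assumes F: "F \<in> L2 all_measures" shows "(\<lambda>w. F (shift x w)) \<in> L2 all_measures"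
proof -
  have [measurable]: "F \<in> borel_measurable all_measures" by (rule L2_measurable[OF F])
  have "integrable (distr all_measures all_measures (shift x)) (\<lambda>w. (cmod (F w))\<^sup>2)"
    unfolding distr_shift by (rule L2_integrable[OF F])
  then have "integrable all_measures (\<lambda>w. (cmod (F (shift x w)))\<^sup>2)"
    by (subst (asm) integrable_distr_eq[OF measurable_shift]) auto
  then show ?thesis
    using measurable_compose[OF measurable_shift L2_measurable[OF F]] by (simp add: L2_def)
qed

lemma shift_cong:
  assumes "L2_eq all_measures F G" shows "L2_eq all_measures (\<lambda>w. F (shift x w)) (\<lambda>w. G (shift x w))"
  unfolding L2_eq_def
  by (rule AE_distrD[OF measurable_shift[of x], where P = "\<lambda>w. F w = G w", unfolded distr_shift])
    (rule assms[unfolded L2_eq_def])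

lemma translate_abs:
  assumes "F \<in> L2 all_measures" shows "translate x (abs_hsum F) = abs_hsum (\<lambda>w. F (shift (- x) w))"
  unfolding translate_def
  by (intro abs_hsum_eqI shift_L2 shift_cong rep_abs_hsum assms rep_hsum_L2)

lemma translate_embed: "f \<in> L2 m \<Longrightarrow> translate x (embed m i f) = embed m i (left_regular x f)"
  by (auto simp: embed_def translate_abs slice_extend_def shift_def left_regular_def intro!: arg_cong[where f = abs_hsum])

lemma translate_translate: "translate x (translate y F) = translate (x + y) F"
  unfolding translate_def[of y] translate_def[of "x + y"]
  by (simp add: translate_abs shift_L2)
    (auto simp: shift_def fun_eq_iff minus_add add.assoc simp del: add_uminus_conv_diff intro!: arg_cong[where f = abs_hsum])

lemma translate_zero [simp]: "translate 0 F = F"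
proof -
  have "(\<lambda>w. rep_hsum F (shift (- 0) w)) = rep_hsum F"
    by (auto simp: shift_def fun_eq_iff)
  then show ?thesis by (simp add: translate_def)
qed

lemma translate_add: "translate x (F + G) = translate x F + translate x G"
proof -
  have "translate x (F + G) = translate x (abs_hsum (\<lambda>w. rep_hsum F w + rep_hsum G w))"
    by (simp flip: abs_hsum_add)
  then show ?thesis
    by (simp add: translate_abs L2_add) (simp add: translate_def abs_hsum_add shift_L2)
qed

lemma translate_cmul: "translate x (cmul c F) = cmul c (translate x F)"
proof -
  have "translate x (cmul c F) = translate x (abs_hsum (\<lambda>w. c * rep_hsum F w))"
    by (simp flip: abs_hsum_cmult)
  then show ?thesis
    by (simp add: translate_abs L2_cmult) (simp add: translate_def abs_hsum_cmult shift_L2)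
qed

lemma inner_translate: "inner (translate x F) (translate x G) = inner F G"
proof -
  have meas: "(\<lambda>w. rep_hsum F w * cnj (rep_hsum G w)) \<in> borel_measurable all_measures"
    by (rule borel_measurable_integrable[OF L2_inner_integrable]) simp_all
  have "L2_inner all_measures (\<lambda>w. rep_hsum F (shift (- x) w)) (\<lambda>w. rep_hsum G (shift (- x) w))
      = integral\<^sup>L (distr all_measures all_measures (shift (- x))) (\<lambda>w. rep_hsum F w * cnj (rep_hsum G w))"
    unfolding L2_inner_def by (rule integral_distr[OF measurable_shift meas, symmetric])
  also have "\<dots> = L2_inner all_measures (rep_hsum F) (rep_hsum G)"
    by (simp add: distr_shift L2_inner_def)
  finally show ?thesis
    unfolding translate_def by (subst inner_abs_hsum) (simp_all add: shift_L2 inner_rep_hsum)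
qed

lemma inner_translate_left: "inner (translate x F) G = inner F (translate (- x) G)"
  using inner_translate[of x F "translate (- x) G"] by (simp add: translate_translate)

lemma bounded_linear_translate: "bounded_linear (translate x)"
  by (rule bounded_linear_intro[where K = 1])
    (simp_all add: translate_add translate_cmul scaleR_eq_cmul inner_translate norm_eq_sqrt_inner)

lemma restr_translate: "L2_eq m (restr m i (translate x F)) (left_regular x (restr m i F))"
proof -
  have "L2_eq m (restr m i (translate x F)) (\<lambda>y. rep_hsum F (shift (- x) ((i, m), y)))"
    unfolding translate_def by (intro restr_cong_AE rep_abs_hsum shift_L2 rep_hsum_L2)
  also have "(\<lambda>y. rep_hsum F (shift (- x) ((i, m), y))) = left_regular x (restr m i F)"
    by (simp add: shift_def left_regular_def restr_def fun_eq_iff)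
  finally show ?thesis .
qed

lemma square_summable_left_regular:
  "square_summable m f \<Longrightarrow> square_summable m (\<lambda>i. left_regular x (f i))"
  by (rule square_summable_op[OF bounded_op_left_regular])

lemma translate_amplify:
  assumes "square_summable m f" shows "translate x (amplify m f) = amplify m (\<lambda>i. left_regular x (f i))"
proof -
  have "(\<lambda>i. translate x (embed m i (f i))) sums translate x (amplify m f)"
    by (intro bounded_linear.sums[OF bounded_linear_translate] sums_amplify assms)
  then have "(\<lambda>i. embed m i (left_regular x (f i))) sums translate x (amplify m f)"
    using assms by (simp add: translate_embed square_summableD)
  then show ?thesis
    using sums_amplify[OF square_summable_left_regular[OF assms]] sums_unique2 by blast
qed

abbreviation left_commutant :: "'a operator set" where
  "left_commutant \<equiv> commutant m (range left_regular)"

lemma left_commutantD: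
  assumes "T \<in> left_commutant"
  shows "bounded_op m T" "f \<in> L2 m \<Longrightarrow> L2_eq m (T (left_regular x f)) (left_regular x (T f))"
  using assms by (auto simp: commutant_def)

lemma VN_D:
  assumes "T \<in> VN m"
  shows "bounded_op m T" "A \<in> left_commutant \<Longrightarrow> f \<in> L2 m \<Longrightarrow> L2_eq m (T (A f)) (A (T f))"
  using assms by (auto simp: VN_def commutant_def[of m "left_commutant"])

lemma VN_I:
  assumes "bounded_op m T" "\<And>A f. A \<in> left_commutant \<Longrightarrow> f \<in> L2 m \<Longrightarrow> L2_eq m (T (A f)) (A (T f))"
  shows "T \<in> VN m"
  using assms by (auto simp: VN_def commutant_def[of m "left_commutant"])

lemma left_regular_VN: "left_regular x \<in> VN m"
  by (rule VN_I) (auto intro: bounded_op_left_regular L2_eq_sym left_commutantD)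

lemma id_VN: "(\<lambda>f. f) \<in> VN m"
  by (rule VN_I[OF bounded_op_id]) simp

text \<open>
  The argument of the bicommutant theorem: the projection \<open>P\<close> onto the closed subspace generated
  by the translates of \<open>(f\<^sub>i)\<close> in the amplification has its matrix entries in the commutant of the
  translations, so it commutes with the amplification of \<open>T\<close> and \<open>(T f\<^sub>i)\<close> stays in that
  subspace, which is orthogonal to \<open>(g\<^sub>i)\<close>.
\<close>

lemma normal_functional_zero:
  assumes f: "square_summable m f" and g: "square_summable m g" and T: "T \<in> VN m"
    and zero: "\<And>x. (\<Sum>i. L2_inner m (left_regular x (f i)) (g i)) = 0"
  shows "(\<Sum>i. L2_inner m (T (f i)) (g i)) = 0"
proof -
  have bT: "bounded_op m T" by (rule VN_D[OF T])
  have fi: "f i \<in> L2 m" for i by (rule square_summableD[OF f])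
  \<comment> \<open>Spans are real, so complex multiples are put among the generators to make
    \<open>K\<close> a complex subspace.\<close>
  define B where "B = {translate x (cmul c (amplify m f)) | x c. True}"
  define K where "K = closure (span B)"
  have K: "closed K" "subspace K"
    by (auto simp: K_def intro: subspace_closure)
  define P where "P = proj K"
  have BK: "B \<subseteq> K" unfolding K_def by (meson closure_subset order_trans span_superset)
  have blP: "bounded_linear P" unfolding P_def by (rule bounded_linear_proj[OF K])
  have K_translate: "translate y v \<in> K" if "v \<in> K" for y v
  proof -
    have "translate y ` B \<subseteq> B" unfolding B_def by (auto simp: translate_translate) blast
    then have "translate y ` closure (span B) \<subseteq> closure (span B)"
      using BK by (intro bounded_linear_closure_span_subset bounded_linear_translate) (auto simp: K_def)
    then show ?thesis using that by (auto simp: K_def)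
  qed
  have K_cmul: "cmul d v \<in> K" if "v \<in> K" for d v
  proof -
    have "cmul d ` B \<subseteq> B"
      unfolding B_def by (auto simp: translate_cmul[symmetric] cmul_cmul) blast
    then have "cmul d ` closure (span B) \<subseteq> closure (span B)"
      using BK by (intro bounded_linear_closure_span_subset bounded_linear_cmul) (auto simp: K_def)
    then show ?thesis using that by (auto simp: K_def)
  qed
  have P_translate: "P (translate y v) = translate y (P v)" for y v
    unfolding P_def
    by (rule proj_commute_adjoint[OF K bounded_linear_translate K_translate K_translate inner_translate_left])
  have P_cmul: "P (cmul d v) = cmul d (P v)" for d v
    unfolding P_def
    by (rule proj_commute_adjoint[OF K bounded_linear_cmul K_cmul K_cmul inner_cmul_commute])
  have f_in: "amplify m f \<in> K"
    by (rule subsetD[OF BK]) (auto simp: B_def intro!: exI[of _ 0] exI[of _ 1])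
  have g_orth: "inner v (amplify m g) = 0" if "v \<in> K" for v
  proof -
    have "inner b (amplify m g) = 0" if bB: "b \<in> B" for b
    proof -
      obtain x c where b: "b = translate x (cmul c (amplify m f))" using bB by (auto simp: B_def)
      have "inner b (amplify m g) = Re (\<Sum>i. L2_inner m (\<lambda>y. c * left_regular x (f i) y) (g i))"
        unfolding b translate_cmul translate_amplify[OF f] cmul_amplify[OF square_summable_left_regular[OF f]]
        by (rule inner_amplify[OF square_summable_cmult[OF square_summable_left_regular[OF f]] g])
      also have "\<dots> = Re (c * (\<Sum>i. L2_inner m (left_regular x (f i)) (g i)))"
        unfolding L2_inner_cmult_left
        by (subst suminf_mult[OF summable_L2_inner[OF square_summable_left_regular[OF f] g]]) simp
      finally show ?thesis by (simp add: zero)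
    qed
    then have "span B \<subseteq> {v. inner v (amplify m g) = 0}"
      by (intro span_minimal) (auto simp: subspace_def inner_add)
    moreover have "closed {v. inner v (amplify m g) = 0}" by (intro closed_Collect_eq continuous_intros)
    ultimately have "closure (span B) \<subseteq> {v. inner v (amplify m g) = 0}"
      by (rule closure_minimal)
    then show ?thesis using that by (auto simp: K_def)
  qed
  have entry: "restr_op m i j P \<in> left_commutant" for i j
  proof -
    have "bounded_op m (restr_op m i j P)"
      by (rule bounded_op_restr_op[OF blP]) (simp add: P_cmul)
    moreover have "L2_eq m (restr_op m i j P (left_regular x h)) (left_regular x (restr_op m i j P h))"
      if "h \<in> L2 m" for x h
      using restr_translate[of i x "P (embed m j h)"] that
      by (simp add: restr_op_def P_translate flip: translate_embed)
    ultimately show ?thesis by (auto simp: commutant_def)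
  qed
  let ?F1 = "amplify m (\<lambda>i. T (f i))"
  have Tf: "square_summable m (\<lambda>i. T (f i))" by (rule square_summable_op[OF bT f])
  \<comment> \<open>Each copy is treated separately: the entries of \<open>P\<close> commute with
    \<open>T\<close>, so the i-th component of \<open>P\<close> applied to (T f_j) is
    \<open>T\<close> applied to that of \<open>P\<close> applied to (f_j), and \<open>P\<close>
    fixes (f_j).\<close>
  have comp: "lift_op m i (\<lambda>h. h) (P ?F1) = lift_op m i (\<lambda>h. h) ?F1" for i
  proof -
    have "(\<lambda>j. lift_op m i (\<lambda>h. h) (P (embed m j (T (f j))))) sums lift_op m i (\<lambda>h. h) (P ?F1)"
      by (intro bounded_linear.sums[OF bounded_linear_lift_op[OF bounded_op_id]] bounded_linear.sums[OF blP] sums_amplify Tf)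
    moreover have "(\<lambda>j. lift_op m i T (P (embed m j (f j)))) sums lift_op m i T (P (amplify m f))"
      by (intro bounded_linear.sums[OF bounded_linear_lift_op[OF bT]] bounded_linear.sums[OF blP] sums_amplify f)
    moreover have "lift_op m i (\<lambda>h. h) (P (embed m j (T (f j)))) = lift_op m i T (P (embed m j (f j)))" for j
      using VN_D(2)[OF T entry fi, of i j j] L2_eq_sym bounded_op_L2[OF bT] restr_L2
      unfolding lift_op_def restr_op_def by (metis embed_cong)
    ultimately have "lift_op m i (\<lambda>h. h) (P ?F1) = lift_op m i T (P (amplify m f))"
      using sums_unique2 by simp
    also have "P (amplify m f) = amplify m f" unfolding P_def by (rule proj_of_mem[OF K f_in])
    finally show ?thesis using lift_op_amplify[OF bT f] lift_op_amplify[OF bounded_op_id Tf] by simp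
  qed
  have "?F1 \<in> K"
  proof -
    \<comment> \<open>Agreement on the copies of \<open>m\<close> does not by itself give P ?F1 =
      ?F1 in the larger type. But \<open>?d\<close> is orthogonal to \<open>?F1\<close>, whose terms
      lie in these copies, and to P ?F1, so it is zero.\<close>
    let ?d = "?F1 - P ?F1"
    have "inner ?d (embed m i (T (f i))) = 0" for i
    proof -
      interpret E: bounded_linear "lift_op m i (\<lambda>h. h)" by (rule bounded_linear_lift_op[OF bounded_op_id])
      have "lift_op m i (\<lambda>h. h) ?d = 0" by (simp add: E.diff comp)
      then have "embed m i (restr m i ?d) = 0" by (simp add: lift_op_def)
      moreover have "inner ?d (embed m i (T (f i))) = inner (embed m i (restr m i ?d)) (embed m i (T (f i)))"
        unfolding inner_embed[OF bounded_op_L2[OF bT fi]]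
        by (subst L2_inner_cong[OF restr_embed L2_eq_refl]) (simp_all add: bounded_op_L2[OF bT fi])
      ultimately show ?thesis by simp
    qed
    moreover have "(\<lambda>i. inner ?d (embed m i (T (f i)))) sums inner ?d ?F1"
      by (intro bounded_linear.sums[OF bounded_linear_inner_right] sums_amplify Tf)
    ultimately have "inner ?d ?F1 = 0" using sums_unique2[OF sums_zero] by simp
    moreover have "inner ?d (P ?F1) = 0" unfolding P_def by (rule proj_orthogonal[OF K proj_in[OF K]])
    ultimately have "inner ?d ?d = 0" by (simp add: inner_diff_right)
    then have "?F1 = P ?F1" by simp
    then show ?thesis unfolding P_def using proj_in[OF K] by metis
  qed
  then have "inner (cmul c ?F1) (amplify m g) = 0" for c by (intro g_orth K_cmul)
  moreover have "inner (cmul c ?F1) (amplify m g) = Re (c * (\<Sum>i. L2_inner m (T (f i)) (g i)))" for c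
    unfolding cmul_amplify[OF Tf] inner_amplify[OF square_summable_cmult[OF Tf] g] L2_inner_cmult_left
    by (subst suminf_mult[OF summable_L2_inner[OF Tf g]]) simp
  ultimately have "Re (c * (\<Sum>i. L2_inner m (T (f i)) (g i))) = 0" for c by simp
  from this[of 1] this[of \<i>] show ?thesis by (simp add: complex_eq_iff)
qed

section \<open>The vector space of normal functionals and the values of
  \<open>duality\<close>\<close>

lemma normal_functional_iff: "normal_functional m \<phi> \<longleftrightarrow>
    (\<exists>f g. square_summable m f \<and> square_summable m g \<and> (\<forall>T\<in>VN m. \<phi> T = (\<Sum>i. L2_inner m (T (f i)) (g i))))"
  unfolding normal_functional_def square_summable_def by blast

lemma normal_functional_cmult:
  assumes "normal_functional m \<phi>" shows "normal_functional m (\<lambda>T. c * \<phi> T)"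
proof -
  obtain f g where fg: "square_summable m f" "square_summable m g"
    "\<And>T. T \<in> VN m \<Longrightarrow> \<phi> T = (\<Sum>i. L2_inner m (T (f i)) (g i))"
    using assms by (auto simp: normal_functional_iff)
  have "c * \<phi> T = (\<Sum>i. L2_inner m (T (f i)) (\<lambda>x. cnj c * g i x))" if "T \<in> VN m" for T
    unfolding L2_inner_cmult_right fg(3)[OF that]
    by (subst suminf_mult[OF summable_L2_inner[OF square_summable_op[OF VN_D(1)[OF that] fg(1)] fg(2)]]) simp
  then show ?thesis
    unfolding normal_functional_iff
    by (intro exI[of _ f] exI[of _ "\<lambda>i x. cnj c * g i x"] conjI ballI square_summable_cmult fg)
qed

text \<open>Merges two series into one, because a normal functional has to be presented by a single
  pair of sequences.\<close>

definition interleave :: "(nat \<Rightarrow> 'b) \<Rightarrow> (nat \<Rightarrow> 'b) \<Rightarrow> nat \<Rightarrow> 'b" where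
  "interleave f g n = (if even n then f (n div 2) else g (n div 2))"

lemma sums_interleave:
  fixes f g :: "nat \<Rightarrow> 'b::real_normed_vector"
  assumes "f sums a" "g sums b" shows "interleave f g sums (a + b)"
proof -
  have "(\<lambda>n. if even n then f (n div 2) else 0) sums a"
    using assms(1) by (subst sums_mono_reindex[of "\<lambda>n. 2 * n", symmetric])
      (auto simp: strict_mono_def elim!: evenE)
  moreover have "(\<lambda>n. if even n then 0 else g (n div 2)) sums b"
    using assms(2) by (subst sums_mono_reindex[of "\<lambda>n. 2 * n + 1", symmetric])
      (auto simp: strict_mono_def elim!: oddE)
  ultimately have "(\<lambda>n. (if even n then f (n div 2) else 0) + (if even n then 0 else g (n div 2))) sums (a + b)"
    by (rule sums_add)
  also have "(\<lambda>n. (if even n then f (n div 2) else 0) + (if even n then 0 else g (n div 2))) = interleave f g"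
    by (auto simp: interleave_def)
  finally show ?thesis .
qed

lemma square_summable_interleave:
  assumes "square_summable M f" "square_summable M g" shows "square_summable M (interleave f g)"
proof -
  have "summable (interleave (\<lambda>i. (L2_nrm M (f i))\<^sup>2) (\<lambda>i. (L2_nrm M (g i))\<^sup>2))"
    using assms unfolding square_summable_def by (meson sums_interleave summable_def)
  also have "interleave (\<lambda>i. (L2_nrm M (f i))\<^sup>2) (\<lambda>i. (L2_nrm M (g i))\<^sup>2) = (\<lambda>i. (L2_nrm M (interleave f g i))\<^sup>2)"
    by (auto simp: interleave_def)
  finally show ?thesis using assms by (auto simp: square_summable_def interleave_def)
qed

lemma normal_functional_add:
  assumes "normal_functional m \<phi>" "normal_functional m \<psi>" shows "normal_functional m (\<lambda>T. \<phi> T + \<psi> T)"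
proof -
  obtain f g where fg: "square_summable m f" "square_summable m g"
    "\<And>T. T \<in> VN m \<Longrightarrow> \<phi> T = (\<Sum>i. L2_inner m (T (f i)) (g i))"
    using assms by (auto simp: normal_functional_iff)
  obtain f' g' where fg': "square_summable m f'" "square_summable m g'"
    "\<And>T. T \<in> VN m \<Longrightarrow> \<psi> T = (\<Sum>i. L2_inner m (T (f' i)) (g' i))"
    using assms by (auto simp: normal_functional_iff)
  have "\<phi> T + \<psi> T = (\<Sum>i. L2_inner m (T (interleave f f' i)) (interleave g g' i))" if T: "T \<in> VN m" for T
  proof -
    have "interleave (\<lambda>i. L2_inner m (T (f i)) (g i)) (\<lambda>i. L2_inner m (T (f' i)) (g' i)) sums (\<phi> T + \<psi> T)"
      unfolding fg(3)[OF T] fg'(3)[OF T]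
      by (intro sums_interleave summable_sums summable_L2_inner square_summable_op[OF VN_D(1)[OF T]] fg fg')
    also have "interleave (\<lambda>i. L2_inner m (T (f i)) (g i)) (\<lambda>i. L2_inner m (T (f' i)) (g' i))
        = (\<lambda>i. L2_inner m (T (interleave f f' i)) (interleave g g' i))"
      by (auto simp: interleave_def)
    finally show ?thesis by (rule sums_unique)
  qed
  then show ?thesis
    unfolding normal_functional_iff
    by (intro exI[of _ "interleave f f'"] exI[of _ "interleave g g'"] conjI ballI
        square_summable_interleave fg fg')
qed

lemma normal_functional_eqI:
  assumes "normal_functional m \<phi>" "normal_functional m \<psi>" "\<And>x. \<phi> (left_regular x) = \<psi> (left_regular x)" "T \<in> VN m"
  shows "\<phi> T = \<psi> T"
proof -
  have "normal_functional m (\<lambda>T. \<phi> T + (- 1) * \<psi> T)"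
    by (intro normal_functional_add normal_functional_cmult assms)
  then obtain f g where fg: "square_summable m f" "square_summable m g"
    "\<And>T. T \<in> VN m \<Longrightarrow> \<phi> T + (- 1) * \<psi> T = (\<Sum>i. L2_inner m (T (f i)) (g i))"
    unfolding normal_functional_iff by blast
  have "(\<Sum>i. L2_inner m (left_regular x (f i)) (g i)) = 0" for x
    using fg(3)[OF left_regular_VN[of x]] assms(3)[of x] by simp
  then have "(\<Sum>i. L2_inner m (T (f i)) (g i)) = 0"
    by (rule normal_functional_zero[OF fg(1,2) assms(4)])
  then show ?thesis using fg(3)[OF assms(4)] by simp
qed

text \<open>Normal functionals that agree on translations agree on \<open>VN m\<close>, so the
  definite description in \<open>duality\<close> has exactly one solution and any suitable
  functional computes it.\<close>

lemma duality_eq: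
  assumes "normal_functional m \<phi>" "\<And>x. \<phi> (left_regular x) = u x" "T \<in> VN m"
  shows "duality m T u = \<phi> T"
  unfolding duality_def
proof (rule the_equality)
  show "\<exists>\<psi>. normal_functional m \<psi> \<and> (\<forall>x. \<psi> (left_regular x) = u x) \<and> \<phi> T = \<psi> T"
    using assms by blast
  fix c assume "\<exists>\<psi>. normal_functional m \<psi> \<and> (\<forall>x. \<psi> (left_regular x) = u x) \<and> c = \<psi> T"
  then show "c = \<phi> T" using normal_functional_eqI[OF _ assms(1) _ assms(3)] assms(2) by metis
qed

lemma duality_coeff_fun:
  assumes "f \<in> L2 m" "g \<in> L2 m" "T \<in> VN m"
  shows "duality m T (coeff_fun m f g) = L2_inner m (T f) g"
  by (rule duality_eq[OF normal_functional_vector[OF assms(1,2)] _ assms(3)]) (simp add: coeff_fun_def)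

end

lemma op_nrm_bound:
  assumes T: "bounded_op M T" and f: "f \<in> L2 M" shows "L2_nrm M (T f) \<le> op_nrm M T * L2_nrm M f"
proof -
  obtain C where C: "0 \<le> C" "\<And>f. f \<in> L2 M \<Longrightarrow> L2_nrm M (T f) \<le> C * L2_nrm M f"
    using bounded_op_bound[OF T] by blast
  show ?thesis
  proof (cases "L2_nrm M f = 0")
    case True
    then show ?thesis using C(2)[OF f] by simp
  next
    case False
    then have pos: "0 < L2_nrm M f" using L2_nrm_nonneg[of M f] by linarith
    let ?c = "complex_of_real (1 / L2_nrm M f)"
    have cL2: "(\<lambda>x. ?c * f x) \<in> L2 M" by (rule L2_cmult[OF f])
    have nc: "L2_nrm M (\<lambda>x. ?c * f x) = 1" using pos unfolding L2_nrm_cmult by (simp add: norm_divide)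
    have bdd: "bdd_above ((\<lambda>f. L2_nrm M (T f)) ` {f \<in> L2 M. L2_nrm M f \<le> 1})"
    proof (rule bdd_aboveI2)
      fix f assume "f \<in> {f \<in> L2 M. L2_nrm M f \<le> 1}"
      then show "L2_nrm M (T f) \<le> C" using C(2)[of f] mult_left_le[OF _ C(1), of "L2_nrm M f"] by auto
    qed
    have "L2_nrm M (T (\<lambda>x. ?c * f x)) \<le> op_nrm M T"
      unfolding op_nrm_def by (rule cSUP_upper[OF _ bdd]) (use cL2 nc in simp)
    moreover have "L2_nrm M (T (\<lambda>x. ?c * f x)) = 1 / L2_nrm M f * L2_nrm M (T f)"
      using L2_nrm_cong[OF bounded_op_cmult[OF T f, of ?c] bounded_op_L2[OF T cL2] L2_cmult[OF bounded_op_L2[OF T f]]]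
        pos unfolding L2_nrm_cmult by (simp add: norm_divide)
    ultimately have "1 / L2_nrm M f * L2_nrm M (T f) \<le> op_nrm M T" by (simp only:)
    then show ?thesis using pos by (simp add: field_simps)
  qed
qed

context haar
begin

section \<open>Products of coefficient functions\<close>

lemma weighted_L2:
  assumes F: "continuous_on UNIV F" "\<And>t. norm (F t) \<le> C" and h: "h \<in> L2 m"
  shows "(\<lambda>t. complex_of_real (inner (F t) v) * h t) \<in> L2 m"
proof (rule L2_dominated)
  have [measurable]: "h \<in> borel_measurable m" by (rule L2_measurable[OF h])
  have "(\<lambda>t. complex_of_real (inner (F t) v)) \<in> borel_measurable borel"
    by (intro borel_measurable_continuous_onI continuous_intros F)
  then have [measurable]: "(\<lambda>t. complex_of_real (inner (F t) v)) \<in> borel_measurable m"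
    by (simp add: measurable_cong_sets[OF sets_m refl])
  show "(\<lambda>t. complex_of_real (inner (F t) v) * h t) \<in> borel_measurable m" by measurable
  show "integrable m (\<lambda>t. (C * norm v)\<^sup>2 * (cmod (h t))\<^sup>2)" using L2_integrable[OF h] by simp
  fix t
  have "\<bar>inner (F t) v\<bar> \<le> C * norm v"
    using Cauchy_Schwarz_ineq2[of "F t" v] mult_right_mono[OF F(2)[of t], of "norm v"] by simp
  then have "(inner (F t) v)\<^sup>2 \<le> (C * norm v)\<^sup>2" using abs_le_square_iff by fastforce
  then show "(cmod (complex_of_real (inner (F t) v) * h t))\<^sup>2 \<le> (C * norm v)\<^sup>2 * (cmod (h t))\<^sup>2"
    by (simp add: norm_mult power_mult_distrib mult_right_mono)
qed

text \<open>Bessel's inequality for \<open>F t\<close>, weighted by |h|^2 and integrated; it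
  controls all coordinate functions of h(t) F(t) at once.\<close>

lemma weighted_bessel:
  assumes F: "continuous_on UNIV F" "\<And>t. norm (F t) \<le> C" and h: "h \<in> L2 m" and e: "orthonormal_or_zero e"
  shows "(\<Sum>i<n. (L2_nrm m (\<lambda>t. complex_of_real (inner (F t) (e i)) * h t))\<^sup>2)
    \<le> (\<integral>t. (cmod (h t))\<^sup>2 * (norm (F t))\<^sup>2 \<partial>m)"
    and "integrable m (\<lambda>t. (cmod (h t))\<^sup>2 * (norm (F t))\<^sup>2)"
proof -
  note wL2 = weighted_L2[OF F h]
  have sq: "(cmod (complex_of_real r * z))\<^sup>2 = r\<^sup>2 * (cmod z)\<^sup>2" for r z
    by (simp add: norm_mult power_mult_distrib)
  have int: "integrable m (\<lambda>t. (inner (F t) (e i))\<^sup>2 * (cmod (h t))\<^sup>2)" for i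
    using L2_integrable[OF wL2[of "e i"]] by (simp only: sq)
  have "(\<lambda>t. (norm (F t))\<^sup>2) \<in> borel_measurable borel"
    by (intro borel_measurable_continuous_onI continuous_intros F)
  then have meas: "(\<lambda>t. (norm (F t))\<^sup>2) \<in> borel_measurable m"
    by (simp add: measurable_cong_sets[OF sets_m refl])
  show I: "integrable m (\<lambda>t. (cmod (h t))\<^sup>2 * (norm (F t))\<^sup>2)"
  proof (rule Bochner_Integration.integrable_bound)
    show "integrable m (\<lambda>t. C\<^sup>2 * (cmod (h t))\<^sup>2)" using L2_integrable[OF h] by simp
    show "(\<lambda>t. (cmod (h t))\<^sup>2 * (norm (F t))\<^sup>2) \<in> borel_measurable m"
      using meas L2_measurable[OF h] by measurable
    have "(norm (F t))\<^sup>2 \<le> C\<^sup>2" for t by (intro power_mono F) simp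
    then show "AE t in m. norm ((cmod (h t))\<^sup>2 * (norm (F t))\<^sup>2) \<le> norm (C\<^sup>2 * (cmod (h t))\<^sup>2)"
      by (intro AE_I2) (simp add: mult.commute mult_right_mono)
  qed
  have "(\<Sum>i<n. (L2_nrm m (\<lambda>t. complex_of_real (inner (F t) (e i)) * h t))\<^sup>2)
      = (\<integral>t. (\<Sum>i<n. (inner (F t) (e i))\<^sup>2 * (cmod (h t))\<^sup>2) \<partial>m)"
    unfolding L2_nrm_power2 sq using int by (subst Bochner_Integration.integral_sum) auto
  also have "\<dots> \<le> (\<integral>t. (cmod (h t))\<^sup>2 * (norm (F t))\<^sup>2 \<partial>m)"
  proof (rule integral_mono[OF Bochner_Integration.integrable_sum[OF int] I])
    fix t
    have "(\<Sum>i<n. (inner (F t) (e i))\<^sup>2 * (cmod (h t))\<^sup>2) = (\<Sum>i<n. (inner (F t) (e i))\<^sup>2) * (cmod (h t))\<^sup>2"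
      by (simp add: sum_distrib_right)
    also have "\<dots> \<le> (norm (F t))\<^sup>2 * (cmod (h t))\<^sup>2"
      by (intro mult_right_mono bessel_inequality[OF e]) simp
    finally show "(\<Sum>i<n. (inner (F t) (e i))\<^sup>2 * (cmod (h t))\<^sup>2) \<le> (cmod (h t))\<^sup>2 * (norm (F t))\<^sup>2"
      by (simp add: mult.commute)
  qed
  finally show "(\<Sum>i<n. (L2_nrm m (\<lambda>t. complex_of_real (inner (F t) (e i)) * h t))\<^sup>2)
    \<le> (\<integral>t. (cmod (h t))\<^sup>2 * (norm (F t))\<^sup>2 \<partial>m)" .
qed

definition backshift :: "('a \<Rightarrow> complex) \<Rightarrow> 'a \<Rightarrow> 'a hsum" where
  "backshift f t = embed m 0 (left_regular (- t) f)"

text \<open>The mean square deviation of \<open>f\<close> from invariance under translation by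
  \<open>- t\<close>, with \<open>t\<close> weighted by |h|^2. It is small when \<open>h\<close>
  lives near the identity.\<close>

definition spread :: "('a \<Rightarrow> complex) \<Rightarrow> ('a \<Rightarrow> complex) \<Rightarrow> real" where
  "spread f h = (\<integral>t. (cmod (h t))\<^sup>2 * (norm (backshift f t - backshift f 0))\<^sup>2 \<partial>m)"

lemma spread_nonneg [simp]: "0 \<le> spread f h"
  by (simp add: spread_def)

lemma continuous_backshift: "f \<in> L2 m \<Longrightarrow> continuous_on UNIV (backshift f)"
  unfolding backshift_def[abs_def]
  by (rule continuous_on_compose2[OF continuous_on_translation]) (auto intro: continuous_intros)

lemma norm_backshift: "f \<in> L2 m \<Longrightarrow> norm (backshift f t) = L2_nrm m f"
  by (simp add: backshift_def norm_embed L2_nrm_left_regular)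

text \<open>Unitarity cancels \<open>t\<close>. As the value does not depend on \<open>t\<close>, it
  can be taken out of the integral of \<open>left_regular x h\<close> against the conjugate of
  \<open>h\<close>.\<close>

lemma inner_backshift:
  assumes "f \<in> L2 m" "g \<in> L2 m"
  shows "inner (backshift f (- x + t)) (backshift g t) = Re (L2_inner m (left_regular x f) g)"
proof -
  have "left_regular (- (- x + t)) f = left_regular (- t) (left_regular x f)"
    by (simp add: left_regular_left_regular minus_add del: add_uminus_conv_diff)
  then show ?thesis
    using assms by (simp add: backshift_def inner_embed_embed L2_inner_left_regular)
qed

lemma square_summable_of_bounded:
  assumes "\<And>i. a i \<in> L2 m" "\<And>n. (\<Sum>i<n. (L2_nrm m (a i))\<^sup>2) \<le> B"
  shows "square_summable m a"
  unfolding square_summable_def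
  using assms by (auto intro!: summableI_nonneg_bounded)

text \<open>
  A discrete form of Fell's absorption principle: by Parseval's identity, the product of the
  real part of \<open>x \<mapsto> \<langle>\<lambda>(x) f, g\<rangle>\<close> with \<open>x \<mapsto> \<langle>\<lambda>(x) h, h\<rangle>\<close> is the sum of the coefficient
  functions of the pairs \<open>(a\<^sub>i, b\<^sub>i)\<close> with \<open>a\<^sub>i(t) = h(t) \<langle>\<lambda>(-t) f, e\<^sub>i\<rangle>\<close> and
  \<open>b\<^sub>i(t) = h(t) \<langle>\<lambda>(-t) g, e\<^sub>i\<rangle>\<close>.
\<close>

lemma real_part_product:
  assumes f: "f \<in> L2 m" and g: "g \<in> L2 m" and h: "h \<in> L2 m"
  obtains \<phi> where "normal_functional m \<phi>"
    "\<And>x. \<phi> (left_regular x) = of_real (Re (L2_inner m (left_regular x f) g)) * L2_inner m (left_regular x h) h"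
    "\<And>T. T \<in> VN m \<Longrightarrow> op_nrm m T \<le> 1 \<Longrightarrow>
      cmod (\<phi> T - of_real (Re (L2_inner m f g)) * L2_inner m (T h) h)
        \<le> L2_nrm m h * (sqrt (spread f h) * L2_nrm m g + L2_nrm m f * sqrt (spread g h))"
proof -
  obtain K :: "nat \<Rightarrow> 'a set" where K: "\<And>j. compact (K j)" "AE x in m. h x \<noteq> 0 \<longrightarrow> x \<in> (\<Union>j. K j)"
    using L2_sigma_compact_support[OF h] by blast
  \<comment> \<open>The point \<open>backshift g 0\<close> is added because Parseval is also needed
    at t = 0, for the sum of the products of \<alpha> and \<beta>, and 0 need not lie in any
    \<open>K j\<close>.\<close>
  have "compact (insert (backshift g 0) (backshift g ` K j))" for j
    by (intro compact_insert compact_continuous_image continuous_on_subset[OF continuous_backshift[OF g]] K) simp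
  from orthonormal_sequence_for_compacts[of "\<lambda>j. insert (backshift g 0) (backshift g ` K j)", OF this]
  obtain e :: "nat \<Rightarrow> 'a hsum" where e: "orthonormal_or_zero e" and
    pars: "\<And>x y. y \<in> (\<Union>j. insert (backshift g 0) (backshift g ` K j)) \<Longrightarrow>
      (\<lambda>i. inner x (e i) * inner y (e i)) sums inner x y"
    by blast
  define a where "a i t = complex_of_real (inner (backshift f t) (e i)) * h t" for i t
  define b where "b i t = complex_of_real (inner (backshift g t) (e i)) * h t" for i t
  \<comment> \<open>Coordinates at t = 0: if \<open>h\<close> lives near the identity,
    \<open>a i\<close> is nearly \<alpha> i times \<open>h\<close> and \<open>b i\<close> nearly
    \<beta> i times \<open>h\<close>.\<close>
  define \<alpha> where "\<alpha> i = inner (backshift f 0) (e i)" for i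
  define \<beta> where "\<beta> i = inner (backshift g 0) (e i)" for i
  have nrm: "norm (backshift f t) \<le> L2_nrm m f" "norm (backshift g t) \<le> L2_nrm m g" for t
    by (simp_all add: norm_backshift f g)
  note cont = continuous_backshift[OF f] continuous_backshift[OF g]
  have aL2: "a i \<in> L2 m" and bL2: "b i \<in> L2 m" for i
    unfolding a_def[abs_def] b_def[abs_def]
    by (rule weighted_L2[OF cont(1) nrm(1) h]) (rule weighted_L2[OF cont(2) nrm(2) h])
  have const: "(\<integral>t. (cmod (h t))\<^sup>2 * (norm (backshift k t))\<^sup>2 \<partial>m) = (L2_nrm m h * L2_nrm m k)\<^sup>2" if "k \<in> L2 m" for k
    using that by (simp add: norm_backshift L2_nrm_power2 power_mult_distrib)
  have suma: "(\<Sum>i<n. (L2_nrm m (a i))\<^sup>2) \<le> (L2_nrm m h * L2_nrm m f)\<^sup>2" for n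
    using weighted_bessel(1)[OF cont(1) nrm(1) h e, of n] by (simp add: const[OF f] a_def[abs_def])
  have sumb: "(\<Sum>i<n. (L2_nrm m (b i))\<^sup>2) \<le> (L2_nrm m h * L2_nrm m g)\<^sup>2" for n
    using weighted_bessel(1)[OF cont(2) nrm(2) h e, of n] by (simp add: const[OF g] b_def[abs_def])
  have diffb: "(\<Sum>i<n. (L2_nrm m (\<lambda>t. complex_of_real (inner (backshift k t - backshift k 0) (e i)) * h t))\<^sup>2) \<le> spread k h"
    if "k \<in> L2 m" for k n
    unfolding spread_def
  proof (rule weighted_bessel(1)[OF _ _ h e])
    show "continuous_on UNIV (\<lambda>t. backshift k t - backshift k 0)"
      by (intro continuous_intros continuous_backshift that)
    show "norm (backshift k t - backshift k 0) \<le> 2 * L2_nrm m k" for t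
      using norm_triangle_ineq4[of "backshift k t" "backshift k 0"] that by (simp add: norm_backshift)
  qed
  have sa: "square_summable m a" by (rule square_summable_of_bounded[OF aL2 suma])
  have sb: "square_summable m b" by (rule square_summable_of_bounded[OF bL2 sumb])
  define \<phi> where "\<phi> T = (\<Sum>i. L2_inner m (T (a i)) (b i))" for T
  show thesis
  proof (rule that[of \<phi>])
    show "normal_functional m \<phi>"
      unfolding normal_functional_iff using sa sb by (auto simp: \<phi>_def)
    fix x
    let ?c = "complex_of_real (Re (L2_inner m (left_regular x f) g))"
    let ?H = "\<lambda>t. left_regular x h t * cnj (h t)"
    let ?S = "\<lambda>n t. complex_of_real (\<Sum>i<n. inner (backshift f (- x + t)) (e i) * inner (backshift g t) (e i)) * ?H t"
    have Hint: "integrable m ?H" by (intro L2_inner_integrable left_regular_L2 h)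
    have int: "integrable m (\<lambda>t. left_regular x (a i) t * cnj (b i t))" for i
      by (intro L2_inner_integrable left_regular_L2 aL2 bL2)
    have S_eq: "?S n t = (\<Sum>i<n. left_regular x (a i) t * cnj (b i t))" for n t
      by (simp add: a_def b_def left_regular_def sum_distrib_right sum_distrib_left mult_ac)
    \<comment> \<open>Sum and integral are exchanged by dominated convergence, with Bessel's bound
      on the partial sums. Parseval applies wherever h(t) is non-zero, as such \<open>t\<close> lie
      in some \<open>K j\<close> up to a null set.\<close>
    have "(\<lambda>n. \<integral>t. ?S n t \<partial>m) \<longlonglongrightarrow> (\<integral>t. ?c * ?H t \<partial>m)"
    proof (rule integral_dominated_convergence[where w = "\<lambda>t. L2_nrm m f * L2_nrm m g * cmod (?H t)"])
      show "(\<lambda>t. ?c * ?H t) \<in> borel_measurable m" using Hint by (intro borel_measurable_integrable) simp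
      show "?S n \<in> borel_measurable m" for n
        unfolding S_eq by (intro borel_measurable_integrable Bochner_Integration.integrable_sum int)
      show "integrable m (\<lambda>t. L2_nrm m f * L2_nrm m g * cmod (?H t))"
        using Hint by (intro integrable_mult_right integrable_norm)
      from K(2) show "AE t in m. (\<lambda>n. ?S n t) \<longlonglongrightarrow> ?c * ?H t"
      proof eventually_elim
        case (elim t)
        show ?case
        proof (cases "h t = 0")
          case False
          then have "backshift g t \<in> (\<Union>j. insert (backshift g 0) (backshift g ` K j))" using elim by blast
          from pars[OF this, of "backshift f (- x + t)"]
          have "(\<lambda>n. \<Sum>i<n. inner (backshift f (- x + t)) (e i) * inner (backshift g t) (e i))
              \<longlonglongrightarrow> Re (L2_inner m (left_regular x f) g)"
            by (simp only: sums_def inner_backshift[OF f g])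
          then show ?thesis by (intro tendsto_intros)
        qed simp
      qed
      fix n
      show "AE t in m. norm (?S n t) \<le> L2_nrm m f * L2_nrm m g * cmod (?H t)"
      proof (rule AE_I2)
        fix t
        have "\<bar>\<Sum>i<n. inner (backshift f (- x + t)) (e i) * inner (backshift g t) (e i)\<bar> \<le> L2_nrm m f * L2_nrm m g"
          using bessel_inequality2[OF e, of "backshift f (- x + t)" "backshift g t" n]
          by (simp add: norm_backshift f g)
        then show "norm (?S n t) \<le> L2_nrm m f * L2_nrm m g * cmod (?H t)"
          unfolding norm_mult[of "complex_of_real _"] norm_of_real by (intro mult_right_mono) simp_all
      qed
    qed
    also have "(\<lambda>n. \<integral>t. ?S n t \<partial>m) = (\<lambda>n. \<Sum>i<n. L2_inner m (left_regular x (a i)) (b i))"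
      unfolding S_eq L2_inner_def using int by (intro ext Bochner_Integration.integral_sum) auto
    also have "(\<integral>t. ?c * ?H t \<partial>m) = ?c * L2_inner m (left_regular x h) h"
      by (simp add: L2_inner_def)
    finally show "\<phi> (left_regular x) = ?c * L2_inner m (left_regular x h) h"
      unfolding \<phi>_def by (intro sums_unique[symmetric]) (simp add: sums_def)
  next
    fix T assume T: "T \<in> VN m" and T1: "op_nrm m T \<le> 1"
    have bT: "bounded_op m T" by (rule VN_D[OF T])
    note TL2 = bounded_op_L2[OF bT]
    have con: "L2_nrm m (T k) \<le> L2_nrm m k" if "k \<in> L2 m" for k
      using op_nrm_bound[OF bT that] mult_right_mono[OF T1 L2_nrm_nonneg[of m k]] by simp
    define a' where "a' i t = a i t - \<alpha> i * h t" for i t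
    define b' where "b' i t = b i t - \<beta> i * h t" for i t
    have a'_eq: "a' i = (\<lambda>t. complex_of_real (inner (backshift f t - backshift f 0) (e i)) * h t)" for i
      by (rule ext) (simp add: a'_def a_def \<alpha>_def inner_diff left_diff_distrib)
    have b'_eq: "b' i = (\<lambda>t. complex_of_real (inner (backshift g t - backshift g 0) (e i)) * h t)" for i
      by (rule ext) (simp add: b'_def b_def \<beta>_def inner_diff left_diff_distrib)
    have a'L2: "a' i \<in> L2 m" and b'L2: "b' i \<in> L2 m" for i
      unfolding a'_def[abs_def] b'_def[abs_def] by (intro L2_diff L2_cmult aL2 bL2 h)+
    let ?B = "L2_nrm m h * (sqrt (spread f h) * L2_nrm m g + L2_nrm m f * sqrt (spread g h))"
    \<comment> \<open>One factor is replaced at a time: first \<open>a i\<close> by \<alpha> i times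
      \<open>h\<close>, then \<open>b i\<close> by \<beta> i times \<open>h\<close>. Each error
      contains a deviation \<open>a'\<close> or \<open>b'\<close>, whose squared norms sum to at
      most a \<open>spread\<close>.\<close>
    have summand: "L2_inner m (T (a i)) (b i) - of_real (\<alpha> i * \<beta> i) * L2_inner m (T h) h
        = L2_inner m (T (a' i)) (b i) + of_real (\<alpha> i) * L2_inner m (T h) (b' i)" for i
    proof -
      have "L2_inner m (T (a' i)) (b i) = L2_inner m (\<lambda>x. T (a i) x - of_real (\<alpha> i) * T h x) (b i)"
      proof (rule L2_inner_cong[OF _ L2_eq_refl])
        have "L2_eq m (T (a' i)) (\<lambda>x. T (a i) x - T (\<lambda>t. of_real (\<alpha> i) * h t) x)"
          unfolding a'_def[abs_def] by (rule bounded_op_diff[OF bT aL2 L2_cmult[OF h]])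
        then show "L2_eq m (T (a' i)) (\<lambda>x. T (a i) x - of_real (\<alpha> i) * T h x)"
          using bounded_op_cmult[OF bT h, of "of_real (\<alpha> i)"] unfolding L2_eq_def by eventually_elim simp
      qed (intro TL2 a'L2 bL2 L2_diff L2_cmult aL2 h)+
      also have "\<dots> = L2_inner m (T (a i)) (b i) - of_real (\<alpha> i) * L2_inner m (T h) (b i)"
        by (simp add: L2_inner_diff_left L2_inner_cmult_left TL2 aL2 bL2 L2_cmult h)
      finally have "L2_inner m (T (a' i)) (b i) = L2_inner m (T (a i)) (b i) - of_real (\<alpha> i) * L2_inner m (T h) (b i)" .
      moreover have "L2_inner m (T h) (b' i) = L2_inner m (T h) (b i) - of_real (\<beta> i) * L2_inner m (T h) h"
        unfolding b'_def[abs_def]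
        by (simp add: L2_inner_diff_right L2_inner_cmult_right TL2 bL2 L2_cmult h)
      moreover have "x - of_real (\<alpha> i * \<beta> i) * w = y - of_real (\<alpha> i) * z + of_real (\<alpha> i) * (z - of_real (\<beta> i) * w)" if "x = y" for w x y z :: complex
        using that by (simp add: algebra_simps)
      ultimately show ?thesis by (simp only:)
    qed
    have part: "cmod ((\<Sum>i<n. L2_inner m (T (a i)) (b i)) - of_real (\<Sum>i<n. \<alpha> i * \<beta> i) * L2_inner m (T h) h) \<le> ?B" for n
    proof -
      have "(\<Sum>i<n. L2_inner m (T (a i)) (b i)) - of_real (\<Sum>i<n. \<alpha> i * \<beta> i) * L2_inner m (T h) h
          = (\<Sum>i<n. L2_inner m (T (a' i)) (b i) + of_real (\<alpha> i) * L2_inner m (T h) (b' i))"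
        unfolding summand[symmetric] by (simp add: sum_subtractf sum_distrib_right)
      also have "cmod \<dots> \<le> (\<Sum>i<n. L2_nrm m (a' i) * L2_nrm m (b i) + L2_nrm m h * (\<bar>\<alpha> i\<bar> * L2_nrm m (b' i)))"
      proof (rule sum_norm_le)
        fix i
        have "cmod (L2_inner m (T (a' i)) (b i)) \<le> L2_nrm m (a' i) * L2_nrm m (b i)"
          using L2_inner_cauchy_schwarz[OF TL2[OF a'L2] bL2] con[OF a'L2]
          by (meson L2_nrm_nonneg mult_right_mono order_trans)
        moreover have "cmod (L2_inner m (T h) (b' i)) \<le> L2_nrm m h * L2_nrm m (b' i)"
          using L2_inner_cauchy_schwarz[OF TL2[OF h] b'L2] con[OF h]
          by (meson L2_nrm_nonneg mult_right_mono order_trans)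
        then have "cmod (of_real (\<alpha> i) * L2_inner m (T h) (b' i)) \<le> L2_nrm m h * (\<bar>\<alpha> i\<bar> * L2_nrm m (b' i))"
          using mult_left_mono[of _ _ "\<bar>\<alpha> i\<bar>"] by (fastforce simp: norm_mult mult_ac)
        ultimately show "norm (L2_inner m (T (a' i)) (b i) + of_real (\<alpha> i) * L2_inner m (T h) (b' i))
            \<le> L2_nrm m (a' i) * L2_nrm m (b i) + L2_nrm m h * (\<bar>\<alpha> i\<bar> * L2_nrm m (b' i))"
          using norm_triangle_ineq by (meson add_mono order_trans)
      qed
      also have "\<dots> = (\<Sum>i<n. \<bar>L2_nrm m (a' i)\<bar> * \<bar>L2_nrm m (b i)\<bar>) + L2_nrm m h * (\<Sum>i<n. \<bar>\<alpha> i\<bar> * \<bar>L2_nrm m (b' i)\<bar>)"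
        by (simp add: sum.distrib sum_distrib_left)
      also have "\<dots> \<le> L2_set (\<lambda>i. L2_nrm m (a' i)) {..<n} * L2_set (\<lambda>i. L2_nrm m (b i)) {..<n}
          + L2_nrm m h * (L2_set \<alpha> {..<n} * L2_set (\<lambda>i. L2_nrm m (b' i)) {..<n})"
        by (intro add_mono mult_left_mono L2_set_mult_ineq) simp
      also have "\<dots> \<le> sqrt (spread f h) * (L2_nrm m h * L2_nrm m g)
          + L2_nrm m h * (L2_nrm m f * sqrt (spread g h))"
      proof -
        have "L2_set (\<lambda>i. L2_nrm m (a' i)) {..<n} \<le> sqrt (spread f h)"
          unfolding L2_set_def a'_eq by (rule real_sqrt_le_mono[OF diffb[OF f]])
        moreover have "L2_set (\<lambda>i. L2_nrm m (b' i)) {..<n} \<le> sqrt (spread g h)"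
          unfolding L2_set_def b'_eq by (rule real_sqrt_le_mono[OF diffb[OF g]])
        moreover have "L2_set (\<lambda>i. L2_nrm m (b i)) {..<n} \<le> L2_nrm m h * L2_nrm m g"
          unfolding L2_set_def by (rule real_le_lsqrt[OF _ sumb]) simp
        moreover have "L2_set \<alpha> {..<n} \<le> L2_nrm m f"
          unfolding L2_set_def \<alpha>_def
          using bessel_inequality[OF e, of "backshift f 0" n] by (intro real_le_lsqrt) (simp_all add: norm_backshift f)
        ultimately show ?thesis
          by (intro add_mono mult_left_mono mult_mono) (auto intro: order_trans[OF L2_set_nonneg])
      qed
      also have "\<dots> = ?B" by (simp add: algebra_simps)
      finally show ?thesis .
    qed
    have "(\<lambda>i. L2_inner m (T (a i)) (b i)) sums \<phi> T"
      unfolding \<phi>_def by (intro summable_sums summable_L2_inner square_summable_op[OF bT] sa sb)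
    moreover have "(\<lambda>i. \<alpha> i * \<beta> i) sums Re (L2_inner m f g)"
      using pars[of "backshift g 0" "backshift f 0"] inner_backshift[OF f g, of 0 0]
      by (simp add: \<alpha>_def \<beta>_def)
    ultimately have "(\<lambda>n. (\<Sum>i<n. L2_inner m (T (a i)) (b i)) - of_real (\<Sum>i<n. \<alpha> i * \<beta> i) * L2_inner m (T h) h)
        \<longlonglongrightarrow> \<phi> T - of_real (Re (L2_inner m f g)) * L2_inner m (T h) h"
      unfolding sums_def by (intro tendsto_intros)
    from tendsto_norm[OF this]
    show "cmod (\<phi> T - of_real (Re (L2_inner m f g)) * L2_inner m (T h) h) \<le> ?B"
      by (rule LIMSEQ_le_const2) (use part in blast)
  qed
qed

lemma spread_cmult:
  assumes "f \<in> L2 m" shows "spread (\<lambda>x. c * f x) h = (cmod c)\<^sup>2 * spread f h"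
proof -
  have "backshift (\<lambda>x. c * f x) t = cmul c (backshift f t)" for t
    using assms by (simp add: backshift_def left_regular_cmult embed_cmult)
  then have "norm (backshift (\<lambda>x. c * f x) t - backshift (\<lambda>x. c * f x) 0) = cmod c * norm (backshift f t - backshift f 0)" for t
    by (simp add: norm_cmul flip: linear_simps(2)[OF bounded_linear_cmul])
  then show ?thesis
    by (simp add: spread_def power_mult_distrib mult.left_commute)
qed

text \<open>\<open>real_part_product\<close> is applied to \<open>g\<close> and to
  \<open>?g\<close>; the latter yields the imaginary part of the coefficient function. At the
  identity the two real factors are 1 and 0, so only the first functional is compared with the
  state, and two equal errors give the factor 2.\<close>

lemma product_minus_state:
  assumes f: "f \<in> L2 m" and g: "g \<in> L2 m" and fg: "L2_inner m f g = 1" and h: "h \<in> L2 m" and h1: "L2_nrm m h = 1"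
  shows "\<exists>\<phi>. normal_functional m \<phi> \<and>
    (\<forall>x. \<phi> (left_regular x) = coeff_fun m f g x * coeff_fun m h h x - coeff_fun m h h x) \<and>
    (\<forall>T\<in>VN m. op_nrm m T \<le> 1 \<longrightarrow> cmod (\<phi> T)
      \<le> 2 * (sqrt (spread f h) * L2_nrm m g + L2_nrm m f * sqrt (spread g h)))"
proof -
  let ?g = "\<lambda>x. \<i> * g x"
  have g': "?g \<in> L2 m" by (rule L2_cmult[OF g])
  obtain \<phi>1 where 1: "normal_functional m \<phi>1"
    "\<And>x. \<phi>1 (left_regular x) = of_real (Re (L2_inner m (left_regular x f) g)) * L2_inner m (left_regular x h) h"
    "\<And>T. T \<in> VN m \<Longrightarrow> op_nrm m T \<le> 1 \<Longrightarrow>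
      cmod (\<phi>1 T - of_real (Re (L2_inner m f g)) * L2_inner m (T h) h)
        \<le> L2_nrm m h * (sqrt (spread f h) * L2_nrm m g + L2_nrm m f * sqrt (spread g h))"
    using real_part_product[OF f g h] by blast
  obtain \<phi>2 where 2: "normal_functional m \<phi>2"
    "\<And>x. \<phi>2 (left_regular x) = of_real (Re (L2_inner m (left_regular x f) ?g)) * L2_inner m (left_regular x h) h"
    "\<And>T. T \<in> VN m \<Longrightarrow> op_nrm m T \<le> 1 \<Longrightarrow>
      cmod (\<phi>2 T - of_real (Re (L2_inner m f ?g)) * L2_inner m (T h) h)
        \<le> L2_nrm m h * (sqrt (spread f h) * L2_nrm m ?g + L2_nrm m f * sqrt (spread ?g h))"
    using real_part_product[OF f g' h] by blast
  define \<phi> where "\<phi> T = (\<phi>1 T + \<i> * \<phi>2 T) + (- 1) * L2_inner m (T h) h" for T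
  have "normal_functional m \<phi>"
    unfolding \<phi>_def[abs_def]
    by (intro normal_functional_add normal_functional_cmult 1(1) 2(1) normal_functional_vector h)
  moreover have "\<phi> (left_regular x) = coeff_fun m f g x * coeff_fun m h h x - coeff_fun m h h x" for x
  proof -
    have "of_real (Re z) + \<i> * of_real (Re (- \<i> * z)) = z" for z by (simp add: complex_eq_iff)
    from this[of "L2_inner m (left_regular x f) g"]
    have "(of_real (Re (L2_inner m (left_regular x f) g)) + \<i> * of_real (Re (L2_inner m (left_regular x f) ?g)))
        = L2_inner m (left_regular x f) g"
      by (simp add: L2_inner_cmult_right)
    moreover have "p * u + \<i> * (q * u) + (- 1) * u = (p + \<i> * q) * u - u" for p q u :: complex
      by (simp add: algebra_simps)
    ultimately show ?thesis
      unfolding \<phi>_def 1(2) 2(2) coeff_fun_def by (simp only:)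
  qed
  moreover have "cmod (\<phi> T) \<le> 2 * (sqrt (spread f h) * L2_nrm m g + L2_nrm m f * sqrt (spread g h))"
    if T: "T \<in> VN m" "op_nrm m T \<le> 1" for T
  proof -
    have "cmod (\<phi>1 T - L2_inner m (T h) h) \<le> sqrt (spread f h) * L2_nrm m g + L2_nrm m f * sqrt (spread g h)"
      using 1(3)[OF T] by (simp add: fg h1)
    moreover have "cmod (\<phi>2 T) \<le> sqrt (spread f h) * L2_nrm m g + L2_nrm m f * sqrt (spread g h)"
      using 2(3)[OF T] by (simp add: L2_inner_cmult_right fg h1 L2_nrm_cmult spread_cmult[OF g])
    moreover have "cmod (\<phi> T) \<le> cmod (\<phi>1 T - L2_inner m (T h) h) + cmod (\<i> * \<phi>2 T)"
      using norm_triangle_ineq[of "\<phi>1 T - L2_inner m (T h) h" "\<i> * \<phi>2 T"] by (simp add: \<phi>_def algebra_simps)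
    ultimately show ?thesis by (simp add: norm_mult)
  qed
  ultimately show ?thesis by blast
qed


section \<open>Projections in the group von Neumann algebra\<close>

text \<open>Membership in \<open>VN m\<close>, phrased for operators on the Hilbert space type,
  where projections and spectral subspaces are formed. The identity in the commutant makes
  \<open>Q\<close> preserve copy 0, the scalars make it complex linear there.\<close>

definition commutes_left_commutant :: "('a hsum \<Rightarrow> 'a hsum) \<Rightarrow> bool" where
  "commutes_left_commutant Q \<longleftrightarrow> bounded_linear Q \<and>
     (\<forall>T\<in>left_commutant. \<forall>F. Q (lift_op m 0 T F) = lift_op m 0 T (Q F))"

lemma left_commutant_cmult: "(\<lambda>f x. c * f x) \<in> left_commutant"
  by (auto simp: commutant_def bounded_op_cmult_id left_regular_cmult)

lemma left_commutant_id: "(\<lambda>f. f) \<in> left_commutant"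
  by (auto simp: commutant_def bounded_op_id)

abbreviation slice0 :: "'a hsum \<Rightarrow> 'a hsum" where
  "slice0 \<equiv> lift_op m 0 (\<lambda>f. f)"

lemma slice0_embed [simp]: "f \<in> L2 m \<Longrightarrow> slice0 (embed m 0 f) = embed m 0 f"
  by (simp add: lift_op_embed[OF bounded_op_id])

lemma bounded_linear_slice0: "bounded_linear slice0"
  by (rule bounded_linear_lift_op[OF bounded_op_id])

lemma embed_restr: "embed m 0 (restr m 0 F) = slice0 F"
  by (simp add: lift_op_def)

lemma commutes_slice0: "commutes_left_commutant Q \<Longrightarrow> Q (slice0 F) = slice0 (Q F)"
  by (auto simp: commutes_left_commutant_def left_commutant_id)

lemma embed_restr_op:
  assumes Q: "commutes_left_commutant Q" and f: "f \<in> L2 m"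
  shows "embed m 0 (restr_op m 0 0 Q f) = Q (embed m 0 f)"
proof -
  have "embed m 0 (restr_op m 0 0 Q f) = slice0 (Q (embed m 0 f))"
    by (simp add: restr_op_def embed_restr)
  also have "\<dots> = Q (slice0 (embed m 0 f))" by (simp only: commutes_slice0[OF Q])
  finally show ?thesis using f by simp
qed

lemma L2_eq_via_embed: "f \<in> L2 m \<Longrightarrow> g \<in> L2 m \<Longrightarrow> L2_eq m f g \<longleftrightarrow> embed m 0 f = embed m 0 g"
  by (simp add: embed_eq_iff)

lemma restr_op_VN:
  assumes Q: "commutes_left_commutant Q" shows "restr_op m 0 0 Q \<in> VN m"
proof (rule VN_I)
  have blQ: "bounded_linear Q" using Q by (simp add: commutes_left_commutant_def)
  have comm: "Q (lift_op m 0 T F) = lift_op m 0 T (Q F)" if "T \<in> left_commutant" for T F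
    using Q that by (simp add: commutes_left_commutant_def)
  show b: "bounded_op m (restr_op m 0 0 Q)"
  proof (rule bounded_op_restr_op[OF blQ])
    fix c and f :: "'a \<Rightarrow> complex" assume f: "f \<in> L2 m"
    have "Q (cmul c (embed m 0 f)) = lift_op m 0 (\<lambda>f x. c * f x) (Q (embed m 0 f))"
      using comm[OF left_commutant_cmult, of c "embed m 0 f"] f
      by (simp add: lift_op_embed[OF bounded_op_cmult_id] embed_cmult)
    then have "Q (cmul c (embed m 0 f)) = embed m 0 (\<lambda>x. c * restr m 0 (Q (embed m 0 f)) x)"
      by (simp add: lift_op_def)
    then have "L2_eq m (restr m 0 (Q (cmul c (embed m 0 f)))) (\<lambda>x. c * restr m 0 (Q (embed m 0 f)) x)"
      by (simp add: restr_embed L2_cmult)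
    then show "L2_eq m (restr m 0 (Q (cmul c (embed m 0 f)))) (restr m 0 (cmul c (Q (embed m 0 f))))"
      using restr_cmul L2_eq_sym L2_eq_trans by blast
  qed
  fix A f assume A: "A \<in> left_commutant" and f: "f \<in> L2 m"
  have bA: "bounded_op m A" by (rule left_commutantD[OF A])
  note L2s = bounded_op_L2[OF bA] bounded_op_L2[OF b]
  show "L2_eq m (restr_op m 0 0 Q (A f)) (A (restr_op m 0 0 Q f))"
    using f L2s comm[OF A, of "embed m 0 f"]
    by (simp add: L2_eq_via_embed embed_restr_op[OF Q] flip: lift_op_embed[OF bA])
qed

lemma L2_inner_eq_of_embed:
  assumes "f \<in> L2 m" "g \<in> L2 m" "f' \<in> L2 m" "g' \<in> L2 m"
    and "\<And>c. inner (cmul c (embed m 0 f)) (embed m 0 g) = inner (cmul c (embed m 0 f')) (embed m 0 g')"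
  shows "L2_inner m f g = L2_inner m f' g'"
proof (rule L2_inner_eq_of_Re)
  fix c show "Re (L2_inner m (\<lambda>x. c * f x) g) = Re (L2_inner m (\<lambda>x. c * f' x) g')"
    using assms(5)[of c] assms(1-4) by (simp add: inner_embed_embed L2_cmult flip: embed_cmult)
qed

lemma restr_op_projection:
  assumes Q: "commutes_left_commutant Q" and idem: "\<And>F. Q (Q F) = Q F" and sa: "self_adjoint Q"
  shows "restr_op m 0 0 Q \<in> VN_projections m"
proof -
  have V: "restr_op m 0 0 Q \<in> VN m" by (rule restr_op_VN[OF Q])
  have b: "bounded_op m (restr_op m 0 0 Q)" by (rule VN_D[OF V])
  note L2s = bounded_op_L2[OF b]
  have cm: "cmul c (Q (embed m 0 f)) = Q (cmul c (embed m 0 f))" if "f \<in> L2 m" for c f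
  proof -
    have "L2_eq m (restr_op m 0 0 Q (\<lambda>x. c * f x)) (\<lambda>x. c * restr_op m 0 0 Q f x)"
      by (rule bounded_op_cmult[OF b that])
    then show ?thesis
      using that by (simp add: L2_eq_via_embed L2s L2_cmult embed_restr_op[OF Q] embed_cmult)
  qed
  have "L2_eq m (restr_op m 0 0 Q (restr_op m 0 0 Q f)) (restr_op m 0 0 Q f)" if "f \<in> L2 m" for f
    using that by (simp add: L2_eq_via_embed L2s embed_restr_op[OF Q] idem)
  moreover have "L2_inner m (restr_op m 0 0 Q f) g = L2_inner m f (restr_op m 0 0 Q g)"
    if "f \<in> L2 m" "g \<in> L2 m" for f g
  proof (rule L2_inner_eq_of_embed)
    fix c
    show "inner (cmul c (embed m 0 (restr_op m 0 0 Q f))) (embed m 0 g)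
        = inner (cmul c (embed m 0 f)) (embed m 0 (restr_op m 0 0 Q g))"
      using sa that by (simp add: embed_restr_op[OF Q] cm self_adjoint_def)
  qed (simp_all add: that L2s)
  ultimately show ?thesis using V b by (simp add: VN_projections_def projection_op_def)
qed

lemma VN_projectionsD:
  assumes "P \<in> VN_projections m"
  shows "P \<in> VN m" "bounded_op m P" "f \<in> L2 m \<Longrightarrow> L2_eq m (P (P f)) (P f)"
    "f \<in> L2 m \<Longrightarrow> g \<in> L2 m \<Longrightarrow> L2_inner m (P f) g = L2_inner m f (P g)"
  using assms by (auto simp: VN_projections_def projection_op_def)

lemma inner_projection:
  assumes P: "P \<in> VN_projections m" and "f \<in> L2 m" "g \<in> L2 m"
  shows "inner (embed m 0 (P f)) (embed m 0 g) = inner (embed m 0 f) (embed m 0 (P g))"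
  using assms VN_projectionsD(4)[OF P] bounded_op_L2[OF VN_projectionsD(2)[OF P]]
  by (simp add: inner_embed_embed)

text \<open>
  The infimum of a set of projections is the projection onto the orthogonal complement of the
  closed span of their kernels.
\<close>

lemma proj_Inf_exists:
  assumes PP: "\<P> \<subseteq> VN_projections m" shows "\<exists>S. is_proj_Inf m \<P> S"
proof -
  define B where "B = {embed m 0 (\<lambda>x. f x - P f x) | f P. f \<in> L2 m \<and> P \<in> \<P>}"
  define Y where "Y = closure (span B)"
  have Y: "closed Y" "subspace Y" by (auto simp: Y_def intro: subspace_closure)
  have BY: "B \<subseteq> Y" unfolding Y_def by (meson closure_subset order_trans span_superset)
  have P: "P \<in> VN_projections m" if "P \<in> \<P>" for P using PP that by blast
  have PL2: "P f \<in> L2 m" if "P \<in> \<P>" "f \<in> L2 m" for P f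
    using that P VN_projectionsD(2) bounded_op_L2 by blast
  have perpI: "inner z y = 0" if "\<And>f P. f \<in> L2 m \<Longrightarrow> P \<in> \<P> \<Longrightarrow> inner z (embed m 0 (\<lambda>x. f x - P f x)) = 0" "y \<in> Y" for z y
  proof -
    have "span B \<subseteq> {v. inner z v = 0}"
      using that(1) by (intro span_minimal) (auto simp: subspace_def inner_add B_def)
    then have "Y \<subseteq> {v. inner z v = 0}"
      unfolding Y_def by (intro closure_minimal closed_Collect_eq continuous_intros)
    then show ?thesis using that(2) by blast
  qed
  \<comment> \<open>f - P f is orthogonal to \<open>f\<close>, being a generator of
    \<open>Y\<close>, and to P f, since \<open>P\<close> is a projection; so it is zero.\<close>
  have Yfix: "embed m 0 (P f) = embed m 0 f"
    if perp: "\<And>y. y \<in> Y \<Longrightarrow> inner (embed m 0 f) y = 0" and f: "f \<in> L2 m" and PPin: "P \<in> \<P>" for f P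
  proof -
    note p = P[OF PPin]
    have "inner (embed m 0 f) (embed m 0 (\<lambda>x. f x - P f x)) = 0"
      using f PPin by (intro perp subsetD[OF BY]) (auto simp: B_def)
    moreover have "inner (embed m 0 (P f)) (embed m 0 (\<lambda>x. f x - P f x)) = 0"
    proof -
      have "embed m 0 (P (P f)) = embed m 0 (P f)"
        using VN_projectionsD(3)[OF p f] f PL2[OF PPin] by (simp add: L2_eq_via_embed)
      then have "inner (embed m 0 (P f)) (embed m 0 (P f)) = inner (embed m 0 (P f)) (embed m 0 f)"
        using inner_projection[OF p PL2[OF PPin f] f] by (simp add: inner_commute)
      then show ?thesis using f PL2[OF PPin f] by (simp add: embed_diff inner_diff inner_commute)
    qed
    ultimately have "inner (embed m 0 (\<lambda>x. f x - P f x)) (embed m 0 (\<lambda>x. f x - P f x)) = 0"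
      using f PL2[OF PPin f] by (simp add: embed_diff inner_diff)
    then show ?thesis using f PL2[OF PPin f] by (simp add: embed_diff)
  qed
  have slice_Y: "slice0 y = y" if "y \<in> Y" for y
  proof -
    interpret bounded_linear slice0 by (rule bounded_linear_slice0)
    have "subspace {y. slice0 y = y}" by (auto simp: subspace_def add scaleR zero)
    moreover have "B \<subseteq> {y. slice0 y = y}" using PL2 by (auto simp: B_def L2_diff)
    moreover have "closed {y. slice0 y = y}"
      by (intro closed_Collect_eq continuous_intros linear_continuous_on bounded_linear_slice0)
    ultimately have "Y \<subseteq> {y. slice0 y = y}" unfolding Y_def by (intro closure_minimal span_minimal)
    then show ?thesis using that by blast
  qed
  \<comment> \<open>\<open>Y\<close> lies in copy 0, and the complement is taken inside that
    copy.\<close>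
  define Q where "Q F = slice0 F - proj Y F" for F
  have perp_slice: "inner (embed m 0 (restr m 0 F)) y = 0" if "\<And>y. y \<in> Y \<Longrightarrow> inner F y = 0" "y \<in> Y" for F y
  proof (rule perpI[OF _ that(2)])
    fix f P assume fP: "f \<in> L2 m" "P \<in> \<P>"
    have d: "(\<lambda>x. f x - P f x) \<in> L2 m" using fP PL2 by (intro L2_diff)
    have "inner F (embed m 0 (\<lambda>x. f x - P f x)) = 0"
      by (intro that subsetD[OF BY]) (use fP in \<open>auto simp: B_def\<close>)
    then show "inner (embed m 0 (restr m 0 F)) (embed m 0 (\<lambda>x. f x - P f x)) = 0"
      by (simp only: inner_embed_embed[OF restr_L2 d] inner_embed[OF d, of F])
  qed
  have projY_comm: "proj Y (lift_op m 0 T F) = lift_op m 0 T (proj Y F)" if T: "T \<in> left_commutant" for T F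
  proof (rule proj_commute[OF Y])
    have bT: "bounded_op m T" by (rule left_commutantD[OF T])
    note TL2 = bounded_op_L2[OF bT]
    show "bounded_linear (lift_op m 0 T)" by (rule bounded_linear_lift_op[OF bT])
    have PT: "L2_eq m (P (T f)) (T (P f))" if "P \<in> \<P>" "f \<in> L2 m" for P f
      by (rule VN_D(2)[OF VN_projectionsD(1)[OF P[OF that(1)]] T that(2)])
    have gen: "embed m 0 (T (\<lambda>x. f x - P f x)) = embed m 0 (\<lambda>x. T f x - P (T f) x)"
      if "P \<in> \<P>" "f \<in> L2 m" for P f
    proof -
      have "embed m 0 (T (\<lambda>x. f x - P f x)) = embed m 0 (\<lambda>x. T f x - T (P f) x)"
        by (rule embed_cong[OF bounded_op_diff[OF bT that(2) PL2[OF that]] TL2[OF L2_diff[OF that(2) PL2[OF that]]]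
              L2_diff[OF TL2[OF that(2)] TL2[OF PL2[OF that]]]])
      also have "\<dots> = embed m 0 (\<lambda>x. T f x - P (T f) x)"
      proof -
        have e: "embed m 0 (P (T f)) = embed m 0 (T (P f))"
          by (rule embed_cong[OF PT[OF that] PL2[OF that(1) TL2[OF that(2)]] TL2[OF PL2[OF that]]])
        show ?thesis
          unfolding embed_diff[OF TL2[OF that(2)] TL2[OF PL2[OF that]]]
            embed_diff[OF TL2[OF that(2)] PL2[OF that(1) TL2[OF that(2)]]] e ..
      qed
      finally show ?thesis .
    qed
    have "lift_op m 0 T ` B \<subseteq> B"
    proof clarify
      fix b assume "b \<in> B"
      then obtain f P where b: "b = embed m 0 (\<lambda>x. f x - P f x)" and fP: "f \<in> L2 m" "P \<in> \<P>"
        by (auto simp: B_def)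
      then have "lift_op m 0 T b = embed m 0 (\<lambda>x. T f x - P (T f) x)"
        by (simp add: lift_op_embed[OF bT] L2_diff PL2 gen)
      then show "lift_op m 0 T b \<in> B" using fP TL2 by (auto simp: B_def)
    qed
    then have "lift_op m 0 T ` Y \<subseteq> Y"
      unfolding Y_def using BY
      by (intro bounded_linear_closure_span_subset bounded_linear_lift_op[OF bT]) (auto simp: Y_def)
    then show "lift_op m 0 T y \<in> Y" if "y \<in> Y" for y using that by blast
    \<comment> \<open>No adjoint of \<open>T\<close> is used: the component \<open>r\<close> of
      \<open>z\<close> in copy 0 is fixed by every \<open>P\<close>, and as \<open>P\<close>
      commutes with \<open>T\<close>, so is T r, which is therefore orthogonal to all
      generators.\<close>
    fix z y assume z: "\<And>y. y \<in> Y \<Longrightarrow> inner z y = 0" and y: "y \<in> Y"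
    define r where "r = restr m 0 z"
    have r: "r \<in> L2 m" by (simp add: r_def)
    have rperp: "inner (embed m 0 r) y = 0" if "y \<in> Y" for y
      unfolding r_def using perp_slice[OF z that] .
    show "inner (lift_op m 0 T z) y = 0"
    proof (rule perpI[OF _ y])
      fix f P assume fP: "f \<in> L2 m" "P \<in> \<P>"
      have "embed m 0 (P (T r)) = embed m 0 (T (P r))"
        using PT[OF fP(2) r] by (intro embed_cong) (simp_all add: TL2 PL2 r fP)
      also have "\<dots> = embed m 0 (T r)"
        using Yfix[OF rperp r fP(2)]
        by (intro embed_cong bounded_op_cong[OF bT]) (simp_all add: TL2 PL2 r fP L2_eq_via_embed)
      finally have "inner (embed m 0 (T r)) (embed m 0 (P f)) = inner (embed m 0 (T r)) (embed m 0 f)"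
        using inner_projection[OF P[OF fP(2)] TL2[OF r] fP(1)] by simp
      then show "inner (lift_op m 0 T z) (embed m 0 (\<lambda>x. f x - P f x)) = 0"
        using fP by (simp add: lift_op_def r_def[symmetric] embed_diff PL2 inner_diff)
    qed
  qed
  have Q: "commutes_left_commutant Q"
    unfolding commutes_left_commutant_def
  proof (intro conjI ballI allI)
    show "bounded_linear Q"
      unfolding Q_def by (intro bounded_linear_sub bounded_linear_slice0 bounded_linear_proj[OF Y])
    fix T F assume T: "T \<in> left_commutant"
    have bT: "bounded_op m T" by (rule left_commutantD[OF T])
    have "slice0 (lift_op m 0 T F) = lift_op m 0 T F"
      by (simp add: lift_op_def[of m 0 T] bounded_op_L2[OF bT])
    moreover have "lift_op m 0 T (slice0 F) = lift_op m 0 T F"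
      using lift_op_embed[OF bT restr_L2] by (simp add: lift_op_def)
    ultimately show "Q (lift_op m 0 T F) = lift_op m 0 T (Q F)"
      by (simp add: Q_def projY_comm[OF T] linear_simps(2)[OF bounded_linear_lift_op[OF bT]])
  qed
  have slice_idem: "slice0 (slice0 F) = slice0 F" for F
    by (simp add: lift_op_def[of m 0 "\<lambda>f. f" F])
  have slice_sa: "inner (slice0 F) G = inner F (slice0 G)" for F G
    by (simp add: embed_restr[symmetric] inner_embed inner_commute[of "embed m 0 _" G])
       (metis L2_inner_commute complex_cnj(1) cnj.simps(1))
  have projY_slice: "proj Y (slice0 F) = proj Y F" for F
    using projY_comm[OF left_commutant_id, of F] slice_Y[OF proj_in[OF Y]] by simp
  have "self_adjoint Q"
    by (simp add: self_adjoint_def Q_def inner_diff slice_sa inner_proj_commute[OF Y])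
  moreover have "Q (Q F) = Q F" for F
  proof -
    have "Q (Q F) = slice0 (slice0 F) - slice0 (proj Y F) - (proj Y (slice0 F) - proj Y (proj Y F))"
      by (simp add: Q_def linear_simps(2)[OF bounded_linear_slice0] linear_simps(2)[OF bounded_linear_proj[OF Y]])
    then show ?thesis
      by (simp add: slice_idem projY_slice slice_Y[OF proj_in[OF Y]] proj_of_mem[OF Y] proj_in[OF Y] Q_def)
  qed
  ultimately have S: "restr_op m 0 0 Q \<in> VN_projections m" by (intro restr_op_projection[OF Q])
  let ?S = "restr_op m 0 0 Q"
  have SL2: "?S f \<in> L2 m" for f by (simp add: restr_op_def)
  have eS: "embed m 0 (?S f) = embed m 0 f - proj Y (embed m 0 f)" if "f \<in> L2 m" for f
    using that by (simp add: embed_restr_op[OF Q] Q_def)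
  have "is_proj_Inf m \<P> ?S"
    unfolding is_proj_Inf_def proj_le_def
  proof (intro conjI S ballI impI)
    fix P f assume PPin: "P \<in> \<P>" and f: "f \<in> L2 m"
    have "embed m 0 (P (?S f)) = embed m 0 (?S f)"
    proof (rule Yfix[OF _ SL2 PPin])
      fix y assume "y \<in> Y"
      then show "inner (embed m 0 (?S f)) y = 0" using proj_orthogonal[OF Y] by (simp add: eS f)
    qed
    then show "L2_eq m (P (?S f)) (?S f)" using PL2[OF PPin SL2] SL2 by (simp add: L2_eq_via_embed)
  next
    fix R f assume R: "R \<in> VN_projections m" "\<forall>P\<in>\<P>. \<forall>f\<in>L2 m. L2_eq m (P (R f)) (R f)" and f: "f \<in> L2 m"
    have Rf: "R f \<in> L2 m" by (rule bounded_op_L2[OF VN_projectionsD(2)[OF R(1)] f])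
    have "proj Y (embed m 0 (R f)) = 0"
    proof (rule proj_of_orthogonal[OF Y], rule perpI)
      fix g P assume gP: "g \<in> L2 m" "P \<in> \<P>"
      have "embed m 0 (P (R f)) = embed m 0 (R f)"
        using R(2) gP f PL2 Rf by (simp add: L2_eq_via_embed[symmetric])
      then have "inner (embed m 0 (R f)) (embed m 0 g) = inner (embed m 0 (R f)) (embed m 0 (P g))"
        using inner_projection[OF P[OF gP(2)] Rf gP(1)] by simp
      then show "inner (embed m 0 (R f)) (embed m 0 (\<lambda>x. g x - P g x)) = 0"
        using gP by (simp add: embed_diff PL2 inner_diff)
    qed
    then show "L2_eq m (?S (R f)) (R f)" using Rf SL2 by (simp add: L2_eq_via_embed eS)
  qed
  then show ?thesis by blast
qed

text \<open>The supports S and R lie below \<open>P\<close> and \<open>Q\<close>, so z = S R f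
  satisfies <z, z> = <Q R f, P S z> = <P Q R f, S z> = 0, and no support has to be computed.\<close>

lemma orthogonal_states_of_projections:
  assumes P: "P \<in> VN_projections m" "duality m P u = 1" and Q: "Q \<in> VN_projections m" "duality m Q v = 1"
    and PQ: "\<And>f. f \<in> L2 m \<Longrightarrow> L2_eq m (P (Q f)) (\<lambda>_. 0)"
  shows "orthogonal_states m u v"
proof -
  have inf: "is_proj_Inf m {P \<in> VN_projections m. duality m P w = 1} (state_support m w)" for w
    unfolding state_support_def by (rule someI_ex[OF proj_Inf_exists]) blast
  let ?S = "state_support m u" and ?R = "state_support m v"
  have S: "?S \<in> VN_projections m" and R: "?R \<in> VN_projections m"
    using inf by (auto simp: is_proj_Inf_def)
  have SP: "L2_eq m (P (?S f)) (?S f)" and RQ: "L2_eq m (Q (?R f)) (?R f)" if "f \<in> L2 m" for f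
    using inf[of u] inf[of v] P Q that by (auto simp: is_proj_Inf_def proj_le_def)
  note b = bounded_op_L2[OF VN_projectionsD(2)[OF S]] bounded_op_L2[OF VN_projectionsD(2)[OF R]]
    bounded_op_L2[OF VN_projectionsD(2)[OF P(1)]] bounded_op_L2[OF VN_projectionsD(2)[OF Q(1)]]
  show ?thesis
    unfolding orthogonal_states_def
  proof
    fix f assume f: "f \<in> L2 m"
    let ?z = "?S (?R f)"
    have "inner (embed m 0 ?z) (embed m 0 ?z) = inner (embed m 0 (?R f)) (embed m 0 (?S ?z))"
      using f by (intro inner_projection[OF S]) (simp_all add: b)
    also have "embed m 0 (?S ?z) = embed m 0 (P (?S ?z))"
      using SP[of ?z] f by (simp add: L2_eq_via_embed b)
    also have "embed m 0 (?R f) = embed m 0 (Q (?R f))"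
      using RQ[of f] f by (simp add: L2_eq_via_embed b)
    also have "inner (embed m 0 (Q (?R f))) (embed m 0 (P (?S ?z)))
        = inner (embed m 0 (P (Q (?R f)))) (embed m 0 (?S ?z))"
      using f by (intro inner_projection[OF P(1), symmetric]) (simp_all add: b)
    also have "embed m 0 (P (Q (?R f))) = 0"
      using PQ[of "?R f"] f by (simp add: L2_eq_via_embed b embed_zero)
    finally show "L2_eq m ?z (\<lambda>_. 0)" using f by (simp add: L2_eq_via_embed b embed_zero)
  qed
qed


section \<open>Concentrated functions and averages of translations\<close>

definition normalized_indicator :: "'a set \<Rightarrow> 'a \<Rightarrow> complex" where
  "normalized_indicator U x = of_real (1 / sqrt (measure m U)) * indicator U x"

definition small_nhd :: "'a set \<Rightarrow> bool" where
  "small_nhd U \<longleftrightarrow> open U \<and> 0 \<in> U \<and> emeasure m U < top"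

lemma small_nhd_sets: "small_nhd U \<Longrightarrow> U \<in> sets m"
  by (simp add: small_nhd_def)

lemma measure_small_nhd_pos: "small_nhd U \<Longrightarrow> 0 < measure m U"
  using emeasure_open_pos[of U] emeasure_eq_ennreal_measure[of m U] measure_nonneg[of m U]
  by (auto simp: small_nhd_def less_le)

lemma normalized_indicator_L2: "small_nhd U \<Longrightarrow> normalized_indicator U \<in> L2 m"
  unfolding normalized_indicator_def[abs_def]
  by (intro L2_cmult L2_indicator) (auto simp: small_nhd_def)

lemma L2_nrm_normalized_indicator:
  assumes U: "small_nhd U" shows "L2_nrm m (normalized_indicator U) = 1"
proof -
  have "(L2_nrm m (\<lambda>x. indicator U x :: complex))\<^sup>2 = (\<integral>x. indicator U x \<partial>m)"
    unfolding L2_nrm_power2 by (intro Bochner_Integration.integral_cong) (auto split: split_indicator)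
  also have "\<dots> = measure m U" using small_nhd_sets[OF U] by simp
  finally have "L2_nrm m (\<lambda>x. indicator U x :: complex) = sqrt (measure m U)"
    by (metis L2_nrm_nonneg real_sqrt_unique)
  then show ?thesis
    using measure_small_nhd_pos[OF U] unfolding normalized_indicator_def[abs_def] L2_nrm_cmult
    by (simp add: norm_divide)
qed

abbreviation chi :: "'a set \<Rightarrow> 'a hsum" where
  "chi U \<equiv> embed m 0 (normalized_indicator U)"

lemma norm_chi: "small_nhd U \<Longrightarrow> norm (chi U) = 1"
  by (simp add: norm_embed normalized_indicator_L2 L2_nrm_normalized_indicator)

text \<open>The invariant of the construction. For a projection it says that the complement nearly
  fixes every sufficiently concentrated normalised indicator.\<close>

definition negligible :: "('a hsum \<Rightarrow> 'a hsum) \<Rightarrow> bool" where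
  "negligible Q \<longleftrightarrow> (\<forall>e>0. \<exists>W. open W \<and> 0 \<in> W \<and> (\<forall>U. small_nhd U \<and> U \<subseteq> W \<longrightarrow> norm (Q (chi U)) < e))"

text \<open>Unlike \<open>translate\<close>, this acts on copy 0 only and vanishes on its orthogonal
  complement, so that averages stay inside the copy.\<close>

abbreviation slice_translate :: "'a \<Rightarrow> 'a hsum \<Rightarrow> 'a hsum" where
  "slice_translate t \<equiv> lift_op m 0 (left_regular t)"

lemma bounded_linear_slice_translate: "bounded_linear (slice_translate t)"
  by (rule bounded_linear_lift_op[OF bounded_op_left_regular])

lemma slice_translate_eq: "slice_translate t F = embed m 0 (left_regular t (restr m 0 F))"
  by (simp add: lift_op_def)

lemma norm_slice_translate: "norm (slice_translate t F) \<le> norm F"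
  by (simp add: slice_translate_eq norm_embed_left_regular norm_embed_restr)

lemma inner_embed_left: "f \<in> L2 m \<Longrightarrow> inner (embed m 0 f) F = Re (L2_inner m f (restr m 0 F))"
  by (subst inner_commute, subst inner_embed, assumption, subst L2_inner_commute) simp

lemma inner_slice_translate: "inner (slice_translate t F) G = inner F (slice_translate (- t) G)"
  by (simp add: slice_translate_eq inner_embed inner_embed_left L2_inner_left_regular_left)

lemma continuous_slice_translate: "continuous_on UNIV (\<lambda>t. slice_translate t F)"
  unfolding slice_translate_eq by (rule continuous_on_translation) simp

lemma slice_translate_slice0: "slice_translate t (slice0 F) = slice_translate t F"
  using lift_op_embed[OF bounded_op_left_regular restr_L2] by (simp add: lift_op_def)

lemma slice_translate_slice_translate: "slice_translate s (slice_translate t F) = slice_translate (s + t) F"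
  unfolding slice_translate_eq[of t] slice_translate_eq[of "s + t"]
  by (simp add: lift_op_embed[OF bounded_op_left_regular] left_regular_left_regular)

lemma slice_translate_zero: "slice_translate 0 F = slice0 F"
  by (simp add: lift_op_def)

definition average :: "'a set \<Rightarrow> ('a \<Rightarrow> real) \<Rightarrow> real" where
  "average V \<phi> = (\<integral>t. indicator V t * \<phi> t \<partial>m) / measure m V"

lemma integrable_average:
  fixes \<phi> :: "'a \<Rightarrow> real"
  assumes V: "small_nhd V" and \<phi>: "continuous_on UNIV \<phi>" "\<And>t. \<bar>\<phi> t\<bar> \<le> C"
  shows "integrable m (\<lambda>t. indicator V t * \<phi> t)"
proof (rule Bochner_Integration.integrable_bound)
  have Vm: "V \<in> sets m" by (rule small_nhd_sets[OF V])
  show "integrable m (\<lambda>t. C * indicator V t)"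
    using V Vm by (simp add: small_nhd_def)
  have "\<phi> \<in> borel_measurable m"
    using borel_measurable_continuous_onI[OF \<phi>(1)] by (simp add: measurable_cong_sets[OF sets_m refl])
  then show "(\<lambda>t. indicator V t * \<phi> t) \<in> borel_measurable m" using Vm by measurable
  show "AE t in m. norm (indicator V t * \<phi> t) \<le> norm (C * indicator V t)"
    using \<phi>(2) order_trans[OF \<phi>(2) abs_ge_self] by (intro AE_I2) (auto split: split_indicator)
qed

lemma average_const: "small_nhd V \<Longrightarrow> average V (\<lambda>_. c) = c"
  using measure_small_nhd_pos[of V] small_nhd_sets[of V] by (simp add: average_def)

lemma abs_average_le:
  assumes V: "small_nhd V" and "\<And>t. t \<in> V \<Longrightarrow> \<bar>\<phi> t\<bar> \<le> c"
  shows "\<bar>average V \<phi>\<bar> \<le> c"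
proof -
  have fin: "emeasure m V < top" using V by (simp add: small_nhd_def)
  have "0 \<in> V" using V by (simp add: small_nhd_def)
  then have c: "0 \<le> c" using assms(2)[of 0] by linarith
  have "\<bar>\<integral>t. indicator V t * \<phi> t \<partial>m\<bar> \<le> (\<integral>t. \<bar>indicator V t * \<phi> t\<bar> \<partial>m)" by (rule integral_abs_bound)
  also have "\<dots> \<le> (\<integral>t. c * indicator V t \<partial>m)"
    using assms(2) c fin small_nhd_sets[OF V] by (intro integral_mono') (auto split: split_indicator)
  also have "\<dots> = c * measure m V" using small_nhd_sets[OF V] by simp
  finally show ?thesis
    using measure_small_nhd_pos[OF V] by (simp add: average_def abs_divide pos_divide_le_eq)
qed

text \<open>The average exists as an operator through its form alone. The map \<open>s\<close> lets
  one lemma provide both the average (identity) and its adjoint (inversion).\<close>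

lemma averaging_operator_exists:
  assumes V: "small_nhd V" and s: "continuous_on UNIV s"
  obtains A where "commutes_left_commutant A"
    "\<And>F G. inner (A F) G = average V (\<lambda>t. inner (slice_translate (s t) F) G)"
    "\<And>F. norm (A F) \<le> norm F"
proof -
  let ?b = "\<lambda>F G. average V (\<lambda>t. inner (slice_translate (s t) F) G)"
  have bd: "\<bar>inner (slice_translate (s t) F) G\<bar> \<le> norm F * norm G" for t F G
    using Cauchy_Schwarz_ineq2[of "slice_translate (s t) F" G]
      mult_right_mono[OF norm_slice_translate[of "s t" F], of "norm G"] by simp
  have cont: "continuous_on UNIV (\<lambda>t. inner (slice_translate (s t) F) G)" for F G
    by (intro continuous_intros continuous_on_compose2[OF continuous_slice_translate s]) simp
  note int = integrable_average[OF V cont bd]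
  have bound: "\<bar>?b F G\<bar> \<le> 1 * norm F * norm G" for F G
    using bd by (intro abs_average_le[OF V]) simp
  have bil: "bounded_bilinear ?b"
  proof
    fix F F' G G' :: "'a hsum" and r :: real
    show "?b (F + F') G = ?b F G + ?b F' G"
      using int[of F G] int[of F' G]
      by (simp add: average_def linear_simps(1)[OF bounded_linear_slice_translate] inner_add distrib_left add_divide_distrib)
    show "?b F (G + G') = ?b F G + ?b F G'"
      using int[of F G] int[of F G'] by (simp add: average_def inner_add distrib_left add_divide_distrib)
    show "?b (r *\<^sub>R F) G = r *\<^sub>R ?b F G"
      by (simp add: average_def linear_simps(5)[OF bounded_linear_slice_translate] mult.left_commute)
    show "?b F (r *\<^sub>R G) = r *\<^sub>R ?b F G"
      by (simp add: average_def mult.left_commute)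
    show "\<exists>K. \<forall>F G. norm (?b F G) \<le> norm F * norm G * K"
      using bound by (intro exI[of _ 1]) simp
  qed
  obtain A where A: "bounded_linear A" "\<And>F G. inner (A F) G = ?b F G" "\<And>F. norm (A F) \<le> 1 * norm F"
    using riesz_form[OF bil bound] by auto
  have "A (lift_op m 0 T F) = lift_op m 0 T (A F)" if T: "T \<in> left_commutant" for T F
  proof (rule vector_eq_rdot[THEN iffD1], rule allI)
    fix G
    have bT: "bounded_op m T" by (rule left_commutantD[OF T])
    \<comment> \<open>Moves \<open>T\<close> into the fixed right argument, outside the
      average.\<close>
    obtain G' where G': "\<And>x. inner (lift_op m 0 T x) G = inner x G'"
      using adjoint_at_exists[OF bounded_linear_lift_op[OF bT]] by blast
    have "slice_translate t (lift_op m 0 T F) = lift_op m 0 T (slice_translate t F)" for t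
    proof -
      have "slice_translate t (lift_op m 0 T F) = embed m 0 (left_regular t (T (restr m 0 F)))"
        unfolding lift_op_def[of m 0 T]
        by (rule lift_op_embed[OF bounded_op_left_regular]) (rule bounded_op_L2[OF bT restr_L2])
      also have "\<dots> = embed m 0 (T (left_regular t (restr m 0 F)))"
        by (rule embed_cong[OF L2_eq_sym[OF left_commutantD(2)[OF T restr_L2]]])
          (simp_all add: bounded_op_L2[OF bT])
      also have "\<dots> = lift_op m 0 T (slice_translate t F)"
        unfolding slice_translate_eq by (rule lift_op_embed[OF bT, symmetric]) simp
      finally show ?thesis .
    qed
    then show "inner (A (lift_op m 0 T F)) G = inner (lift_op m 0 T (A F)) G"
      by (simp add: A(2) G')
  qed
  then have "commutes_left_commutant A" using A(1) by (simp add: commutes_left_commutant_def)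
  with A(2,3) show thesis by (intro that) simp_all
qed

text \<open>With D = A F - F, the number |D|^2 is the average of the inner products of D with the
  differences between the translates of \<open>F\<close> and \<open>F\<close>, each at most e
  |D|.\<close>

lemma averaging_operator_near:
  assumes V: "small_nhd V" and A: "\<And>F G. inner (A F) G = average V (\<lambda>t. inner (slice_translate (s t) F) G)"
    and near: "\<And>t. t \<in> V \<Longrightarrow> norm (slice_translate (s t) F - F) \<le> e"
    and int: "integrable m (\<lambda>t. indicator V t * inner (slice_translate (s t) F) (A F - F))"
  shows "norm (A F - F) \<le> e"
proof -
  let ?G = "A F - F"
  have "(norm ?G)\<^sup>2 = average V (\<lambda>t. inner (slice_translate (s t) F) ?G) - average V (\<lambda>_. inner F ?G)"
    unfolding average_const[OF V] A[symmetric] by (simp add: power2_norm_eq_inner inner_diff_left)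
  also have "\<dots> = average V (\<lambda>t. inner (slice_translate (s t) F - F) ?G)"
  proof -
    have "integrable m (\<lambda>t. indicator V t * inner F ?G)"
      using V by (intro integrable_average[where C = "\<bar>inner F ?G\<bar>"]) auto
    then show ?thesis
      using int by (simp add: average_def inner_diff_left[of _ F] right_diff_distrib diff_divide_distrib)
  qed
  also have "\<dots> \<le> e * norm ?G"
  proof (rule abs_le_D1, rule abs_average_le[OF V])
    fix t assume "t \<in> V"
    then show "\<bar>inner (slice_translate (s t) F - F) ?G\<bar> \<le> e * norm ?G"
      using Cauchy_Schwarz_ineq2[of "slice_translate (s t) F - F" ?G]
        mult_right_mono[OF near, of t "norm ?G"] by simp
  qed
  finally show ?thesis
    using order_trans[OF norm_ge_zero near[of 0]] V by (cases "?G = 0") (auto simp: power2_eq_square small_nhd_def)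
qed

text \<open>The squared norm is an average over \<open>t\<close> of averages over \<open>s\<close>
  of the inner products of two translates of \<open>chi U\<close>. The translates of
  \<open>U\<close> by \<open>s\<close> and \<open>t\<close> meet only if - t + s lies in
  \<open>W\<close>, so by left invariance each inner average is at most |W| / |V|.\<close>

lemma averaging_operator_chi:
  assumes V: "small_nhd V" and A: "\<And>F G. inner (A F) G = average V (\<lambda>t. inner (slice_translate t F) G)"
    and U: "small_nhd U" and W: "W \<in> sets m" "emeasure m W < top" "\<And>x y. x \<in> U \<Longrightarrow> y \<in> U \<Longrightarrow> x + - y \<in> W"
  shows "(norm (A (chi U)))\<^sup>2 \<le> measure m W / measure m V"
proof -
  let ?h = "normalized_indicator U"
  have hL2: "?h \<in> L2 m" by (rule normalized_indicator_L2[OF U])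
  have st: "slice_translate t (chi U) = embed m 0 (left_regular t ?h)" for t
    by (rule lift_op_embed[OF bounded_op_left_regular hL2])
  have pair: "\<bar>inner (slice_translate s (chi U)) (slice_translate t (chi U))\<bar> \<le> indicator W (- t + s)" for s t
  proof (cases "- t + s \<in> W")
    case True
    have "\<bar>inner (slice_translate s (chi U)) (slice_translate t (chi U))\<bar> \<le> norm (chi U) * norm (chi U)"
      using Cauchy_Schwarz_ineq2 norm_slice_translate by (meson mult_mono norm_ge_zero order_trans)
    then show ?thesis using True by (simp add: norm_chi[OF U])
  next
    case False
    have z: "left_regular s ?h y * cnj (left_regular t ?h y) = 0" for y
    proof (rule ccontr)
      assume "left_regular s ?h y * cnj (left_regular t ?h y) \<noteq> 0"
      then have "- s + y \<in> U" "- t + y \<in> U"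
        by (auto simp: left_regular_def normalized_indicator_def indicator_def split: if_splits)
      then have "(- t + y) + - (- s + y) \<in> W" by (intro W)
      moreover have "(- t + y) + - (- s + y) = - t + s"
        by (simp add: minus_add add.assoc del: add_uminus_conv_diff)
      ultimately have "- t + s \<in> W" by (simp only:)
      then show False using False by simp
    qed
    have "L2_inner m (left_regular s ?h) (left_regular t ?h) = 0"
      unfolding L2_inner_def z by simp
    then show ?thesis using False hL2 by (simp add: st inner_embed_embed)
  qed
  have first: "\<bar>inner (A (chi U)) (slice_translate t (chi U))\<bar> \<le> measure m W / measure m V" for t
  proof -
    have "\<bar>\<integral>s. indicator V s * inner (slice_translate s (chi U)) (slice_translate t (chi U)) \<partial>m\<bar>
        \<le> (\<integral>s. \<bar>indicator V s * inner (slice_translate s (chi U)) (slice_translate t (chi U))\<bar> \<partial>m)"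
      by (rule integral_abs_bound)
    also have "\<dots> \<le> (\<integral>s. indicator W (- t + s) \<partial>m)"
    proof (rule integral_mono')
      show "integrable m (\<lambda>s. indicator W (- t + s) :: real)"
        using W by (subst integrable_left_translate) auto
      show "\<bar>indicator V s * inner (slice_translate s (chi U)) (slice_translate t (chi U))\<bar> \<le> indicator W (- t + s)" for s
        using pair[of s t] by (auto split: split_indicator)
    qed simp
    also have "\<dots> = measure m W" using W(1) by (subst integral_left_translate) auto
    finally show ?thesis
      using measure_small_nhd_pos[OF V] unfolding A average_def abs_divide by (simp add: divide_right_mono)
  qed
  have "(norm (A (chi U)))\<^sup>2 = average V (\<lambda>t. inner (slice_translate t (chi U)) (A (chi U)))"
    by (simp only: power2_norm_eq_inner A)
  also have "\<dots> \<le> measure m W / measure m V"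
    by (rule abs_le_D1, rule abs_average_le[OF V]) (use first in \<open>simp add: inner_commute\<close>)
  finally show ?thesis .
qed

lemma difference_nhd:
  assumes "open W" "(0::'a) \<in> W"
  obtains U where "open U" "0 \<in> U" "\<And>x y. x \<in> U \<Longrightarrow> y \<in> U \<Longrightarrow> x + - y \<in> W"
proof -
  have "open ((\<lambda>p::'a \<times> 'a. fst p + - snd p) -` W)"
    by (intro open_vimage assms continuous_intros)
  moreover have "(0, 0) \<in> (\<lambda>p::'a \<times> 'a. fst p + - snd p) -` W" using assms by simp
  ultimately obtain A B where "open A" "open B" "(0,0) \<in> A \<times> B" "A \<times> B \<subseteq> (\<lambda>p::'a \<times> 'a. fst p + - snd p) -` W"
    by (rule open_prod_elim)
  then show thesis by (intro that[of "A \<inter> B"]) auto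
qed


section \<open>Construction of the orthogonal sequence\<close>

definition negligible_projection :: "('a hsum \<Rightarrow> 'a hsum) \<Rightarrow> bool" where
  "negligible_projection Q \<longleftrightarrow> commutes_left_commutant Q \<and> self_adjoint Q \<and> (\<forall>F. Q (Q F) = Q F) \<and>
     (\<forall>F. slice0 (Q F) = Q F) \<and> negligible Q"

lemma negligible_projectionD:
  assumes "negligible_projection Q"
  shows "commutes_left_commutant Q" "self_adjoint Q" "Q (Q F) = Q F" "slice0 (Q F) = Q F" "negligible Q"
  using assms unfolding negligible_projection_def by blast+

lemma negligibleD:
  assumes "negligible Q" "0 < e"
  obtains W where "open W" "0 \<in> W" "\<And>U. small_nhd U \<Longrightarrow> U \<subseteq> W \<Longrightarrow> norm (Q (chi U)) < e"
proof -
  have "\<exists>W. open W \<and> 0 \<in> W \<and> (\<forall>U. small_nhd U \<and> U \<subseteq> W \<longrightarrow> norm (Q (chi U)) < e)"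
    using assms unfolding negligible_def by simp
  then obtain W where W: "open W \<and> 0 \<in> W \<and> (\<forall>U. small_nhd U \<and> U \<subseteq> W \<longrightarrow> norm (Q (chi U)) < e)" ..
  show thesis by (rule that[of W]) (use W in simp_all)
qed

lemma norm_projection_le:
  assumes "self_adjoint Q" "\<And>F. Q (Q F) = Q F" shows "norm (Q F) \<le> norm F"
proof -
  have "(norm (Q F))\<^sup>2 = inner F (Q F)"
    using assms by (simp add: power2_norm_eq_inner self_adjoint_def)
  also have "\<dots> \<le> norm F * norm (Q F)" by (rule norm_cauchy_schwarz)
  finally show ?thesis by (cases "Q F = 0") (auto simp: power2_eq_square)
qed

lemma norm_complement_le:
  fixes F :: "'b::real_inner"
  assumes "self_adjoint Q" "\<And>F. Q (Q F) = Q F" shows "norm (F - Q F) \<le> norm F"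
proof -
  have "inner (F - Q F) (Q F) = 0"
    using assms by (simp add: inner_diff self_adjoint_def)
  then have "(norm (F - Q F))\<^sup>2 = inner F (F - Q F)"
    by (simp add: power2_norm_eq_inner inner_diff inner_commute)
  also have "\<dots> \<le> norm F * norm (F - Q F)" by (rule norm_cauchy_schwarz)
  finally show ?thesis by (cases "F - Q F = 0") (auto simp: power2_eq_square)
qed

lemma negligible_projection_zero: "negligible_projection (\<lambda>_. 0)"
proof -
  have "lift_op m 0 T 0 = 0" if "T \<in> left_commutant" for T
    using linear_simps(3)[OF bounded_linear_lift_op[OF left_commutantD(1)[OF that]]] .
  then have "commutes_left_commutant (\<lambda>_. 0)"
    unfolding commutes_left_commutant_def by (intro conjI ballI allI bounded_linear_zero) simp
  moreover have "negligible (\<lambda>_. 0)"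
    unfolding negligible_def by (intro allI impI exI[of _ UNIV]) simp
  moreover have "slice0 0 = 0" by (rule linear_simps(3)[OF bounded_linear_slice0])
  ultimately show ?thesis
    by (simp add: negligible_projection_def self_adjoint_def)
qed

text \<open>Formulated as domination, so that it also yields multiples such as 2 A and the
  comparison of a spectral projection with \<open>A\<close> and \<open>Q\<close>.\<close>

lemma negligible_add:
  assumes "negligible P" "negligible Q" "\<And>F. norm (R F) \<le> norm (P F) + norm (Q F)"
  shows "negligible R"
  unfolding negligible_def
proof (intro allI impI)
  fix e :: real assume "0 < e"
  then have e: "0 < e / 2" by simp
  obtain W1 where W1: "open W1" "0 \<in> W1" "\<And>U. small_nhd U \<Longrightarrow> U \<subseteq> W1 \<Longrightarrow> norm (P (chi U)) < e / 2"
    using negligibleD[OF assms(1) e] by metis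
  obtain W2 where W2: "open W2" "0 \<in> W2" "\<And>U. small_nhd U \<Longrightarrow> U \<subseteq> W2 \<Longrightarrow> norm (Q (chi U)) < e / 2"
    using negligibleD[OF assms(2) e] by metis
  have "norm (R (chi U)) < e" if "small_nhd U" "U \<subseteq> W1 \<inter> W2" for U
    using assms(3)[of "chi U"] W1(3)[of U] W2(3)[of U] that by simp
  then show "\<exists>W. open W \<and> 0 \<in> W \<and> (\<forall>U. small_nhd U \<and> U \<subseteq> W \<longrightarrow> norm (R (chi U)) < e)"
    using W1 W2 by (intro exI[of _ "W1 \<inter> W2"]) auto
qed

lemma negligible_projection_add:
  assumes P: "negligible_projection P" and Q: "negligible_projection Q" and PQ: "\<And>F. P (Q F) = 0"
  shows "negligible_projection (\<lambda>F. Q F + P F)"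
proof -
  have QP: "Q (P F) = 0" for F
  proof -
    have "inner (Q (P F)) (Q (P F)) = inner F (P (Q (Q (P F))))"
      using negligible_projectionD(2)[OF P] negligible_projectionD(2)[OF Q] by (simp add: self_adjoint_def)
    then show ?thesis by (simp add: PQ)
  qed
  have bl: "bounded_linear P" "bounded_linear Q"
    using negligible_projectionD(1)[OF P] negligible_projectionD(1)[OF Q]
    by (simp_all add: commutes_left_commutant_def)
  have "commutes_left_commutant (\<lambda>F. Q F + P F)"
    unfolding commutes_left_commutant_def
  proof (intro conjI ballI allI)
    show "bounded_linear (\<lambda>F. Q F + P F)" by (intro bounded_linear_add bl)
    fix T F assume T: "T \<in> left_commutant"
    have "Q (lift_op m 0 T F) = lift_op m 0 T (Q F)" "P (lift_op m 0 T F) = lift_op m 0 T (P F)"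
      using negligible_projectionD(1)[OF P] negligible_projectionD(1)[OF Q] T
      by (simp_all add: commutes_left_commutant_def)
    then show "Q (lift_op m 0 T F) + P (lift_op m 0 T F) = lift_op m 0 T (Q F + P F)"
      by (simp add: linear_simps(1)[OF bounded_linear_lift_op[OF left_commutantD(1)[OF T]]])
  qed
  moreover have "negligible (\<lambda>F. Q F + P F)"
    by (rule negligible_add[OF negligible_projectionD(5)[OF Q] negligible_projectionD(5)[OF P] norm_triangle_ineq])
  moreover have "self_adjoint (\<lambda>F. Q F + P F)"
    using negligible_projectionD(2)[OF P] negligible_projectionD(2)[OF Q]
    by (simp add: self_adjoint_def inner_add)
  ultimately show ?thesis
    unfolding negligible_projection_def
    by (simp add: linear_simps(1)[OF bl(1)] linear_simps(1)[OF bl(2)] linear_simps(1)[OF bounded_linear_slice0]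
        PQ QP negligible_projectionD(3,4)[OF P] negligible_projectionD(3,4)[OF Q])
qed

text \<open>Non-discreteness enters here: with \<open>V\<close> fixed there are neighbourhoods
  \<open>W\<close> of measure below e^2 |V|, and the differences of a small enough \<open>U\<close>
  stay in \<open>W\<close>.\<close>

lemma negligible_average:
  assumes lc: "locally_compact_space (euclidean :: 'a topology)" and nd: "\<not> open {0 :: 'a}"
    and V: "small_nhd V" and A: "\<And>F G. inner (A F) G = average V (\<lambda>t. inner (slice_translate t F) G)"
  shows "negligible A"
  unfolding negligible_def
proof (intro allI impI)
  fix e :: real assume "0 < e"
  have mV: "0 < measure m V" by (rule measure_small_nhd_pos[OF V])
  then have "0 < e\<^sup>2 * measure m V" using \<open>0 < e\<close> by simp
  then obtain W where W: "open W" "0 \<in> W" "emeasure m W < top" "measure m W < e\<^sup>2 * measure m V"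
    using small_nhds_of_nondiscrete[OF lc nd] by metis
  obtain U0 where U0: "open U0" "0 \<in> U0" "\<And>x y. x \<in> U0 \<Longrightarrow> y \<in> U0 \<Longrightarrow> x + - y \<in> W"
    using difference_nhd[OF W(1,2)] by blast
  have "norm (A (chi U)) < e" if U: "small_nhd U" "U \<subseteq> U0" for U
  proof -
    have "(norm (A (chi U)))\<^sup>2 \<le> measure m W / measure m V"
      using U U0 W by (intro averaging_operator_chi[OF V A U(1)]) auto
    also have "\<dots> < e\<^sup>2" using W(4) mV by (simp add: pos_divide_less_eq)
    finally show ?thesis using \<open>0 < e\<close> by (simp add: power2_less_imp_less)
  qed
  then show "\<exists>W. open W \<and> 0 \<in> W \<and> (\<forall>U. small_nhd U \<and> U \<subseteq> W \<longrightarrow> norm (A (chi U)) < e)"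
    using U0 by blast
qed

text \<open>
  The step of the construction: cut a concentrated function down by \<open>1 - Q\<close> to \<open>h'\<close>, average
  translations over a neighbourhood under which \<open>h'\<close> is almost invariant, compress the average
  by \<open>1 - Q\<close>, and take the spectral projection for the interval from 1/2.
\<close>

lemma next_projection:
  assumes lc: "locally_compact_space (euclidean :: 'a topology)" and nd: "\<not> open {0 :: 'a}"
    and Q: "negligible_projection Q" and W: "open W" "0 \<in> W" and "0 < e"
  obtains P h U where "negligible_projection P" "\<And>F. P (Q F) = 0" "h \<in> L2 m" "L2_nrm m h = 1"
    "P (embed m 0 h) = embed m 0 h" "small_nhd U" "U \<subseteq> W" "norm (embed m 0 h - chi U) \<le> e"
proof -
  \<comment> \<open>P h' will be within 1 + 4 units of \<epsilon> of \<open>chi U\<close>, and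
    normalising costs at most 5 more, hence 10; the bound 1/10 keeps |1 - n| at most 1/2, so that
    \<open>n\<close> is positive.\<close>
  define \<epsilon> where "\<epsilon> = min (e / 10) (1 / 10)"
  have \<epsilon>: "0 < \<epsilon>" "10 * \<epsilon> \<le> e" "10 * \<epsilon> \<le> 1" using \<open>0 < e\<close> by (auto simp: \<epsilon>_def min_def)
  have Qc: "commutes_left_commutant Q" and Qsa: "self_adjoint Q" and Qi: "\<And>F. Q (Q F) = Q F"
    and Qs: "\<And>F. slice0 (Q F) = Q F" and Qn: "negligible Q"
    by (fact negligible_projectionD[OF Q])+
  have Qbl: "bounded_linear Q" using Qc by (simp add: commutes_left_commutant_def)
  interpret Q: bounded_linear Q by (rule Qbl)
  obtain W1 where W1: "open W1" "0 \<in> W1" "\<And>U. small_nhd U \<Longrightarrow> U \<subseteq> W1 \<Longrightarrow> norm (Q (chi U)) < \<epsilon>"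
    using negligibleD[OF Qn \<epsilon>(1)] by metis
  obtain W2 :: "'a set" where W2: "open W2" "0 \<in> W2" "emeasure m W2 < top"
    using small_nhds_of_nondiscrete[OF lc nd zero_less_one] by blast
  define U where "U = W1 \<inter> W2 \<inter> W"
  have U: "small_nhd U" "U \<subseteq> W" "U \<subseteq> W1"
    using W W1 W2 le_less_trans[OF emeasure_mono[of U W2 m]] by (auto simp: small_nhd_def U_def)
  define R where "R F = F - Q F" for F
  have Rbl: "bounded_linear R"
    unfolding R_def[abs_def] by (intro bounded_linear_sub bounded_linear_ident Qbl)
  interpret R: bounded_linear R by (rule Rbl)
  have Rsa: "inner (R F) G = inner F (R G)" for F G
    using Qsa by (simp add: R_def inner_diff self_adjoint_def)
  have RR: "R (R F) = R F" for F by (simp add: R_def Q.diff Qi)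
  have RQ: "R (Q F) = 0" for F by (simp add: R_def Qi)
  have R_le: "norm (R F) \<le> norm F" for F unfolding R_def by (rule norm_complement_le[OF Qsa Qi])
  have R_slice: "slice0 (R F) = R (slice0 F)" for F
    by (simp add: R_def linear_simps(2)[OF bounded_linear_slice0] commutes_slice0[OF Qc])
  define h' where "h' = R (chi U)"
  have h'_near: "norm (h' - chi U) \<le> \<epsilon>"
    using W1(3)[OF U(1,3)] by (simp add: h'_def R_def)
  have h'_slice: "slice0 h' = h'"
    by (simp add: h'_def R_slice normalized_indicator_L2[OF U(1)])
  have Rh': "R h' = h'" by (simp add: h'_def RR)
  have "((\<lambda>t. slice_translate t h') \<longlongrightarrow> h') (nhds 0)"
    using translation_tendsto[OF restr_L2[of m 0 h']] h'_slice by (simp add: slice_translate_eq embed_restr)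
  then have "\<forall>\<^sub>F t in nhds 0. dist (slice_translate t h') h' < \<epsilon>" using \<epsilon>(1) by (rule tendstoD)
  then obtain V1 where V1: "open V1" "0 \<in> V1" "\<And>t. t \<in> V1 \<Longrightarrow> dist (slice_translate t h') h' < \<epsilon>"
    by (auto simp: eventually_nhds)
  define V where "V = V1 \<inter> W2"
  have V: "small_nhd V"
    using V1 W2 le_less_trans[OF emeasure_mono[of V W2 m]] by (auto simp: small_nhd_def V_def)
  have near: "norm (slice_translate t h' - h') \<le> \<epsilon>" if "t \<in> V" for t
    using V1(3)[of t] that by (simp add: V_def dist_norm)
  have near': "norm (slice_translate (- t) h' - h') \<le> \<epsilon>" if "t \<in> V" for t
  proof -
    have "slice_translate (- t) h' - h' = slice_translate (- t) (h' - slice_translate t h')"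
      by (simp add: linear_simps(2)[OF bounded_linear_slice_translate] slice_translate_slice_translate
          slice_translate_zero h'_slice)
    then show ?thesis
      using norm_slice_translate[of "- t" "h' - slice_translate t h'"] near[OF that] by (simp add: norm_minus_commute)
  qed
  obtain A where Ac: "commutes_left_commutant A"
    and A: "\<And>F G. inner (A F) G = average V (\<lambda>t. inner (slice_translate t F) G)" and A_le: "\<And>F. norm (A F) \<le> norm F"
    using averaging_operator_exists[OF V, of "\<lambda>t. t"] by (auto intro: continuous_on_id)
  obtain A' where A'c: "commutes_left_commutant A'"
    and A': "\<And>F G. inner (A' F) G = average V (\<lambda>t. inner (slice_translate (- t) F) G)" and A'_le: "\<And>F. norm (A' F) \<le> norm F"
    by (rule averaging_operator_exists[OF V, of uminus]) (intro continuous_intros, rule that)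
  have adj: "inner (A' F) G = inner F (A G)" for F G
  proof -
    have "inner (slice_translate (- t) F) G = inner (slice_translate t G) F" for t
      using inner_slice_translate[of "- t" F G] by (simp only: minus_minus inner_commute[of _ F])
    then have "inner (A' F) G = inner (A G) F" by (simp only: A A')
    then show ?thesis by (simp add: inner_commute)
  qed
  have Abl: "bounded_linear A" and A'bl: "bounded_linear A'"
    using Ac A'c by (auto simp: commutes_left_commutant_def)
  interpret A: bounded_linear A by (rule Abl)
  interpret A': bounded_linear A' by (rule A'bl)
  have int: "integrable m (\<lambda>t. indicator V t * inner (slice_translate (s t) F) G)"
    if "continuous_on UNIV s" for s :: "'a \<Rightarrow> 'a" and F G
  proof (rule integrable_average[OF V])
    show "continuous_on UNIV (\<lambda>t. inner (slice_translate (s t) F) G)"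
      by (intro continuous_intros continuous_on_compose2[OF continuous_slice_translate that]) simp
    show "\<bar>inner (slice_translate (s t) F) G\<bar> \<le> norm F * norm G" for t
      using Cauchy_Schwarz_ineq2[of "slice_translate (s t) F" G]
        mult_right_mono[OF norm_slice_translate[of "s t" F], of "norm G"] by simp
  qed
  have A_near: "norm (A h' - h') \<le> \<epsilon>"
    by (rule averaging_operator_near[OF V A near int[OF continuous_on_id]])
  have A'_near: "norm (A' h' - h') \<le> \<epsilon>"
    by (rule averaging_operator_near[where s = uminus, OF V A' near' int]) (auto intro: continuous_intros)
  have A_slice: "A (slice0 F) = A F" for F
    by (rule vector_eq_rdot[THEN iffD1]) (simp add: A slice_translate_slice0)
  \<comment> \<open>The compressed average. It annihilates the range of \<open>Q\<close>, so its
    spectral projection will be orthogonal to \<open>Q\<close>, and it nearly fixes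
    \<open>h'\<close>.\<close>
  define B where "B F = R (A' (A (R F)))" for F
  have Bbl: "bounded_linear B"
    unfolding B_def[abs_def]
    by (intro bounded_linear_compose[OF Rbl] bounded_linear_compose[OF A'bl] bounded_linear_compose[OF Abl] Rbl)
  interpret B: bounded_linear B by (rule Bbl)
  have Bsa: "inner (B F) G = inner F (B G)" for F G
    by (simp add: B_def Rsa adj) (metis adj inner_commute Rsa)
  have blB: "blinfun_apply (Blinfun B) = B" by (rule bounded_linear_Blinfun_apply[OF Bbl])
  obtain P where Pbl: "bounded_linear P" and Psa: "self_adjoint P" and Pi: "\<And>x. P (P x) = P x"
    and low: "\<And>x. 1/2 * (norm (P x))\<^sup>2 \<le> inner (B (P x)) (P x)"
    and up: "\<And>x. inner (B (x - P x)) (x - P x) \<le> 1/2 * (norm (x - P x))\<^sup>2"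
    and Pcomm: "\<And>y x. bounded_linear y \<Longrightarrow> (\<And>x. y (B x) = B (y x)) \<Longrightarrow> y (P x) = P (y x)"
  proof (rule spectral_projection_exists[of "Blinfun B" "1/2"], unfold blB)
    show "self_adjoint B" using Bsa by (simp add: self_adjoint_def)
    fix p
    assume p: "bounded_linear p" "self_adjoint p" "\<And>x. p (p x) = p x"
      "\<And>x. 1/2 * (norm (p x))\<^sup>2 \<le> inner (B (p x)) (p x)"
      "\<And>x. inner (B (x - p x)) (x - p x) \<le> 1/2 * (norm (x - p x))\<^sup>2"
      and comm: "\<And>y x. bounded_linear y \<Longrightarrow> (\<And>x. y (B x) = B (y x)) \<Longrightarrow> y (p x) = p (y x)"
    show thesis by (rule that[OF p comm])
  qed
  interpret P: bounded_linear P by (rule Pbl)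
  have PB: "B (P x) = P (B x)" for x by (rule Pcomm[OF Bbl]) simp
  \<comment> \<open>\<open>P\<close> commutes with \<open>B\<close>, and on its range the form of
    \<open>B\<close> is at least 1/2; so whatever \<open>B\<close> annihilates or makes small,
    \<open>P\<close> does too, up to the factor 2.\<close>
  have P_bound: "norm (P x) \<le> 2 * norm (B x)" for x
  proof -
    have "1/2 * (norm (P x))\<^sup>2 \<le> norm (P (B x)) * norm (P x)"
      using low[of x] norm_cauchy_schwarz[of "B (P x)" "P x"] unfolding PB by linarith
    also have "\<dots> \<le> norm (B x) * norm (P x)"
      by (intro mult_right_mono norm_projection_le Psa Pi) simp
    finally show ?thesis by (cases "P x = 0") (auto simp: power2_eq_square)
  qed
  have P_zero: "P x = 0" if "B x = 0" for x using P_bound[of x] that by simp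
  have PQ: "P (Q F) = 0" for F
    by (rule P_zero) (simp add: B_def RQ R.zero A.zero A'.zero)
  have lift_comm: "lift_op m 0 T (P F) = P (lift_op m 0 T F)" if T: "T \<in> left_commutant" for T F
  proof (rule Pcomm)
    show "bounded_linear (lift_op m 0 T)" by (rule bounded_linear_lift_op[OF left_commutantD(1)[OF T]])
    then show "lift_op m 0 T (B x) = B (lift_op m 0 T x)" for x
      using Qc Ac A'c T unfolding commutes_left_commutant_def B_def R_def by (simp add: linear_simps(2))
  qed
  have Pc: "commutes_left_commutant P" using Pbl lift_comm by (simp add: commutes_left_commutant_def)
  have Ps: "slice0 (P F) = P F" for F
  proof -
    have "P (F - slice0 F) = 0"
      by (rule P_zero) (simp add: B_def R.diff A.diff A_slice R_slice[symmetric] A'.zero R.zero)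
    then have "P F = P (slice0 F)" by (simp add: P.diff)
    then show ?thesis using commutes_slice0[OF Pc, of F] by simp
  qed
  have "negligible P"
  proof (rule negligible_add)
    show "negligible (\<lambda>F. (2::real) *\<^sub>R A F)"
      by (rule negligible_add[OF negligible_average[OF lc nd V A] negligible_average[OF lc nd V A]]) simp
    show "negligible (\<lambda>F. (2::real) *\<^sub>R Q F)"
      by (rule negligible_add[OF Qn Qn]) simp
    fix F
    have "norm (P F) \<le> 2 * norm (B F)" by (rule P_bound)
    also have "norm (B F) \<le> norm (A (R F))"
      unfolding B_def by (intro order_trans[OF R_le] A'_le)
    also have "A (R F) = A F - A (Q F)" by (simp add: R_def A.diff)
    also have "norm (A F - A (Q F)) \<le> norm (A F) + norm (A (Q F))" by (rule norm_triangle_ineq4)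
    also have "norm (A (Q F)) \<le> norm (Q F)" by (rule A_le)
    finally show "norm (P F) \<le> norm ((2::real) *\<^sub>R A F) + norm ((2::real) *\<^sub>R Q F)" by simp
  qed
  then have Pn: "negligible_projection P"
    using Pc Psa Pi Ps by (simp add: negligible_projection_def)
  have B_near: "norm (h' - B h') \<le> 2 * \<epsilon>"
  proof -
    have "h' - B h' = R (h' - A' (A h'))" by (simp add: B_def Rh' R.diff)
    then have "norm (h' - B h') \<le> norm (h' - A' (A h'))" using R_le by simp
    also have "h' - A' (A h') = (h' - A' h') + A' (h' - A h')" by (simp add: A'.diff)
    also have "norm \<dots> \<le> norm (h' - A' h') + norm (h' - A h')"
      by (intro order_trans[OF norm_triangle_ineq] add_left_mono A'_le)
    also have "\<dots> \<le> 2 * \<epsilon>" using A_near A'_near by (simp add: norm_minus_commute)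
    finally show ?thesis .
  qed
  \<comment> \<open>The other half of the spectral projection: on the range of 1 - P the form of
    \<open>B\<close> is at most 1/2, so the residual z satisfies |z|^2 / 2 <= <z - B z, z>, which is
    at most |h' - B h'| |z|.\<close>
  have P_near: "norm (h' - P h') \<le> 4 * \<epsilon>"
  proof -
    let ?z = "h' - P h'"
    have Pz: "P ?z = 0" by (simp add: P.diff Pi)
    have "1/2 * (norm ?z)\<^sup>2 \<le> inner (?z - B ?z) ?z"
      using up[of h'] by (simp add: inner_diff_left power2_norm_eq_inner)
    also have "\<dots> = inner (h' - B h') ?z"
    proof -
      have "?z - B ?z = (h' - B h') - P (h' - B h')" by (simp add: B.diff P.diff PB)
      moreover have "inner (P (h' - B h')) ?z = 0" using Psa Pz by (simp add: self_adjoint_def)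
      ultimately show ?thesis
        by (simp only: inner_diff_left[of "h' - B h'" "P (h' - B h')"] diff_zero)
    qed
    also have "\<dots> \<le> norm (h' - B h') * norm ?z" by (rule norm_cauchy_schwarz)
    finally have "norm ?z \<le> 2 * norm (h' - B h')" by (cases "?z = 0") (auto simp: power2_eq_square)
    then show ?thesis using B_near by simp
  qed
  have dist: "norm (P h' - chi U) \<le> 5 * \<epsilon>"
    using norm_triangle_ineq[of "P h' - h'" "h' - chi U"] P_near h'_near by (simp add: norm_minus_commute)
  define n where "n = norm (P h')"
  have n: "\<bar>1 - n\<bar> \<le> 5 * \<epsilon>"
    using norm_triangle_ineq3[of "P h'" "chi U"] dist norm_chi[OF U(1)] by (simp add: n_def abs_minus_commute)
  have n_pos: "0 < n" using n \<epsilon> by linarith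
  define h where "h = (\<lambda>x. of_real (1 / n) * restr m 0 (P h') x)"
  have eh: "embed m 0 h = (1 / n) *\<^sub>R P h'"
    unfolding h_def by (simp only: embed_scaleR[OF restr_L2] embed_restr Ps)
  have hL2: "h \<in> L2 m" unfolding h_def by (intro L2_cmult restr_L2)
  have nh: "norm (embed m 0 h) = 1" using n_pos by (simp add: eh n_def)
  show thesis
  proof (rule that[OF Pn PQ hL2 _ _ U(1,2)])
    show "L2_nrm m h = 1" using nh hL2 by (simp add: norm_embed)
    show "P (embed m 0 h) = embed m 0 h" by (simp add: eh P.scaleR Pi)
    have "norm (embed m 0 h - P h') = \<bar>1 - n\<bar>"
    proof -
      have "P h' = n *\<^sub>R embed m 0 h" using n_pos by (simp add: eh)
      then have "embed m 0 h - P h' = (1 - n) *\<^sub>R embed m 0 h" by (simp add: scaleR_diff_left)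
      then show ?thesis using nh by simp
    qed
    then show "norm (embed m 0 h - chi U) \<le> e"
      using norm_triangle_ineq[of "embed m 0 h - P h'" "P h' - chi U"] n dist \<epsilon> by simp
  qed
qed

text \<open>The recursion carries only \<open>S n\<close>, the sum of the first \<open>n\<close>
  projections, which stays negligible. Each new \<open>P n\<close> annihilates the range of
  \<open>S n\<close>; pairwise orthogonality is derived from this afterwards.\<close>

lemma orthogonal_concentrated_sequence:
  assumes lc: "locally_compact_space (euclidean :: 'a topology)" and nd: "\<not> open {0 :: 'a}"
    and W: "\<And>n. open (W n)" "\<And>n. (0::'a) \<in> W n"
  obtains P h U where "\<And>n. negligible_projection (P n)" "\<And>i j F. i \<noteq> j \<Longrightarrow> P i (P j F) = 0"
    "\<And>n. h n \<in> L2 m" "\<And>n. L2_nrm m (h n) = 1" "\<And>n. P n (embed m 0 (h n)) = embed m 0 (h n)"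
    "\<And>n. small_nhd (U n)" "\<And>n. U n \<subseteq> W n" "\<And>n. norm (embed m 0 (h n) - chi (U n)) \<le> 1 / Suc n"
proof -
  define good where "good n Q z \<longleftrightarrow> (case z of (P, h, U) \<Rightarrow> negligible_projection P \<and> (\<forall>F. P (Q F) = 0) \<and>
    h \<in> L2 m \<and> L2_nrm m h = 1 \<and> P (embed m 0 h) = embed m 0 h \<and> small_nhd U \<and> U \<subseteq> W n \<and>
    norm (embed m 0 h - chi U) \<le> 1 / Suc n)" for n :: nat and Q :: "'a hsum \<Rightarrow> 'a hsum" and z
  have "\<exists>z. good n Q z" if Q: "negligible_projection Q" for n Q
  proof -
    have "0 < 1 / real (Suc n)" by simp
    from next_projection[OF lc nd Q W[of n] this]
    obtain P h U where "negligible_projection P" "\<And>F. P (Q F) = 0" "h \<in> L2 m" "L2_nrm m h = 1"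
      "P (embed m 0 h) = embed m 0 h" "small_nhd U" "U \<subseteq> W n" "norm (embed m 0 h - chi U) \<le> 1 / Suc n"
      by metis
    then have "good n Q (P, h, U)" by (simp add: good_def del: of_nat_Suc)
    then show ?thesis ..
  qed
  then have z: "good n Q (SOME z. good n Q z)" if "negligible_projection Q" for n Q
    using that by (blast intro: someI_ex)
  define z where "z n Q = (SOME z. good n Q z)" for n Q
  note z = z[folded z_def]
  define S where "S = rec_nat (\<lambda>_. 0) (\<lambda>n Q F. Q F + fst (z n Q) F)"
  have S_Suc: "S (Suc n) = (\<lambda>F. S n F + fst (z n (S n)) F)" for n by (simp add: S_def)
  have S: "negligible_projection (S n)" for n
  proof (induction n)
    case 0
    then show ?case using negligible_projection_zero by (simp add: S_def)
  next
    case (Suc n)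
    from z[OF Suc, of n] show ?case
      unfolding S_Suc good_def by (intro negligible_projection_add Suc) (auto split: prod.splits)
  qed
  define P where "P n = fst (z n (S n))" for n
  define h where "h n = fst (snd (z n (S n)))" for n
  define U where "U n = snd (snd (z n (S n)))" for n
  have all: "negligible_projection (P n) \<and> (\<forall>F. P n (S n F) = 0) \<and>
    h n \<in> L2 m \<and> L2_nrm m (h n) = 1 \<and> P n (embed m 0 (h n)) = embed m 0 (h n) \<and> small_nhd (U n) \<and> U n \<subseteq> W n \<and>
    norm (embed m 0 (h n) - chi (U n)) \<le> 1 / Suc n" for n
    using z[OF S, of n n] by (simp add: good_def P_def h_def U_def case_prod_beta del: of_nat_Suc)
  have S_step: "S (Suc n) F = S n F + P n F" for n F by (simp add: S_Suc P_def)
  have Pi: "P i (P i F) = P i F" and Psa: "inner (P i F) G = inner F (P i G)" for i F G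
    using negligible_projectionD(2,3)[of "P i"] all by (auto simp: self_adjoint_def)
  \<comment> \<open>Every later sum absorbs \<open>P n\<close>; so for j > n the projection
    \<open>P j\<close>, which annihilates the range of \<open>S j\<close>, annihilates that of
    \<open>P n\<close>.\<close>
  have SP: "S (Suc n + k) (P n F) = P n F" for n k F
  proof (induction k)
    case 0
    have "inner (S n (P n F)) (S n (P n F)) = inner (P n F) (S n (S n (P n F)))"
      using negligible_projectionD(2)[OF S[of n]] by (simp add: self_adjoint_def)
    also have "\<dots> = inner F (P n (S n (S n (P n F))))" by (rule Psa)
    finally have "S n (P n F) = 0" using all by simp
    then show ?case by (simp add: S_step Pi)
  next
    case (Suc k)
    have "P (Suc n + k) (P n F) = P (Suc n + k) (S (Suc n + k) (P n F))" using Suc by simp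
    also have "\<dots> = 0" using all by blast
    finally show ?case using Suc by (simp add: S_step)
  qed
  have less: "P j (P i F) = 0" if "i < j" for i j F
  proof -
    obtain k where "j = Suc i + k" using less_imp_Suc_add[OF \<open>i < j\<close>] by auto
    then have "P j (P i F) = P j (S j (P i F))" using SP[of i k F] by simp
    then show ?thesis using all by simp
  qed
  have orth: "P i (P j F) = 0" if "i \<noteq> j" for i j F
  proof (cases "i < j")
    case True
    have "inner (P i (P j F)) (P i (P j F)) = inner F (P j (P i (P i (P j F))))" by (simp only: Psa)
    then show ?thesis using less[OF True] by (simp add: Pi)
  next
    case False
    then show ?thesis using less that by simp
  qed
  show thesis using all orth by (intro that[of P h U]) blast+
qed

text \<open>The integral is split at a neighbourhood whose translations move \<open>f\<close>
  little. Inside, the deviation is small against the unit mass of |h n|^2; outside, the indicator of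
  \<open>U n\<close> eventually vanishes, so the mass of |h n|^2 is at most the squared distance to
  \<open>chi (U n)\<close>.\<close>

lemma spread_tendsto_zero:
  assumes f: "f \<in> L2 m" and h: "\<And>n. h n \<in> L2 m" "\<And>n. L2_nrm m (h n) = 1"
    and U: "\<And>n. small_nhd (U n)" "\<And>O'. open O' \<Longrightarrow> 0 \<in> O' \<Longrightarrow> \<forall>\<^sub>F n in sequentially. U n \<subseteq> O'"
    and near: "\<And>n. norm (embed m 0 (h n) - chi (U n)) \<le> 1 / Suc n"
  shows "(\<lambda>n. spread f (h n)) \<longlonglongrightarrow> 0"
proof (rule LIMSEQ_I)
  fix e :: real assume "0 < e"
  let ?d = "\<lambda>t. norm (backshift f t - backshift f 0)"
  define C where "C = 2 * L2_nrm m f"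
  have dC: "?d t \<le> C" for t
    using norm_triangle_ineq4[of "backshift f t" "backshift f 0"] by (simp add: C_def norm_backshift f)
  have cont: "continuous_on UNIV ?d" by (intro continuous_intros continuous_backshift f)
  \<comment> \<open>The square of this threshold against unit mass contributes e / 2; the outer part
    takes the other half for large n.\<close>
  define O' where "O' = {t. ?d t < sqrt (e / 2)}"
  have O': "open O'" "0 \<in> O'"
    using open_Collect_less[OF cont continuous_on_const] \<open>0 < e\<close> by (simp_all add: O'_def)
  have out: "(\<integral>t. indicator (- O') t * (cmod (h n t))\<^sup>2 \<partial>m) \<le> (1 / Suc n)\<^sup>2" if "U n \<subseteq> O'" for n
  proof -
    have d: "(\<lambda>t. h n t - normalized_indicator (U n) t) \<in> L2 m"
      by (intro L2_diff h normalized_indicator_L2 U)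
    have "(\<integral>t. indicator (- O') t * (cmod (h n t))\<^sup>2 \<partial>m) \<le> (\<integral>t. (cmod (h n t - normalized_indicator (U n) t))\<^sup>2 \<partial>m)"
      using that by (intro integral_mono' L2_integrable[OF d])
        (auto simp: normalized_indicator_def split: split_indicator)
    also have "\<dots> = (norm (embed m 0 (h n) - chi (U n)))\<^sup>2"
      using d by (simp add: L2_nrm_power2[symmetric] norm_embed h normalized_indicator_L2 U flip: embed_diff)
    also have "\<dots> \<le> (1 / Suc n)\<^sup>2" by (intro power_mono near) simp
    finally show ?thesis .
  qed
  have bound: "spread f (h n) \<le> e / 2 + C\<^sup>2 * (1 / Suc n)\<^sup>2" if "U n \<subseteq> O'" for n
  proof -
    have hi: "integrable m (\<lambda>t. (cmod (h n t))\<^sup>2)" by (rule L2_integrable[OF h(1)])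
    have oi: "integrable m (\<lambda>t. indicator (- O') t * (cmod (h n t))\<^sup>2)"
      using integrable_mult_indicator[OF _ hi, of "- O'"] O'(1) by (simp add: borel_closed closed_Compl)
    have "spread f (h n) \<le> (\<integral>t. e / 2 * (cmod (h n t))\<^sup>2 + C\<^sup>2 * (indicator (- O') t * (cmod (h n t))\<^sup>2) \<partial>m)"
      unfolding spread_def
    proof (rule integral_mono')
      show "integrable m (\<lambda>t. e / 2 * (cmod (h n t))\<^sup>2 + C\<^sup>2 * (indicator (- O') t * (cmod (h n t))\<^sup>2))"
        using hi oi by (intro Bochner_Integration.integrable_add integrable_mult_right)
      fix t
      show "(cmod (h n t))\<^sup>2 * (?d t)\<^sup>2 \<le> e / 2 * (cmod (h n t))\<^sup>2 + C\<^sup>2 * (indicator (- O') t * (cmod (h n t))\<^sup>2)"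
      proof (cases "t \<in> O'")
        case True
        then have "(?d t)\<^sup>2 \<le> (sqrt (e / 2))\<^sup>2" by (intro power_mono) (auto simp: O'_def)
        then have "(cmod (h n t))\<^sup>2 * (?d t)\<^sup>2 \<le> (cmod (h n t))\<^sup>2 * (e / 2)"
          using \<open>0 < e\<close> by (intro mult_left_mono) auto
        then show ?thesis using True by (simp add: mult.commute)
      next
        case False
        have "(?d t)\<^sup>2 \<le> C\<^sup>2" by (intro power_mono dC) simp
        then have "(cmod (h n t))\<^sup>2 * (?d t)\<^sup>2 \<le> (cmod (h n t))\<^sup>2 * C\<^sup>2" by (intro mult_left_mono) auto
        moreover have "0 \<le> e / 2 * (cmod (h n t))\<^sup>2" using \<open>0 < e\<close> by simp
        ultimately show ?thesis using False by (simp add: mult.commute)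
      qed
      show "0 \<le> e / 2 * (cmod (h n t))\<^sup>2 + C\<^sup>2 * (indicator (- O') t * (cmod (h n t))\<^sup>2)"
        using \<open>0 < e\<close> by (intro add_nonneg_nonneg mult_nonneg_nonneg) auto
    qed
    also have "\<dots> = e / 2 * (L2_nrm m (h n))\<^sup>2 + C\<^sup>2 * (\<integral>t. indicator (- O') t * (cmod (h n t))\<^sup>2 \<partial>m)"
      using hi oi by (simp add: L2_nrm_power2)
    also have "\<dots> \<le> e / 2 + C\<^sup>2 * (1 / Suc n)\<^sup>2"
      using out[OF that] by (simp add: h mult_left_mono del: of_nat_Suc)
    finally show ?thesis .
  qed
  have "(\<lambda>n. C\<^sup>2 * (1 / real (Suc n))\<^sup>2) \<longlonglongrightarrow> C\<^sup>2 * 0\<^sup>2"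
    by (intro tendsto_intros LIMSEQ_Suc[OF lim_1_over_n])
  then have "\<forall>\<^sub>F n in sequentially. C\<^sup>2 * (1 / real (Suc n))\<^sup>2 < e / 2"
    by (rule order_tendstoD(2)) (use \<open>0 < e\<close> in simp)
  with U(2)[OF O'] have "\<forall>\<^sub>F n in sequentially. norm (spread f (h n) - 0) < e"
  proof eventually_elim
    case (elim n)
    then show ?case using bound[OF elim(1)] by simp
  qed
  then show "\<exists>no. \<forall>n\<ge>no. norm (spread f (h n) - 0) < e" by (simp add: eventually_sequentially)
qed

text \<open>The unit vector \<open>h\<close> shows that the supremum reaches 1; on a zero space it
  would be 0.\<close>

lemma op_nrm_id:
  assumes h: "h \<in> L2 m" "L2_nrm m h = 1" shows "op_nrm m (\<lambda>f. f) = 1"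
  unfolding op_nrm_def by (rule cSup_eq_maximum) (use h in force)+

text \<open>The supremum in the norm is attained at the identity operator, with value <h, h>;
  Cauchy-Schwarz bounds all other values.\<close>

lemma vector_state_normal_state:
  assumes h: "h \<in> L2 m" "L2_nrm m h = 1" shows "coeff_fun m h h \<in> normal_states m"
proof -
  have hh: "L2_inner m h h = 1" using h(2) by (simp add: L2_inner_self)
  have le: "cmod (duality m T (coeff_fun m h h)) \<le> 1" if "T \<in> VN m" "op_nrm m T = 1" for T
    using L2_inner_cauchy_schwarz[OF bounded_op_L2[OF VN_D(1)[OF that(1)] h(1)] h(1)]
      op_nrm_bound[OF VN_D(1)[OF that(1)] h(1)] that h by (simp add: duality_coeff_fun)
  have "Fourier_nrm m (coeff_fun m h h) = 1"
    unfolding Fourier_nrm_def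
    by (intro cSup_eq_maximum) (use le id_VN hh op_nrm_id[OF h] duality_coeff_fun[OF h(1) h(1) id_VN] in \<open>force+\<close>)
  moreover have "coeff_fun m h h 0 = 1" by (simp add: coeff_fun_def hh)
  ultimately show ?thesis using h by (auto simp: normal_states_def Fourier_algebra_def)
qed

text \<open>\<open>Fourier_nrm\<close> is a supremum of reals, so even its non-negativity needs
  boundedness and an element of the index set; the identity operator, of norm 1 thanks to
  \<open>h\<close>, is such an element.\<close>

lemma Fourier_nrm_product_minus_state:
  assumes f: "f \<in> L2 m" and g: "g \<in> L2 m" and fg: "L2_inner m f g = 1" and h: "h \<in> L2 m" and h1: "L2_nrm m h = 1"
  shows "0 \<le> Fourier_nrm m (\<lambda>x. coeff_fun m f g x * coeff_fun m h h x - coeff_fun m h h x)"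
    "Fourier_nrm m (\<lambda>x. coeff_fun m f g x * coeff_fun m h h x - coeff_fun m h h x)
      \<le> 2 * (sqrt (spread f h) * L2_nrm m g + L2_nrm m f * sqrt (spread g h))" (is "_ \<le> ?B")
proof -
  let ?w = "\<lambda>x. coeff_fun m f g x * coeff_fun m h h x - coeff_fun m h h x"
  obtain \<phi> where \<phi>: "normal_functional m \<phi>" "\<And>x. \<phi> (left_regular x) = ?w x"
    "\<And>T. T \<in> VN m \<Longrightarrow> op_nrm m T \<le> 1 \<Longrightarrow> cmod (\<phi> T) \<le> ?B"
    using product_minus_state[OF assms] by blast
  have le: "cmod (duality m T ?w) \<le> ?B" if "T \<in> {T \<in> VN m. op_nrm m T = 1}" for T
    using duality_eq[OF \<phi>(1,2), of T] \<phi>(3)[of T] that by simp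
  have id: "(\<lambda>f. f) \<in> {T \<in> VN m. op_nrm m T = 1}"
    using id_VN op_nrm_id[OF h h1] by simp
  show "Fourier_nrm m ?w \<le> ?B"
    unfolding Fourier_nrm_def using id le by (intro cSUP_least) auto
  have "cmod (duality m (\<lambda>f. f) ?w) \<le> Fourier_nrm m ?w"
    unfolding Fourier_nrm_def using le by (intro cSUP_upper id bdd_aboveI2)
  then show "0 \<le> Fourier_nrm m ?w" using norm_ge_zero order_trans by blast
qed

end

text \<open>If {x} were open, {{x}} would be a finite basis, against minimality of the infinite
  weight. The second part enumerates a countable basis.\<close>

lemma local_weight_natLeq:
  assumes "local_weight_is (x :: 'a::topological_space) natLeq"
  shows "\<not> open {x}" and "\<exists>W. (\<forall>n::nat. open (W n) \<and> x \<in> W n) \<and>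
    (\<forall>O'. open O' \<longrightarrow> x \<in> O' \<longrightarrow> (\<forall>\<^sub>F n in sequentially. W n \<subseteq> O'))"
proof -
  obtain \<B> where B: "nhds_basis x \<B>" "|\<B>| =o natLeq" and min: "\<And>\<B>. nhds_basis x \<B> \<Longrightarrow> natLeq \<le>o |\<B>|"
    using assms by (auto simp: local_weight_is_def)
  show "\<not> open {x}"
  proof
    assume "open {x}"
    then have "nhds_basis x {{x}}" by (auto simp: nhds_basis_def interior_open)
    then have "natLeq \<le>o |{{x}}|" by (rule min)
    then have "infinite {{x}}" using infinite_iff_natLeq_ordLeq by blast
    then show False by simp
  qed
  have "countable \<B>"
  proof -
    have "|\<B>| =o |UNIV :: nat set|"
      using B(2) card_of_nat ordIso_symmetric ordIso_transitive by blast
    then obtain f :: "'a set \<Rightarrow> nat" where "bij_betw f \<B> UNIV" using card_of_ordIso by blast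
    then show ?thesis by (auto intro: countableI simp: bij_betw_def)
  qed
  moreover have "\<B> \<noteq> {}" using B(1) unfolding nhds_basis_def by (metis empty_iff open_UNIV UNIV_I)
  ultimately obtain b :: "nat \<Rightarrow> 'a set" where b: "range b = \<B>" by (metis range_from_nat_into)
  \<comment> \<open>Intersecting the first n + 1 members makes the sequence decreasing, so it is
    eventually inside every neighbourhood; interiors make it open.\<close>
  define W where "W n = (\<Inter>k\<le>n. interior (b k))" for n
  have "open (W n)" "x \<in> W n" for n
    using B(1) b by (auto simp: W_def nhds_basis_def)
  moreover have "\<forall>\<^sub>F n in sequentially. W n \<subseteq> O'" if O': "open O'" "x \<in> O'" for O'
  proof -
    obtain k where "b k \<subseteq> O'" using B(1) O' b unfolding nhds_basis_def by (metis rangeE)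
    then have "W n \<subseteq> O'" if "k \<le> n" for n
      using that interior_subset[of "b k"] unfolding W_def by blast
    then show ?thesis by (auto simp: eventually_sequentially)
  qed
  ultimately show "\<exists>W. (\<forall>n::nat. open (W n) \<and> x \<in> W n) \<and>
    (\<forall>O'. open O' \<longrightarrow> x \<in> O' \<longrightarrow> (\<forall>\<^sub>F n in sequentially. W n \<subseteq> O'))" by blast
qed

theorem mainTheorem6:
  fixes m :: "'a::{topological_group_add, t2_space} measure"
  assumes "locally_compact_space (euclidean :: 'a topology)"
    and "left_Haar_measure m"
    and "local_weight_is (0::'a) natLeq"
  shows "\<exists>u. TI_sequence m u \<and> orthogonal_sequence m u"
proof -
  interpret haar m by unfold_locales (rule assms(2))
  obtain W :: "nat \<Rightarrow> 'a set" where W: "\<And>n. open (W n)" "\<And>n. 0 \<in> W n"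
    "\<And>O'. open O' \<Longrightarrow> 0 \<in> O' \<Longrightarrow> \<forall>\<^sub>F n in sequentially. W n \<subseteq> O'"
    using local_weight_natLeq(2)[OF assms(3)] by blast
  obtain P h U where P: "\<And>n. negligible_projection (P n)" and PP: "\<And>i j F. i \<noteq> j \<Longrightarrow> P i (P j F) = 0"
    and h: "\<And>n. h n \<in> L2 m" "\<And>n. L2_nrm m (h n) = 1" and Ph: "\<And>n. P n (embed m 0 (h n)) = embed m 0 (h n)"
    and U: "\<And>n. small_nhd (U n)" "\<And>n. U n \<subseteq> W n" and near: "\<And>n. norm (embed m 0 (h n) - chi (U n)) \<le> 1 / Suc n"
    by (rule orthogonal_concentrated_sequence[OF assms(1) local_weight_natLeq(1)[OF assms(3)] W(1,2)]) (rule that)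
  have U_ev: "\<forall>\<^sub>F n in sequentially. U n \<subseteq> O'" if "open O'" "0 \<in> O'" for O'
    using W(3)[OF that] by (rule eventually_mono) (use U(2) in blast)
  note spread0 = spread_tendsto_zero[OF _ h U(1) U_ev near]
  define u where "u n = coeff_fun m (h n) (h n)" for n
  have state: "u n \<in> normal_states m" for n
    unfolding u_def by (rule vector_state_normal_state[OF h])
  have "(\<lambda>n. Fourier_nrm m (\<lambda>x. v x * u n x - u n x)) \<longlonglongrightarrow> 0" if v: "v \<in> normal_states m" for v
  proof -
    obtain f g where fg: "f \<in> L2 m" "g \<in> L2 m" "v = coeff_fun m f g"
      using v by (auto simp: normal_states_def Fourier_algebra_def)
    \<comment> \<open>This is the normalisation v(e) = 1, since translation by 0 is the
      identity.\<close>
    have "L2_inner m f g = 1" using v by (simp add: normal_states_def fg(3) coeff_fun_def)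
    note bounds = Fourier_nrm_product_minus_state[OF fg(1,2) this h]
    have "(\<lambda>n. 2 * (sqrt (spread f (h n)) * L2_nrm m g + L2_nrm m f * sqrt (spread g (h n))))
        \<longlonglongrightarrow> 2 * (sqrt 0 * L2_nrm m g + L2_nrm m f * sqrt 0)"
      by (intro tendsto_intros spread0 fg)
    then have "(\<lambda>n. 2 * (sqrt (spread f (h n)) * L2_nrm m g + L2_nrm m f * sqrt (spread g (h n)))) \<longlonglongrightarrow> 0"
      by simp
    then show ?thesis
      unfolding u_def fg(3)
      by (rule tendsto_sandwich[OF _ _ tendsto_const, rotated -1])
        (intro always_eventually allI bounds)+
  qed
  then have "TI_sequence m u" using state by (simp add: TI_sequence_def)
  moreover have "orthogonal_states m (u i) (u j)" if "i \<noteq> j" for i j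
  proof -
    let ?p = "\<lambda>n. restr_op m 0 0 (P n)"
    note c = negligible_projectionD(1)[OF P]
    have p: "?p n \<in> VN_projections m" for n
      by (intro restr_op_projection negligible_projectionD[OF P])
    \<comment> \<open>\<open>P n\<close> fixes \<open>h n\<close>, so \<open>?p n\<close> has the
      value <h n, h n> = 1 in the state \<open>u n\<close>, whose support therefore lies below
      it.\<close>
    have dual: "duality m (?p n) (u n) = 1" for n
    proof -
      have "L2_eq m (?p n (h n)) (h n)"
      proof -
        have "embed m 0 (?p n (h n)) = embed m 0 (h n)"
          by (simp only: embed_restr_op[OF c h(1)] Ph)
        then show ?thesis by (subst L2_eq_via_embed) (simp_all add: restr_op_def h)
      qed
      then have "L2_inner m (?p n (h n)) (h n) = L2_inner m (h n) (h n)"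
        by (intro L2_inner_cong) (simp_all add: h restr_op_def)
      then show ?thesis
        unfolding u_def using VN_projectionsD(1)[OF p] h by (simp add: duality_coeff_fun L2_inner_self)
    qed
    have "L2_eq m (?p i (?p j f)) (\<lambda>_. 0)" if "f \<in> L2 m" for f
    proof -
      have pL2: "?p n k \<in> L2 m" for n k by (simp add: restr_op_def)
      have "embed m 0 (?p i (?p j f)) = 0"
        using that PP[OF \<open>i \<noteq> j\<close>] by (simp add: embed_restr_op[OF c] pL2)
      then show ?thesis using pL2 by (simp add: L2_eq_via_embed embed_zero)
    qed
    then show ?thesis by (rule orthogonal_states_of_projections[OF p dual p dual])
  qed
  ultimately show ?thesis by (auto simp: orthogonal_sequence_def)
qed

end
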